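(* Assume that $f$ is $\mu$-quasi strongly convex, $\mu\ge0$, and the functions $f_{ij}$ are convex and $L$-smooth for all $i\in\{1,\dots,n\}$, $j\in\{1,\dots,m\}$. Consider D-QLSVRGstar with delay $\tau\ge1$, $p\in(0,1)$ and $$0<\gamma\le\min\left\{\frac3{56L\left(1+\frac{2\omega}n\right)},\ \frac1{8L\sqrt{\tau\left(\tau+2\left(1+\frac{2\omega}n\right)\left(1+\frac2{1-p}\right)\right)}}\right\}.$$ Then D-QLSVRGstar satisfies the parametric assumption of the context with $A'=2L\left(1+\frac{2\omega}n\right)$, $B_1'=0$, $B_2'=2\left(1+\frac{2\omega}n\right)$, $D_1'=0$, $\sigma_{1,k}^2\equiv0$, $\sigma_{2,k}^2=\sigma_k^2=\frac1{nm}\sum_{i=1}^n\sum_{j=1}^m\|\nabla f_{ij}(w_i^k)-\nabla f_{ij}(x^* )\|^2$, $\rho_1=1$, $\rho_2=p$, $C_1=0$, $C_2=Lp$, $D_2=0$, $G=0$, $F_1=0$, $F_2=\frac{12\gamma^2L\tau(1+\frac{2\omega}n)(2+p)}p$, $D_3=0$. Moreover, with $M_2=\frac{8(1+\frac{2\omega}n)}{3p}$ and $T^0=\|x^0-x^*\|^2+M_2\gamma^2\sigma_0^2$, for all $K\ge0$ $$\mathbf E[f(\bar x^K)-f(x^* )]\le\left(1-\min\left\{\frac{\gamma\mu}2,\frac p4\right\}\right)^K\frac{4(T^0+\gamma F_2\sigma_0^2)}\gamma$$ when $\mu>0$, and $$\mathbf E[f(\bar x^K)-f(x^* )]\le\frac{4(T^0+\gamma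 F_2\sigma_0^2)}{\gamma K}$$ when $\mu=0$ (right-hand side read as $+\infty$ for $K=0$).
   Context: $f(x)=\frac1n\sum_{i=1}^nf_i(x)$, $f_i(x)=\frac1m\sum_{j=1}^mf_{ij}(x)$ on $\mathbb R^d$. A function is $L$-smooth if it is differentiable with $L$-Lipschitz gradient. $f$ is $\mu$-quasi strongly convex if it has a unique minimizer $x^*$ and $f(x^* )\ge f(x)+\langle\nabla f(x),x^*-x\rangle+\frac\mu2\|x-x^*\|^2$ for all $x$. $Q$ is a randomized quantization operator with $\mathbf E[Q(x)]=x$, $\mathbf E\|Q(x)-x\|^2\le\omega\|x\|^2$ for all $x$, $\omega>0$. All random choices use fresh independent randomness. Delayed framework with integer delay $\tau\ge1$: $x^{k+1}=x^k-\frac1n\sum_iv_i^k$, where $v_i^k=\gamma g_i^{k-\tau}$ if $k\ge\tau$ and $v_i^k=0$ if $k<\tau$; $e_i^{k+1}=e_i^k+\gamma g_i^k-v_i^k$, $e_i^0=0$; $x^0$ deterministic. Here $g_i^k$ is the stochastic vector associated with the point $x^k$. D-QLSVRGstar: given deterministic $w_i^0\in\mathbb R^d$; for $k\ge0$ worker $i$ picks $l$ uniformly from $\{1,\dots,m\}$, sets $\hat g_i^k=\nabla f_{il}(x^k)-\nabla f_{il}(w_i^k)+\nabla f_i(w_i^k)$, $g_i^k=Q(\hat g_i^k-\nabla f_i(x^* ))$, and $w_i^{k+1}=x^k$ with probability $p$, $w_i^{k+1}=w_i^k$ with probability $1-p$. Parametric assumption: let $g^k=\frac1n\sum_ig_i^k$,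 $e^k=\frac1n\sum_ie_i^k$, $\mathbf E_k$ the conditional expectation given $x^k$ and all randomness used to generate $g_i^t,w_i^{t+1}$ for $t<k$. For all $k,K\ge0$: $\mathbf E_k[g^k]=\nabla f(x^k)$; $\mathbf E_k\|g^k\|^2\le2A'(f(x^k)-f(x^* ))+B_1'\sigma_{1,k}^2+B_2'\sigma_{2,k}^2+D_1'$; $\mathbf E_k[\sigma_{1,k+1}^2]\le(1-\rho_1)\sigma_{1,k}^2+2C_1(f(x^k)-f(x^* ))+G\rho_1\sigma_{2,k}^2+D_2$; $\mathbf E_k[\sigma_{2,k+1}^2]\le(1-\rho_2)\sigma_{2,k}^2+2C_2(f(x^k)-f(x^* ))$; $3L\sum_{k=0}^Kw_k\mathbf E\|e^k\|^2\le\frac14\sum_{k=0}^Kw_k\mathbf E[f(x^k)-f(x^* )]+F_1\sigma_{1,0}^2+F_2\sigma_{2,0}^2+\gamma D_3W_K$, where (scalar weights) $w_k=(1-\eta)^{-(k+1)}$, $W_K=\sum_{k=0}^Kw_k$, $\eta=\min\{\frac{\gamma\mu}2,\frac{\rho_1}4,\frac{\rho_2}4\}$. Also $\bar x^K=\frac1{W_K}\sum_{k=0}^Kw_kx^k$. *)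

theory Defs
  imports "HOL-Probability.Probability"
begin

definition gradient :: "('a::real_inner \<Rightarrow> real) \<Rightarrow> 'a \<Rightarrow> 'a" where
  "gradient f x = (THE D. GDERIV f x :> D)"

lemma gradient_eqI:
  fixes f :: "'a::real_inner \<Rightarrow> real"
  assumes "GDERIV f x :> D"
  shows "gradient f x = D"
  unfolding gradient_def
proof (rule the_equality)
  show "GDERIV f x :> D" by (fact assms)
next
  fix D' assume "GDERIV f x :> D'"
  then have "(\<lambda>h. inner h D') = (\<lambda>h. inner h D)"
    using assms has_derivative_unique unfolding gderiv_def by blast
  then show "D' = D"
    by (metis inner_commute vector_eq_ldot)
qed

definition L_smooth :: "real \<Rightarrow> ('a::euclidean_space \<Rightarrow> real) \<Rightarrow> bool" where
  "L_smooth L f \<longleftrightarrow> (\<forall>x. f differentiable (at x)) \<and> L-lipschitz_on UNIV (gradient f)"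

definition unique_minimizer :: "('a \<Rightarrow> real) \<Rightarrow> 'a \<Rightarrow> bool" where
  "unique_minimizer f xs \<longleftrightarrow> (\<forall>x. f xs \<le> f x) \<and> (\<forall>y. (\<forall>x. f y \<le> f x) \<longrightarrow> y = xs)"

definition quasi_strongly_convex ::
    "real \<Rightarrow> ('a::euclidean_space \<Rightarrow> real) \<Rightarrow> 'a \<Rightarrow> bool" where
  "quasi_strongly_convex \<mu> f xs \<longleftrightarrow> unique_minimizer f xs \<and>
     (\<forall>x. f xs \<ge> f x + inner (gradient f x) (xs - x) + \<mu> / 2 * (norm (x - xs))\<^sup>2)"

definition f_local :: "nat \<Rightarrow> (nat \<Rightarrow> nat \<Rightarrow> 'a \<Rightarrow> real) \<Rightarrow> nat \<Rightarrow> 'a \<Rightarrow> real" where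
  "f_local m F i x = 1 / real m * (\<Sum>j\<in>{1..m}. F i j x)"

definition f_global :: "nat \<Rightarrow> nat \<Rightarrow> (nat \<Rightarrow> nat \<Rightarrow> 'a \<Rightarrow> real) \<Rightarrow> 'a \<Rightarrow> real" where
  "f_global n m F x = 1 / real n * (\<Sum>i\<in>{1..n}. f_local m F i x)"

text \<open>A randomized operator is a map \<open>Q\<close> taking a random seed, distributed according to
  \<open>S\<close>, and a point. The integrability clauses are needed because the Bochner integral of a
  non-integrable function is 0.\<close>

definition quantization :: "real \<Rightarrow> 's measure \<Rightarrow> ('s \<Rightarrow> 'a::euclidean_space \<Rightarrow> 'a) \<Rightarrow> bool" where
  "quantization \<omega> S Q \<longleftrightarrow> prob_space S \<and>
     (\<lambda>(q, y). Q q y) \<in> borel_measurable (S \<Otimes>\<^sub>M borel) \<and>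
     (\<forall>y. integrable S (\<lambda>q. Q q y) \<and> (\<integral>q. Q q y \<partial>S) = y) \<and>
     (\<forall>y. integrable S (\<lambda>q. (norm (Q q y - y))\<^sup>2) \<and>
          (\<integral>q. (norm (Q q y - y))\<^sup>2 \<partial>S) \<le> \<omega> * (norm y)\<^sup>2)"

text \<open>Law of the triple (component index, quantization seed, coin) drawn by one worker in one
  iteration; its three components are independent. The index is in \<open>{1..m}\<close> surely,
  not only almost surely, so that no \<open>F i l\<close> outside this range is ever evaluated.\<close>

definition round_law :: "nat \<Rightarrow> 's measure \<Rightarrow> real \<Rightarrow> (nat \<times> 's \<times> bool) measure" where
  "round_law m S p =
     uniform_count_measure {1..m} \<Otimes>\<^sub>M S \<Otimes>\<^sub>M measure_pmf (bernoulli_pmf p)"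

definition draws ::
    "(nat \<Rightarrow> nat \<Rightarrow> 'o \<Rightarrow> nat) \<Rightarrow> (nat \<Rightarrow> nat \<Rightarrow> 'o \<Rightarrow> 's) \<Rightarrow> (nat \<Rightarrow> nat \<Rightarrow> 'o \<Rightarrow> bool)
      \<Rightarrow> nat \<Rightarrow> nat \<Rightarrow> 'o \<Rightarrow> nat \<times> 's \<times> bool" where
  "draws idx seed coin i k s = (idx i k s, seed i k s, coin i k s)"

definition fresh_randomness ::
    "'o measure \<Rightarrow> 's measure \<Rightarrow> nat \<Rightarrow> nat \<Rightarrow> real
      \<Rightarrow> (nat \<Rightarrow> nat \<Rightarrow> 'o \<Rightarrow> nat) \<Rightarrow> (nat \<Rightarrow> nat \<Rightarrow> 'o \<Rightarrow> 's) \<Rightarrow> (nat \<Rightarrow> nat \<Rightarrow> 'o \<Rightarrow> bool)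
      \<Rightarrow> bool" where
  "fresh_randomness M S n m p idx seed coin \<longleftrightarrow> prob_space M \<and>
     prob_space.indep_vars M (\<lambda>_. round_law m S p)
       (\<lambda>(i, k). draws idx seed coin i k) ({1..n} \<times> UNIV) \<and>
     (\<forall>i\<in>{1..n}. \<forall>k. distr M (round_law m S p) (draws idx seed coin i k) = round_law m S p)"

text \<open>The sigma-algebra generated by \<open>x\<^sup>k\<close> and all draws of all workers in the
  iterations \<open>t < k\<close>.\<close>

definition history ::
    "'o measure \<Rightarrow> 'b measure \<Rightarrow> nat \<Rightarrow> (nat \<Rightarrow> nat \<Rightarrow> 'o \<Rightarrow> 'b)
      \<Rightarrow> (nat \<Rightarrow> 'o \<Rightarrow> 'a::euclidean_space) \<Rightarrow> nat \<Rightarrow> 'o measure" where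
  "history M D n Z x k = sigma (space M)
     ({x k -` B \<inter> space M | B. B \<in> sets borel} \<union>
      (\<Union>i\<in>{1..n}. \<Union>t\<in>{..<k}. {Z i t -` A \<inter> space M | A. A \<in> sets D}))"

text \<open>Conditional expectation of a vector, coordinate by coordinate.\<close>

definition vec_cond_exp ::
    "'o measure \<Rightarrow> 'o measure \<Rightarrow> ('o \<Rightarrow> 'a::euclidean_space) \<Rightarrow> 'o \<Rightarrow> 'a" where
  "vec_cond_exp M H X s = (\<Sum>b\<in>Basis. real_cond_exp M H (\<lambda>s. inner (X s) b) s *\<^sub>R b)"

definition worker_mean :: "nat \<Rightarrow> (nat \<Rightarrow> nat \<Rightarrow> 'o \<Rightarrow> 'a::real_vector) \<Rightarrow> nat \<Rightarrow> 'o \<Rightarrow> 'a" where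
  "worker_mean n g k s = (1 / real n) *\<^sub>R (\<Sum>i\<in>{1..n}. g i k s)"

definition delayed_framework ::
    "'o measure \<Rightarrow> nat \<Rightarrow> nat \<Rightarrow> real \<Rightarrow> 'a::euclidean_space \<Rightarrow> (nat \<Rightarrow> 'o \<Rightarrow> 'a)
      \<Rightarrow> (nat \<Rightarrow> nat \<Rightarrow> 'o \<Rightarrow> 'a) \<Rightarrow> (nat \<Rightarrow> nat \<Rightarrow> 'o \<Rightarrow> 'a) \<Rightarrow> (nat \<Rightarrow> nat \<Rightarrow> 'o \<Rightarrow> 'a) \<Rightarrow> bool" where
  "delayed_framework M n \<tau> \<gamma> x0 x g v e \<longleftrightarrow> (\<forall>s\<in>space M.
     x 0 s = x0 \<and>
     (\<forall>k. x (Suc k) s = x k s - worker_mean n v k s) \<and>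
     (\<forall>i\<in>{1..n}. e i 0 s = 0 \<and>
       (\<forall>k. v i k s = (if k \<ge> \<tau> then \<gamma> *\<^sub>R g i (k - \<tau>) s else 0) \<and>
            e i (Suc k) s = e i k s + \<gamma> *\<^sub>R g i k s - v i k s)))"

definition qlsvrgstar_estimator ::
    "'o measure \<Rightarrow> nat \<Rightarrow> nat \<Rightarrow> (nat \<Rightarrow> nat \<Rightarrow> 'a::euclidean_space \<Rightarrow> real) \<Rightarrow> 'a
      \<Rightarrow> ('s \<Rightarrow> 'a \<Rightarrow> 'a) \<Rightarrow> (nat \<Rightarrow> 'a)
      \<Rightarrow> (nat \<Rightarrow> nat \<Rightarrow> 'o \<Rightarrow> nat) \<Rightarrow> (nat \<Rightarrow> nat \<Rightarrow> 'o \<Rightarrow> 's) \<Rightarrow> (nat \<Rightarrow> nat \<Rightarrow> 'o \<Rightarrow> bool)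
      \<Rightarrow> (nat \<Rightarrow> 'o \<Rightarrow> 'a) \<Rightarrow> (nat \<Rightarrow> nat \<Rightarrow> 'o \<Rightarrow> 'a) \<Rightarrow> (nat \<Rightarrow> nat \<Rightarrow> 'o \<Rightarrow> 'a) \<Rightarrow> bool" where
  "qlsvrgstar_estimator M n m F xs Q w0 idx seed coin x g w \<longleftrightarrow>
     (\<forall>s\<in>space M. \<forall>i\<in>{1..n}.
       w i 0 s = w0 i \<and>
       (\<forall>k. let l = idx i k s;
                ghat = gradient (F i l) (x k s) - gradient (F i l) (w i k s)
                       + gradient (f_local m F i) (w i k s)
            in g i k s = Q (seed i k s) (ghat - gradient (f_local m F i) xs)) \<and>
       (\<forall>k. w i (Suc k) s = (if coin i k s then x k s else w i k s)))"

definition sigma_sq ::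
    "nat \<Rightarrow> nat \<Rightarrow> (nat \<Rightarrow> nat \<Rightarrow> 'a::euclidean_space \<Rightarrow> real) \<Rightarrow> 'a \<Rightarrow> (nat \<Rightarrow> 'a) \<Rightarrow> real" where
  "sigma_sq n m F xs u = 1 / (real n * real m) *
     (\<Sum>i\<in>{1..n}. \<Sum>j\<in>{1..m}. (norm (gradient (F i j) (u i) - gradient (F i j) xs))\<^sup>2)"

definition eta :: "real \<Rightarrow> real \<Rightarrow> real \<Rightarrow> real \<Rightarrow> real" where
  "eta \<gamma> \<mu> \<rho>1 \<rho>2 = min (\<gamma> * \<mu> / 2) (min (\<rho>1 / 4) (\<rho>2 / 4))"

definition weight :: "real \<Rightarrow> nat \<Rightarrow> real" where
  "weight \<eta> k = 1 / (1 - \<eta>) ^ (k + 1)"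

definition weight_sum :: "real \<Rightarrow> nat \<Rightarrow> real" where
  "weight_sum \<eta> K = (\<Sum>k=0..K. weight \<eta> k)"

definition weighted_average ::
    "real \<Rightarrow> (nat \<Rightarrow> 'o \<Rightarrow> 'a::real_vector) \<Rightarrow> nat \<Rightarrow> 'o \<Rightarrow> 'a" where
  "weighted_average \<eta> x K s =
     (1 / weight_sum \<eta> K) *\<^sub>R (\<Sum>k=0..K. weight \<eta> k *\<^sub>R x k s)"

text \<open>Here \<open>H k\<close> is the sigma-algebra conditioned on at step \<open>k\<close>, and \<open>\<sigma>1 k\<close>, \<open>\<sigma>2 k\<close>
  stand for the squared quantities \<open>\<sigma>\<^sub>1\<^sub>,\<^sub>k\<^sup>2\<close>, \<open>\<sigma>\<^sub>2\<^sub>,\<^sub>k\<^sup>2\<close>.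
  The integrability clauses make every (conditional) expectation a genuine one.\<close>

definition parametric_assumption ::
    "'o measure \<Rightarrow> (nat \<Rightarrow> 'o measure) \<Rightarrow> ('a::euclidean_space \<Rightarrow> real) \<Rightarrow> 'a
      \<Rightarrow> real \<Rightarrow> real \<Rightarrow> real
      \<Rightarrow> (nat \<Rightarrow> 'o \<Rightarrow> 'a) \<Rightarrow> (nat \<Rightarrow> 'o \<Rightarrow> 'a) \<Rightarrow> (nat \<Rightarrow> 'o \<Rightarrow> 'a)
      \<Rightarrow> (nat \<Rightarrow> 'o \<Rightarrow> real) \<Rightarrow> (nat \<Rightarrow> 'o \<Rightarrow> real)
      \<Rightarrow> real \<Rightarrow> real \<Rightarrow> real \<Rightarrow> real
      \<Rightarrow> real \<Rightarrow> real \<Rightarrow> real \<Rightarrow> real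
      \<Rightarrow> real \<Rightarrow> real
      \<Rightarrow> real \<Rightarrow> real \<Rightarrow> real \<Rightarrow> bool" where
  "parametric_assumption M H f xs L \<mu> \<gamma> x g e \<sigma>1 \<sigma>2
      A' B1' B2' D1' \<rho>1 \<rho>2 C1 C2 G D2 F1 F2 D3 \<longleftrightarrow>
    (\<forall>k. integrable M (g k)
       \<and> integrable M (\<lambda>s. (norm (g k s))\<^sup>2)
       \<and> integrable M (\<sigma>1 k) \<and> integrable M (\<sigma>2 k)
       \<and> integrable M (\<lambda>s. f (x k s) - f xs)
       \<and> integrable M (\<lambda>s. (norm (e k s))\<^sup>2)) \<and>
    (\<forall>k. \<forall>s\<in>space M. 0 \<le> \<sigma>1 k s \<and> 0 \<le> \<sigma>2 k s) \<and>
    (\<forall>k. AE s in M. vec_cond_exp M (H k) (g k) s = gradient f (x k s)) \<and>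
    (\<forall>k. AE s in M. real_cond_exp M (H k) (\<lambda>s. (norm (g k s))\<^sup>2) s
        \<le> 2 * A' * (f (x k s) - f xs) + B1' * \<sigma>1 k s + B2' * \<sigma>2 k s + D1') \<and>
    (\<forall>k. AE s in M. real_cond_exp M (H k) (\<sigma>1 (Suc k)) s
        \<le> (1 - \<rho>1) * \<sigma>1 k s + 2 * C1 * (f (x k s) - f xs) + G * \<rho>1 * \<sigma>2 k s + D2) \<and>
    (\<forall>k. AE s in M. real_cond_exp M (H k) (\<sigma>2 (Suc k)) s
        \<le> (1 - \<rho>2) * \<sigma>2 k s + 2 * C2 * (f (x k s) - f xs)) \<and>
    (let \<eta> = eta \<gamma> \<mu> \<rho>1 \<rho>2 in
      \<forall>K. AE s in M. 3 * L * (\<Sum>k=0..K. weight \<eta> k * (\<integral>r. (norm (e k r))\<^sup>2 \<partial>M))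
        \<le> 1 / 4 * (\<Sum>k=0..K. weight \<eta> k * (\<integral>r. f (x k r) - f xs \<partial>M))
          + F1 * \<sigma>1 0 s + F2 * \<sigma>2 0 s + \<gamma> * D3 * weight_sum \<eta> K)"

end

theory Submission
  imports Defs
begin

text \<open>
  \<^emph>\<open>Idea of the proof.\<close> Delay is treated as error feedback. The averaged error \<open>e_mean k\<close> consists of
  the at most \<open>\<tau>\<close> steps that have been computed but not yet applied (\<open>e_window\<close>), so the corrected
  iterate \<open>x k - e_mean k\<close> performs undelayed stochastic gradient steps, with the only defect that the
  gradient is evaluated at \<open>x k\<close>. One step of it contracts the squared distance to the
  minimiser up to \<open>3 * L * \<gamma>\<close> times the squared error and \<open>\<gamma>\<^sup>2\<close> times the second moment of the
  estimator (\<open>dist_sq_Suc\<close>).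

  The second moment is variance reduced. Conditionally on the past the estimator is unbiased, and
  since the workers draw independently, its second moment is at most a constant times the function gap
  plus a constant times \<open>sig k\<close>, the mean squared gradient difference between the reference points and
  the minimiser (\<open>mean_quantized_draws\<close>, \<open>second_moment_centred\<close>, \<open>g_mean_cond\<close>).
  In turn \<open>sig\<close> contracts by the factor \<open>1 - p\<close> up to a multiple of the gap
  (\<open>sig_cond\<close>). Both estimates come from the co-coercivity of gradients of smooth convex functions
  (\<open>convex_L_smooth_bregman\<close>); conditional expectations are computed by integrating the fresh draws
  while the past is kept fixed (\<open>real_cond_exp_freezing\<close>).

  The squared error is bounded by the terms of the window that it sums: gradients by Cauchy-Schwarz,
  noises by orthogonality of martingale differences (\<open>mean_err_le\<close>). As the step size is of order
  \<open>1 / (L * \<tau>)\<close>, the weights are nearly constant over a window, and the weighted sum of the errors is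
  at most a quarter of the weighted sum of the gaps plus an initial term (\<open>error_sum\<close>).
  Adding a multiple of \<open>sig\<close> to the squared distance gives a Lyapunov function
  (\<open>lyapunov_Suc\<close>); telescoping it with the weights and absorbing the errors bounds the weighted sum of
  the gaps (\<open>gap_sum\<close>). Jensen's inequality passes to the averaged iterate, and the growth of the total
  weight gives the two rates.
\<close>

section \<open>Smooth convex functions\<close>

lemma L_smooth_GDERIV:
  assumes "L_smooth L f"
  shows "GDERIV f x :> gradient f x"
proof -
  obtain D where D: "(f has_derivative D) (at x)"
    using assms unfolding L_smooth_def differentiable_def by blast
  then have lin: "linear D" by (rule has_derivative_linear)
  have "D h = inner h (\<Sum>b\<in>Basis. D b *\<^sub>R b)" for h
  proof -
    have "D h = D (\<Sum>b\<in>Basis. (inner h b) *\<^sub>R b)" by (simp add: euclidean_representation)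
    also have "\<dots> = (\<Sum>b\<in>Basis. inner h b * D b)"
      using lin by (simp add: linear_sum linear_scale)
    finally show ?thesis by (simp add: inner_sum_right mult.commute)
  qed
  then have "D = (\<lambda>h. inner h (\<Sum>b\<in>Basis. D b *\<^sub>R b))" by (rule ext)
  with D have *: "GDERIV f x :> (\<Sum>b\<in>Basis. D b *\<^sub>R b)" unfolding gderiv_def by (simp flip: \<open>D = _\<close>)
  show ?thesis unfolding gradient_eqI[OF *] by (rule *)
qed

lemma L_smooth_gradient_lipschitz:
  assumes "L_smooth L f"
  shows "norm (gradient f x - gradient f y) \<le> L * norm (x - y)"
  using assms unfolding L_smooth_def lipschitz_on_def by (auto simp: dist_norm)

lemma L_smooth_nonneg: "L_smooth L f \<Longrightarrow> 0 \<le> L"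
  unfolding L_smooth_def lipschitz_on_def by auto

lemma continuous_on_L_smooth: "L_smooth L f \<Longrightarrow> continuous_on UNIV f"
  unfolding L_smooth_def
  by (simp add: differentiable_imp_continuous_within continuous_at_imp_continuous_on)

lemma continuous_on_gradient: "L_smooth L f \<Longrightarrow> continuous_on UNIV (gradient f)"
  unfolding L_smooth_def by (blast intro: lipschitz_on_continuous_on)

lemma GDERIV_along_line:
  assumes "\<And>z. GDERIV f z :> gradient f z"
  shows "((\<lambda>t. f (x + t *\<^sub>R d)) has_real_derivative inner d (gradient f (x + t *\<^sub>R d))) (at t within A)"
proof -
  have "((\<lambda>t. f (x + t *\<^sub>R d)) has_derivative
          (\<lambda>h. inner (h *\<^sub>R d) (gradient f (x + t *\<^sub>R d)))) (at t within A)"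
  proof (rule has_derivative_compose[where g = f])
    show "((\<lambda>t. x + t *\<^sub>R d) has_derivative (\<lambda>h. h *\<^sub>R d)) (at t within A)"
      by (auto intro!: derivative_eq_intros)
    show "(f has_derivative (\<lambda>h. inner h (gradient f (x + t *\<^sub>R d)))) (at (x + t *\<^sub>R d))"
      using assms unfolding gderiv_def by blast
  qed
  then show ?thesis
    by (simp add: has_field_derivative_def mult_commute_abs)
qed

lemma L_smooth_upper_bound:
  assumes "L_smooth L f"
  shows "f y \<le> f x + inner (gradient f x) (y - x) + L / 2 * (norm (y - x))\<^sup>2"
proof -
  define d where "d = y - x"
  define \<phi> where "\<phi> t = f (x + t *\<^sub>R d) - t * inner d (gradient f x) - L / 2 * t\<^sup>2 * (norm d)\<^sup>2" for t
  have der: "(\<phi> has_real_derivative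
      inner d (gradient f (x + t *\<^sub>R d)) - inner d (gradient f x) - L * t * (norm d)\<^sup>2) (at t)" for t
    unfolding \<phi>_def
    by (rule derivative_eq_intros GDERIV_along_line L_smooth_GDERIV[OF assms] refl)+
       (simp add: field_simps)
  have "\<phi> 1 \<le> \<phi> 0"
  proof (rule DERIV_nonpos_imp_nonincreasing[of 0 1])
    fix t :: real assume t: "0 \<le> t" "t \<le> 1"
    have "inner d (gradient f (x + t *\<^sub>R d) - gradient f x)
        \<le> norm d * norm (gradient f (x + t *\<^sub>R d) - gradient f x)"
      by (rule norm_cauchy_schwarz)
    also have "\<dots> \<le> norm d * (L * (t * norm d))"
      using L_smooth_gradient_lipschitz[OF assms, of "x + t *\<^sub>R d" x] t
      by (intro mult_left_mono) auto
    finally have "inner d (gradient f (x + t *\<^sub>R d)) - inner d (gradient f x) - L * t * (norm d)\<^sup>2 \<le> 0"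
      by (simp add: inner_diff_right power2_eq_square mult_ac)
    then show "\<exists>y. (\<phi> has_real_derivative y) (at t) \<and> y \<le> 0" using der by blast
  qed simp
  then show ?thesis by (simp add: \<phi>_def d_def inner_commute)
qed

lemma convex_gradient_inequality:
  fixes f :: "'a::euclidean_space \<Rightarrow> real"
  assumes cvx: "convex_on UNIV f" and "\<And>z. GDERIV f z :> gradient f z"
  shows "f x + inner (gradient f x) (y - x) \<le> f y"
proof -
  define \<phi> where "\<phi> t = f (x + t *\<^sub>R (y - x))" for t :: real
  have "convex_on UNIV \<phi>"
  proof (rule convex_onI)
    fix t u v :: real assume "0 < t" "t < 1"
    have "x + ((1 - t) *\<^sub>R u + t *\<^sub>R v) *\<^sub>R (y - x)
        = (1 - t) *\<^sub>R (x + u *\<^sub>R (y - x)) + t *\<^sub>R (x + v *\<^sub>R (y - x))"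
      by (simp add: algebra_simps)
    then show "\<phi> ((1 - t) *\<^sub>R u + t *\<^sub>R v) \<le> (1 - t) * \<phi> u + t * \<phi> v"
      unfolding \<phi>_def using cvx \<open>0 < t\<close> \<open>t < 1\<close>
      by (metis convex_onD UNIV_I less_eq_real_def)
  qed simp
  then have "\<phi> 1 - \<phi> 0 \<ge> inner (y - x) (gradient f (x + 0 *\<^sub>R (y - x))) * (1 - 0)"
    unfolding \<phi>_def
    by (rule convex_on_imp_above_tangent) (use GDERIV_along_line[OF assms(2), where x = x and t = 0 and d = "y - x"] in auto)
  then show ?thesis by (simp add: \<phi>_def inner_commute)
qed

text \<open>Let \<open>h z = f z - inner (gradient f y) z\<close>. By convexity \<open>y\<close> minimises \<open>h\<close>, while one gradient
  step of length \<open>1 / L\<close> from \<open>x\<close> lowers \<open>h\<close> by at least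
  \<open>(norm (gradient f x - gradient f y))\<^sup>2 / (2 * L)\<close>. The estimate compares the two.\<close>

lemma convex_L_smooth_bregman:
  fixes f :: "'a::euclidean_space \<Rightarrow> real"
  assumes "convex_on UNIV f" "L_smooth L f" "0 < L"
  shows "(norm (gradient f x - gradient f y))\<^sup>2 \<le> 2 * L * (f x - f y - inner (gradient f y) (x - y))"
proof -
  define d where "d = gradient f x - gradient f y"
  define z where "z = x - (1 / L) *\<^sub>R d"
  have "f y + inner (gradient f y) (z - y) \<le> f z"
    using assms L_smooth_GDERIV by (intro convex_gradient_inequality) auto
  also have "f z \<le> f x + inner (gradient f x) (z - x) + L / 2 * (norm (z - x))\<^sup>2"
    by (rule L_smooth_upper_bound) fact
  finally have *: "f y + inner (gradient f y) (z - y)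
      \<le> f x + inner (gradient f x) (z - x) + L / 2 * (norm (z - x))\<^sup>2" .
  have n: "L / 2 * (norm (z - x))\<^sup>2 = (norm d)\<^sup>2 / (2 * L)"
    using \<open>0 < L\<close> by (simp add: z_def power2_eq_square field_simps)
  have "inner (gradient f x) (z - x) - inner (gradient f y) (z - y)
      = inner d (z - x) - inner (gradient f y) (x - y)"
    by (simp add: d_def algebra_simps)
  also have "inner d (z - x) = - (norm d)\<^sup>2 / L"
    by (simp add: z_def power2_norm_eq_inner)
  finally have "0 \<le> f x - f y - (norm d)\<^sup>2 / L - inner (gradient f y) (x - y) + (norm d)\<^sup>2 / (2 * L)"
    using * n by linarith
  then have "(norm d)\<^sup>2 / (2 * L) \<le> f x - f y - inner (gradient f y) (x - y)"
    using \<open>0 < L\<close> by (simp add: field_simps)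
  then show ?thesis using \<open>0 < L\<close> by (simp add: field_simps d_def)
qed

lemma gradient_minimizer_eq_0:
  assumes "GDERIV f xs :> gradient f xs" "\<And>x. f xs \<le> f x"
  shows "gradient f xs = 0"
proof -
  have "(\<lambda>h. inner h (gradient f xs)) = (\<lambda>h. 0)"
    using assms unfolding gderiv_def
    by (intro differential_zero_maxmin[of xs UNIV f]) auto
  then have "inner (gradient f xs) (gradient f xs) = 0" by metis
  then show ?thesis by simp
qed

lemma GDERIV_weighted_sum:
  assumes "finite A" "\<And>i. i \<in> A \<Longrightarrow> GDERIV (f i) x :> D i"
  shows "GDERIV (\<lambda>x. c * (\<Sum>i\<in>A. f i x)) x :> c *\<^sub>R (\<Sum>i\<in>A. D i)"
  using assms unfolding gderiv_def
  by (auto intro!: derivative_eq_intros simp: inner_sum_right)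

lemma gradient_weighted_sum:
  assumes "finite A" "\<And>i. i \<in> A \<Longrightarrow> L_smooth L (f i)"
  shows "gradient (\<lambda>x. c * (\<Sum>i\<in>A. f i x)) x = c *\<^sub>R (\<Sum>i\<in>A. gradient (f i) x)"
  using assms by (intro gradient_eqI GDERIV_weighted_sum L_smooth_GDERIV) auto

lemma L_smooth_average:
  fixes f :: "'i \<Rightarrow> 'a::euclidean_space \<Rightarrow> real"
  assumes "finite A" "A \<noteq> {}" "\<And>i. i \<in> A \<Longrightarrow> L_smooth L (f i)"
  shows "L_smooth L (\<lambda>x. 1 / real (card A) * (\<Sum>i\<in>A. f i x))"
  unfolding L_smooth_def
proof (intro conjI allI)
  let ?g = "\<lambda>x. 1 / real (card A) * (\<Sum>i\<in>A. f i x)"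
  have card: "0 < real (card A)" using assms by (simp add: card_gt_0_iff)
  show "?g differentiable at x" for x
    using GDERIV_weighted_sum[of A f x "\<lambda>i. gradient (f i) x" "1 / real (card A)"]
      assms L_smooth_GDERIV
    unfolding gderiv_def differentiable_def by blast
  show "L-lipschitz_on UNIV (gradient ?g)"
  proof (rule lipschitz_onI)
    show "0 \<le> L" using assms L_smooth_nonneg by blast
    have grad: "gradient ?g z = (1 / real (card A)) *\<^sub>R (\<Sum>i\<in>A. gradient (f i) z)" for z
      using assms(1,3) by (rule gradient_weighted_sum)
    fix x y :: 'a
    have "norm (gradient ?g x - gradient ?g y)
        = 1 / real (card A) * norm (\<Sum>i\<in>A. gradient (f i) x - gradient (f i) y)"
      unfolding grad using card by (simp add: sum_subtractf flip: scaleR_diff_right)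
    also have "norm (\<Sum>i\<in>A. gradient (f i) x - gradient (f i) y) \<le> (\<Sum>i\<in>A. L * norm (x - y))"
      using assms by (intro sum_norm_le L_smooth_gradient_lipschitz) auto
    finally show "dist (gradient ?g x) (gradient ?g y) \<le> L * dist x y"
      using card by (simp add: dist_norm field_simps)
  qed
qed

lemma convex_on_weighted_sum:
  fixes f :: "'i \<Rightarrow> 'a::real_vector \<Rightarrow> real"
  assumes "finite A" "0 \<le> c" "\<And>i. i \<in> A \<Longrightarrow> convex_on UNIV (f i)"
  shows "convex_on UNIV (\<lambda>x. c * (\<Sum>i\<in>A. f i x))"
proof (rule convex_on_cmul[OF \<open>0 \<le> c\<close>])
  show "convex_on UNIV (\<lambda>x. \<Sum>i\<in>A. f i x)"
    using assms(1,3)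
  proof (induction A rule: finite_induct)
    case empty
    show ?case by (simp add: convex_on_def)
  next
    case (insert i A)
    then show ?case by (simp add: convex_on_add)
  qed
qed

text \<open>At distance 1 from the minimiser, quasi strong convexity bounds the function gap from above by
  \<open>inner (gradient f x) b - \<mu> / 2\<close>, and smoothness with convexity bounds it from below by
  \<open>(norm (gradient f x))\<^sup>2 / (2 * L)\<close>; completing the square gives the claim. A unit vector is
  available because a Euclidean space is never trivial.\<close>

lemma quasi_strongly_convex_le_L:
  fixes f :: "'a::euclidean_space \<Rightarrow> real"
  assumes qsc: "quasi_strongly_convex \<mu> f xs" and "convex_on UNIV f" "L_smooth L f" "0 < L"
  shows "\<mu> \<le> L"
proof -
  obtain b :: 'a where b: "b \<in> Basis" using nonempty_Basis by blast
  define x where "x = xs + b"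
  let ?g = "gradient f x"
  have min: "f xs \<le> f y" for y
    using qsc unfolding quasi_strongly_convex_def unique_minimizer_def by blast
  have "gradient f xs = 0"
    using assms by (intro gradient_minimizer_eq_0 L_smooth_GDERIV min)
  then have breg: "(norm ?g)\<^sup>2 \<le> 2 * L * (f x - f xs)"
    using convex_L_smooth_bregman[OF assms(2-4), of x xs] by simp
  have "f xs \<ge> f x + inner ?g (xs - x) + \<mu> / 2 * (norm (x - xs))\<^sup>2"
    using qsc unfolding quasi_strongly_convex_def by blast
  then have *: "\<mu> / 2 \<le> inner ?g b - (f x - f xs)"
    using b by (simp add: x_def)
  have "0 \<le> (norm (?g - L *\<^sub>R b))\<^sup>2" by simp
  also have "\<dots> = (norm ?g)\<^sup>2 - 2 * L * inner ?g b + L\<^sup>2"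
    using b unfolding power2_norm_eq_inner by (simp add: algebra_simps inner_commute power2_eq_square)
  finally have "2 * L * (inner ?g b - (f x - f xs)) \<le> L\<^sup>2"
    using breg by (simp add: algebra_simps)
  then have "L * (2 * (inner ?g b - (f x - f xs))) \<le> L * L"
    by (simp add: power2_eq_square mult_ac)
  then have "2 * (inner ?g b - (f x - f xs)) \<le> L"
    using \<open>0 < L\<close> mult_le_cancel_left_pos by blast
  then show ?thesis using * by simp
qed

section \<open>Averaging out fresh randomness\<close>

lemma (in prob_space) distr_identity_pair:
  assumes sub: "subalgebra M H" and Y: "Y \<in> M \<rightarrow>\<^sub>M N"
    and ind: "indep_set (sets H) (sigma_sets (space M) {Y -` A \<inter> space M | A. A \<in> sets N})"
  shows "distr M (H \<Otimes>\<^sub>M N) (\<lambda>s. (s, Y s)) = restr_to_subalg M H \<Otimes>\<^sub>M distr M N Y"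
proof (rule pair_measure_eqI[symmetric])
  note Y[measurable]
  have sp: "space H = space M" using sub by (simp add: subalgebra_def)
  have H[measurable]: "(\<lambda>s. s) \<in> M \<rightarrow>\<^sub>M H"
    using measurable_from_subalg[OF sub, of "\<lambda>s. s" H] by simp
  show "sigma_finite_measure (distr M N Y)"
    by (intro prob_space_imp_sigma_finite prob_space_distr Y)
  show "sigma_finite_measure (restr_to_subalg M H)"
    using sub by (intro prob_space_imp_sigma_finite prob_space_restr_to_subalg) unfold_locales
  show "sets (restr_to_subalg M H \<Otimes>\<^sub>M distr M N Y) = sets (distr M (H \<Otimes>\<^sub>M N) (\<lambda>s. (s, Y s)))"
    using sub by (simp add: sets_restr_to_subalg cong: sets_pair_measure_cong)
  fix A B assume "A \<in> sets (restr_to_subalg M H)" "B \<in> sets (distr M N Y)"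
  then have A[measurable]: "A \<in> sets H" and B[measurable]: "B \<in> sets N"
    using sub by (simp_all add: sets_restr_to_subalg)
  have "emeasure (distr M (H \<Otimes>\<^sub>M N) (\<lambda>s. (s, Y s))) (A \<times> B)
      = emeasure M ((\<lambda>s. (s, Y s)) -` (A \<times> B) \<inter> space M)"
    by (rule emeasure_distr) measurable
  also have "(\<lambda>s. (s, Y s)) -` (A \<times> B) \<inter> space M = A \<inter> (Y -` B \<inter> space M)"
    by auto
  also have "emeasure M \<dots> = emeasure M A * emeasure M (Y -` B \<inter> space M)"
  proof -
    have "Y -` B \<inter> space M \<in> sigma_sets (space M) {Y -` A \<inter> space M | A. A \<in> sets N}"
      using B by blast
    then have "prob (A \<inter> (Y -` B \<inter> space M)) = prob A * prob (Y -` B \<inter> space M)"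
      using ind A unfolding indep_sets2_eq by blast
    then show ?thesis by (simp add: emeasure_eq_measure ennreal_mult)
  qed
  also have "\<dots> = emeasure (restr_to_subalg M H) A * emeasure (distr M N Y) B"
    using sub by (simp add: emeasure_restr_to_subalg emeasure_distr)
  finally show "emeasure (restr_to_subalg M H) A * emeasure (distr M N Y) B
      = emeasure (distr M (H \<Otimes>\<^sub>M N) (\<lambda>s. (s, Y s))) (A \<times> B)" ..
qed

text \<open>Since \<open>s\<close> is, as far as \<open>H\<close> can see, independent of \<open>Y s\<close>, the pair \<open>(s, Y s)\<close> has a
  product law: the occurrence of \<open>s\<close> in \<open>\<phi> (s, Y s)\<close> may be frozen and the fresh variable
  integrated out with an independent copy \<open>Y t\<close>.\<close>

lemma (in prob_space) nn_integral_freezing: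
  assumes sub: "subalgebra M H" and Y: "Y \<in> M \<rightarrow>\<^sub>M N"
    and ind: "indep_set (sets H) (sigma_sets (space M) {Y -` A \<inter> space M | A. A \<in> sets N})"
    and \<phi>[measurable]: "\<phi> \<in> borel_measurable (H \<Otimes>\<^sub>M N)"
  shows "(\<integral>\<^sup>+ s. \<phi> (s, Y s) \<partial>M) = (\<integral>\<^sup>+ s. \<integral>\<^sup>+ t. \<phi> (s, Y t) \<partial>M \<partial>M)"
proof -
  note Y[measurable]
  have H[measurable]: "(\<lambda>s. s) \<in> M \<rightarrow>\<^sub>M H"
    using measurable_from_subalg[OF sub, of "\<lambda>s. s" H] by simp
  have law: "prob_space (distr M N Y)" by (rule prob_space_distr) (rule Y)
  interpret law: prob_space "distr M N Y" by (rule law)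
  have [measurable_cong]: "sets (restr_to_subalg M H) = sets H"
    using sub by (rule sets_restr_to_subalg)
  have "(\<integral>\<^sup>+ s. \<phi> (s, Y s) \<partial>M) = (\<integral>\<^sup>+ z. \<phi> z \<partial>distr M (H \<Otimes>\<^sub>M N) (\<lambda>s. (s, Y s)))"
    by (subst nn_integral_distr) auto
  also have "\<dots> = (\<integral>\<^sup>+ s. \<integral>\<^sup>+ y. \<phi> (s, y) \<partial>distr M N Y \<partial>restr_to_subalg M H)"
    unfolding distr_identity_pair[OF sub Y ind]
    by (subst law.nn_integral_fst) (auto cong: measurable_cong_sets)
  also have "\<dots> = (\<integral>\<^sup>+ s. \<integral>\<^sup>+ y. \<phi> (s, y) \<partial>distr M N Y \<partial>M)"
    using sub by (intro nn_integral_subalgebra2) measurable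
  also have "\<dots> = (\<integral>\<^sup>+ s. \<integral>\<^sup>+ t. \<phi> (s, Y t) \<partial>M \<partial>M)"
  proof (rule nn_integral_cong)
    fix s assume "s \<in> space M"
    then have [measurable]: "Pair s \<in> N \<rightarrow>\<^sub>M H \<Otimes>\<^sub>M N"
      using sub by (intro measurable_Pair1') (simp add: subalgebra_def)
    show "(\<integral>\<^sup>+ y. \<phi> (s, y) \<partial>distr M N Y) = (\<integral>\<^sup>+ t. \<phi> (s, Y t) \<partial>M)"
      by (subst nn_integral_distr) auto
  qed
  finally show ?thesis .
qed

lemma (in prob_space) real_cond_exp_freezing:
  fixes \<phi> :: "'a \<times> 'b \<Rightarrow> real"
  assumes sub: "subalgebra M H" and Y: "Y \<in> M \<rightarrow>\<^sub>M N"
    and ind: "indep_set (sets H) (sigma_sets (space M) {Y -` A \<inter> space M | A. A \<in> sets N})"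
    and \<phi>[measurable]: "\<phi> \<in> borel_measurable (H \<Otimes>\<^sub>M N)"
    and int: "integrable M (\<lambda>s. \<phi> (s, Y s))"
  shows "AE s in M. real_cond_exp M H (\<lambda>s. \<phi> (s, Y s)) s = (\<integral> t. \<phi> (s, Y t) \<partial>M)"
proof -
  note Y[measurable]
  have H[measurable]: "(\<lambda>s. s) \<in> M \<rightarrow>\<^sub>M H"
    using measurable_from_subalg[OF sub, of "\<lambda>s. s" H] by simp
  let ?R = "restr_to_subalg M H" and ?law = "distr M N Y"
  have law: "prob_space ?law" by (rule prob_space_distr) (rule Y)
  interpret law: prob_space ?law by (rule law)
  interpret R: prob_space ?R by (rule prob_space_restr_to_subalg[OF sub]) unfold_locales
  interpret RL: pair_prob_space ?R ?law ..
  interpret finite_measure_subalgebra M H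
    by unfold_locales (rule sub)
  have cong[measurable_cong]: "sets ?R = sets H"
    using sub by (rule sets_restr_to_subalg)
  have fubini: "integrable ?R (\<lambda>s. \<integral> y. \<psi> (s, y) \<partial>?law)"
      "(\<integral> s. (\<integral> y. \<psi> (s, y) \<partial>?law) \<partial>M) = (\<integral> s. \<psi> (s, Y s) \<partial>M)"
    if \<psi>[measurable]: "\<psi> \<in> borel_measurable (H \<Otimes>\<^sub>M N)" and "integrable M (\<lambda>s. \<psi> (s, Y s))"
    for \<psi> :: "'a \<times> 'b \<Rightarrow> real"
  proof -
    have "integrable (distr M (H \<Otimes>\<^sub>M N) (\<lambda>s. (s, Y s))) \<psi>"
      using that by (subst integrable_distr_eq) auto
    then have i: "integrable (?R \<Otimes>\<^sub>M ?law) \<psi>"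
      unfolding distr_identity_pair[OF sub Y ind] .
    show "integrable ?R (\<lambda>s. \<integral> y. \<psi> (s, y) \<partial>?law)" by (rule RL.integrable_fst'[OF i])
    have "(\<integral> s. (\<integral> y. \<psi> (s, y) \<partial>?law) \<partial>M) = (\<integral> s. (\<integral> y. \<psi> (s, y) \<partial>?law) \<partial>?R)"
      using sub by (intro integral_subalgebra2[symmetric]) measurable
    also have "\<dots> = integral\<^sup>L (?R \<Otimes>\<^sub>M ?law) \<psi>" by (rule RL.integral_fst'[OF i])
    also have "\<dots> = (\<integral> s. \<psi> (s, Y s) \<partial>M)"
      unfolding distr_identity_pair[OF sub Y ind, symmetric] by (subst integral_distr) auto
    finally show "(\<integral> s. (\<integral> y. \<psi> (s, y) \<partial>?law) \<partial>M) = (\<integral> s. \<psi> (s, Y s) \<partial>M)" .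
  qed
  have "AE s in M. real_cond_exp M H (\<lambda>s. \<phi> (s, Y s)) s = (\<integral> y. \<phi> (s, y) \<partial>?law)"
  proof (rule real_cond_exp_charact)
    fix A assume A[measurable]: "A \<in> sets H"
    then have "A \<in> sets M" using sub by (auto simp: subalgebra_def)
    define \<psi> where "\<psi> z = indicator A (fst z) * \<phi> z" for z
    have [measurable]: "\<psi> \<in> borel_measurable (H \<Otimes>\<^sub>M N)" unfolding \<psi>_def by measurable
    have "integrable M (\<lambda>s. \<psi> (s, Y s))"
      using integrable_mult_indicator[OF \<open>A \<in> sets M\<close> int] by (simp add: \<psi>_def)
    from fubini(2)[OF _ this]
    show "(\<integral>s\<in>A. \<phi> (s, Y s) \<partial>M) = (\<integral>s\<in>A. (\<integral> y. \<phi> (s, y) \<partial>?law) \<partial>M)"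
      by (simp add: \<psi>_def set_lebesgue_integral_def)
  next
    show "integrable M (\<lambda>s. \<integral> y. \<phi> (s, y) \<partial>?law)"
      by (rule integrable_from_subalg[OF sub fubini(1)[OF \<phi> int]])
    show "integrable M (\<lambda>s. \<phi> (s, Y s))" by (rule int)
    show "(\<lambda>s. \<integral> y. \<phi> (s, y) \<partial>?law) \<in> borel_measurable H" by measurable
  qed
  moreover have "(\<integral> y. \<phi> (s, y) \<partial>?law) = (\<integral> t. \<phi> (s, Y t) \<partial>M)" if "s \<in> space M" for s
  proof -
    have [measurable]: "Pair s \<in> N \<rightarrow>\<^sub>M H \<Otimes>\<^sub>M N"
      using sub that by (intro measurable_Pair1') (simp add: subalgebra_def)
    show ?thesis by (subst integral_distr) auto
  qed
  ultimately show ?thesis by (auto elim: AE_mp)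
qed

section \<open>Second moments\<close>

lemma (in prob_space) integrable_of_square_integrable:
  fixes f :: "'a \<Rightarrow> 'b::euclidean_space"
  assumes [measurable]: "f \<in> borel_measurable M" and "integrable M (\<lambda>s. (norm (f s))\<^sup>2)"
  shows "integrable M f"
proof -
  have "integrable M (\<lambda>s. norm (f s))"
    by (rule square_integrable_imp_integrable[OF _ assms(2)]) measurable
  then show ?thesis by (subst (asm) integrable_norm_iff) (rule assms(1))
qed

lemma integrable_norm2_scaleR:
  assumes "integrable M (\<lambda>s. (norm (f s))\<^sup>2)"
  shows "integrable M (\<lambda>s. (norm (c *\<^sub>R f s))\<^sup>2)"
  using assms by (simp add: power_mult_distrib)

lemma norm_add_sq_le: "(norm (a + b))\<^sup>2 \<le> 2 * (norm a)\<^sup>2 + 2 * (norm b)\<^sup>2"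
  for a b :: "'b::real_inner"
proof -
  have "0 \<le> (norm (a - b))\<^sup>2" by simp
  then show ?thesis
    unfolding power2_norm_eq_inner by (simp add: algebra_simps inner_commute)
qed

lemma integrable_norm2_add:
  fixes f g :: "'a \<Rightarrow> 'b::euclidean_space"
  assumes [measurable]: "f \<in> borel_measurable M" "g \<in> borel_measurable M"
    and "integrable M (\<lambda>s. (norm (f s))\<^sup>2)" "integrable M (\<lambda>s. (norm (g s))\<^sup>2)"
  shows "integrable M (\<lambda>s. (norm (f s + g s))\<^sup>2)"
  using norm_add_sq_le
  by (intro Bochner_Integration.integrable_bound[OF Bochner_Integration.integrable_add[OF
        integrable_mult_right[OF assms(3), of 2] integrable_mult_right[OF assms(4), of 2]]]) auto

lemma integrable_norm2_diff:
  fixes f g :: "'a \<Rightarrow> 'b::euclidean_space"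
  assumes "f \<in> borel_measurable M" "g \<in> borel_measurable M"
    and "integrable M (\<lambda>s. (norm (f s))\<^sup>2)" "integrable M (\<lambda>s. (norm (g s))\<^sup>2)"
  shows "integrable M (\<lambda>s. (norm (f s - g s))\<^sup>2)"
  using integrable_norm2_add[of f M "\<lambda>s. - g s"] assms by simp

lemma integrable_norm2_sum:
  fixes f :: "'i \<Rightarrow> 'a \<Rightarrow> 'b::euclidean_space"
  assumes "finite A" "\<And>i. i \<in> A \<Longrightarrow> f i \<in> borel_measurable M"
    "\<And>i. i \<in> A \<Longrightarrow> integrable M (\<lambda>s. (norm (f i s))\<^sup>2)"
  shows "integrable M (\<lambda>s. (norm (\<Sum>i\<in>A. f i s))\<^sup>2)"
  using assms
proof (induction A rule: finite_induct)
  case (insert i A)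
  then have "integrable M (\<lambda>s. (norm (f i s + (\<Sum>i\<in>A. f i s)))\<^sup>2)"
    by (intro integrable_norm2_add borel_measurable_sum) auto
  then show ?case using insert.hyps by simp
qed simp

lemma integrable_inner_of_norm2:
  fixes f g :: "'a \<Rightarrow> 'b::euclidean_space"
  assumes [measurable]: "f \<in> borel_measurable M" "g \<in> borel_measurable M"
    and "integrable M (\<lambda>s. (norm (f s))\<^sup>2)" "integrable M (\<lambda>s. (norm (g s))\<^sup>2)"
  shows "integrable M (\<lambda>s. inner (f s) (g s))"
proof (rule Bochner_Integration.integrable_bound[OF
      Bochner_Integration.integrable_add[OF assms(3,4)]])
  have "\<bar>inner u v\<bar> \<le> (norm u)\<^sup>2 + (norm v)\<^sup>2" for u v :: 'b
    using Cauchy_Schwarz_ineq2[of u v] sum_squares_bound[of "norm u" "norm v"]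
      mult_nonneg_nonneg[of "norm u" "norm v"] by simp
  then show "AE s in M. norm (inner (f s) (g s)) \<le> norm ((norm (f s))\<^sup>2 + (norm (g s))\<^sup>2)"
    by simp
qed measurable

lemma integral_norm_sum_sq:
  fixes V :: "'i \<Rightarrow> 'a \<Rightarrow> 'b::euclidean_space"
  assumes meas: "\<And>i. i \<in> I \<Longrightarrow> V i \<in> borel_measurable M"
    and sq: "\<And>i. i \<in> I \<Longrightarrow> integrable M (\<lambda>s. (norm (V i s))\<^sup>2)"
  shows "(\<integral>s. (norm (\<Sum>i\<in>I. V i s))\<^sup>2 \<partial>M) = (\<Sum>i\<in>I. \<Sum>j\<in>I. \<integral>s. inner (V i s) (V j s) \<partial>M)"
proof -
  have "(\<integral>s. (norm (\<Sum>i\<in>I. V i s))\<^sup>2 \<partial>M) = (\<integral>s. (\<Sum>i\<in>I. \<Sum>j\<in>I. inner (V i s) (V j s)) \<partial>M)"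
    unfolding power2_norm_eq_inner inner_sum_left inner_sum_right
    by (intro Bochner_Integration.integral_cong refl sum.swap)
  also have "\<dots> = (\<Sum>i\<in>I. \<integral>s. (\<Sum>j\<in>I. inner (V i s) (V j s)) \<partial>M)"
    by (intro Bochner_Integration.integral_sum Bochner_Integration.integrable_sum
        integrable_inner_of_norm2 meas sq)
  also have "\<dots> = (\<Sum>i\<in>I. \<Sum>j\<in>I. \<integral>s. inner (V i s) (V j s) \<partial>M)"
    by (intro sum.cong refl Bochner_Integration.integral_sum integrable_inner_of_norm2 meas sq)
  finally show ?thesis .
qed

lemma norm_sum_sq_le:
  fixes v :: "'i \<Rightarrow> 'b::real_normed_vector"
  shows "(norm (\<Sum>i\<in>A. v i))\<^sup>2 \<le> real (card A) * (\<Sum>i\<in>A. (norm (v i))\<^sup>2)"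
proof -
  have "(norm (\<Sum>i\<in>A. v i))\<^sup>2 \<le> (\<Sum>i\<in>A. norm (v i))\<^sup>2"
    by (intro power_mono norm_sum) simp
  also have "\<dots> \<le> (\<Sum>i\<in>A. (norm (v i))\<^sup>2) * (\<Sum>i\<in>A. 1\<^sup>2)"
    using Cauchy_Schwarz_ineq_sum[of "\<lambda>i. norm (v i)" "\<lambda>_. 1" A] by simp
  finally show ?thesis by (simp add: mult.commute)
qed

lemma (in prob_space) indep_vars_imp_indep_var:
  assumes ind: "indep_vars M' X I" and "i \<in> I" "j \<in> I" "i \<noteq> j"
  shows "indep_var (M' i) (X i) (M' j) (X j)"
proof -
  have "indep_var (PiM {i} M') (\<lambda>s. \<lambda>k\<in>{i}. X k s) (PiM {j} M') (\<lambda>s. \<lambda>k\<in>{j}. X k s)"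
    using assms by (intro indep_var_restrict[OF ind]) auto
  from indep_var_compose[OF this, of "\<lambda>f. f i" "M' i" "\<lambda>f. f j" "M' j"]
  show ?thesis by (simp add: comp_def)
qed

lemma (in prob_space) indep_var_inner:
  fixes X Y :: "'a \<Rightarrow> 'b::euclidean_space"
  assumes ind: "indep_var borel X borel Y" and X: "integrable M X" and Y: "integrable M Y"
  shows "(\<integral>s. inner (X s) (Y s) \<partial>M) = inner (\<integral>s. X s \<partial>M) (\<integral>s. Y s \<partial>M)"
proof -
  have ind': "indep_var borel (\<lambda>s. inner (X s) b) borel (\<lambda>s. inner (Y s) b)" for b
    using indep_var_compose[OF ind, of "\<lambda>v. inner v b" borel "\<lambda>v. inner v b" borel]
    by (simp add: comp_def)
  have "(\<integral>s. inner (X s) (Y s) \<partial>M) = (\<integral>s. (\<Sum>b\<in>Basis. inner (X s) b * inner (Y s) b) \<partial>M)"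
    by (simp add: euclidean_inner[symmetric])
  also have "\<dots> = (\<Sum>b\<in>Basis. (\<integral>s. inner (X s) b \<partial>M) * (\<integral>s. inner (Y s) b \<partial>M))"
    using X Y by (subst Bochner_Integration.integral_sum)
      (auto intro!: indep_var_integrable ind' simp: indep_var_lebesgue_integral[OF ind'])
  also have "\<dots> = inner (\<integral>s. X s \<partial>M) (\<integral>s. Y s \<partial>M)"
    using X Y by (subst (3) euclidean_inner) simp
  finally show ?thesis .
qed

text \<open>Off the diagonal, independence replaces the expected inner product by the inner product of the
  means, so that the variances are the only correction to the squared mean.\<close>

lemma (in prob_space) second_moment_sum_indep:
  fixes V :: "'i \<Rightarrow> 'a \<Rightarrow> 'b::euclidean_space"
  assumes fin: "finite I" and ind: "indep_vars (\<lambda>_. borel) V I"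
    and sq: "\<And>i. i \<in> I \<Longrightarrow> integrable M (\<lambda>s. (norm (V i s))\<^sup>2)"
  shows "(\<integral>s. (norm (\<Sum>i\<in>I. V i s))\<^sup>2 \<partial>M)
    = (norm (\<Sum>i\<in>I. \<integral>s. V i s \<partial>M))\<^sup>2
      + (\<Sum>i\<in>I. (\<integral>s. (norm (V i s))\<^sup>2 \<partial>M) - (norm (\<integral>s. V i s \<partial>M))\<^sup>2)"
proof -
  have meas: "V i \<in> borel_measurable M" if "i \<in> I" for i
    using ind that by (auto simp: indep_vars_def)
  have int: "integrable M (V i)" if "i \<in> I" for i
    using integrable_of_square_integrable meas sq that by blast
  let ?m = "\<lambda>i. \<integral>s. V i s \<partial>M"
  let ?v = "\<lambda>i. (\<integral>s. (norm (V i s))\<^sup>2 \<partial>M) - (norm (?m i))\<^sup>2"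
  have cross: "(\<integral>s. inner (V i s) (V j s) \<partial>M) = inner (?m i) (?m j) + (if i = j then ?v i else 0)"
    if "i \<in> I" "j \<in> I" for i j
  proof (cases "i = j")
    case True
    then show ?thesis by (simp add: power2_norm_eq_inner)
  next
    case False
    then have "indep_var borel (V i) borel (V j)"
      using indep_vars_imp_indep_var[OF ind that] by simp
    then show ?thesis using False that by (simp add: indep_var_inner int)
  qed
  have "(\<integral>s. (norm (\<Sum>i\<in>I. V i s))\<^sup>2 \<partial>M) = (\<Sum>i\<in>I. \<Sum>j\<in>I. \<integral>s. inner (V i s) (V j s) \<partial>M)"
    by (rule integral_norm_sum_sq[OF meas sq])
  also have "\<dots> = (\<Sum>i\<in>I. \<Sum>j\<in>I. inner (?m i) (?m j) + (if i = j then ?v i else 0))"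
    by (intro sum.cong refl cross)
  also have "\<dots> = (\<Sum>i\<in>I. \<Sum>j\<in>I. inner (?m i) (?m j)) + (\<Sum>i\<in>I. ?v i)"
    using fin by (simp add: sum.distrib sum.delta)
  also have "(\<Sum>i\<in>I. \<Sum>j\<in>I. inner (?m i) (?m j)) = (norm (\<Sum>i\<in>I. ?m i))\<^sup>2"
    unfolding power2_norm_eq_inner inner_sum_left inner_sum_right by (rule sum.swap)
  finally show ?thesis .
qed

section \<open>One round of quantized random draws\<close>

lemma quantization_measurable:
  assumes "quantization \<omega> S Q" and [measurable]: "f \<in> K \<rightarrow>\<^sub>M S" "h \<in> borel_measurable K"
  shows "(\<lambda>s. Q (f s) (h s)) \<in> borel_measurable K"
proof -
  have [measurable]: "(\<lambda>(q, y). Q q y) \<in> borel_measurable (S \<Otimes>\<^sub>M borel)"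
    using assms(1) by (simp add: quantization_def)
  have "(\<lambda>s. (\<lambda>(q, y). Q q y) (f s, h s)) \<in> borel_measurable K" by measurable
  then show ?thesis by simp
qed

text \<open>The quantization error is centred, hence uncorrelated with \<open>y\<close>.\<close>

lemma quantization_second_moment:
  fixes Q :: "'s \<Rightarrow> 'a::euclidean_space \<Rightarrow> 'a"
  assumes "quantization \<omega> S Q"
  shows "integrable S (\<lambda>q. (norm (Q q y))\<^sup>2)"
    and "(\<integral>q. (norm (Q q y))\<^sup>2 \<partial>S) \<le> (1 + \<omega>) * (norm y)\<^sup>2"
proof -
  interpret S: prob_space S using assms by (simp add: quantization_def)
  have i1: "integrable S (\<lambda>q. Q q y)" and e1: "(\<integral>q. Q q y \<partial>S) = y"
    and i2: "integrable S (\<lambda>q. (norm (Q q y - y))\<^sup>2)"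
    and e2: "(\<integral>q. (norm (Q q y - y))\<^sup>2 \<partial>S) \<le> \<omega> * (norm y)\<^sup>2"
    using assms by (auto simp: quantization_def)
  have eq: "(\<lambda>q. (norm (Q q y))\<^sup>2)
      = (\<lambda>q. (norm (Q q y - y))\<^sup>2 + (2 * inner (Q q y) y - (norm y)\<^sup>2))"
    unfolding power2_norm_eq_inner by (simp add: algebra_simps inner_commute)
  show "integrable S (\<lambda>q. (norm (Q q y))\<^sup>2)"
    unfolding eq using i1 i2 by simp
  have "(\<integral>q. (norm (Q q y))\<^sup>2 \<partial>S)
      = (\<integral>q. (norm (Q q y - y))\<^sup>2 \<partial>S) + (2 * inner y y - (norm y)\<^sup>2)"
    unfolding eq using i1 i2 e1 by (simp add: S.prob_space)
  also have "\<dots> \<le> \<omega> * (norm y)\<^sup>2 + (2 * inner y y - (norm y)\<^sup>2)" using e2 by simp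
  finally show "(\<integral>q. (norm (Q q y))\<^sup>2 \<partial>S) \<le> (1 + \<omega>) * (norm y)\<^sup>2"
    by (simp add: power2_norm_eq_inner algebra_simps)
qed

lemma round_law_integral:
  fixes h :: "nat \<Rightarrow> 's \<Rightarrow> 'b::euclidean_space"
  assumes "m \<ge> 1" "prob_space S"
    and int: "\<And>l. l \<in> {1..m} \<Longrightarrow> integrable S (h l)"
    and meas: "(\<lambda>z. h (fst z) (fst (snd z))) \<in> borel_measurable (round_law m S p)"
  shows "integrable (round_law m S p) (\<lambda>z. h (fst z) (fst (snd z)))"
    and "(\<integral>z. h (fst z) (fst (snd z)) \<partial>round_law m S p)
      = (1 / real m) *\<^sub>R (\<Sum>l\<in>{1..m}. \<integral>q. h l q \<partial>S)"
proof -
  let ?U = "uniform_count_measure {1..m}" and ?K = "S \<Otimes>\<^sub>M measure_pmf (bernoulli_pmf p)"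
  interpret S: prob_space S by fact
  interpret U: prob_space ?U using assms by (intro prob_space_uniform_count_measure) auto
  interpret B: prob_space "measure_pmf (bernoulli_pmf p)" by (rule measure_pmf.prob_space_axioms)
  interpret SB: pair_prob_space S "measure_pmf (bernoulli_pmf p)" ..
  interpret P: pair_prob_space ?U ?K ..
  have K: "integrable ?K (\<lambda>y. f (fst y))" "(\<integral>y. f (fst y) \<partial>?K) = (\<integral>q. f q \<partial>S)"
    if "integrable S f" for f :: "'s \<Rightarrow> 'c::euclidean_space"
  proof -
    have [measurable]: "f \<in> borel_measurable S"
      using that by (rule borel_measurable_integrable)
    have "integrable (distr ?K S fst) f" using that by (simp add: measure_pmf.distr_pair_fst)
    then show "integrable ?K (\<lambda>y. f (fst y))" by (subst (asm) integrable_distr_eq) auto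
    have "(\<integral>y. f (fst y) \<partial>?K) = (\<integral>q. f q \<partial>distr ?K S fst)"
      by (rule integral_distr[symmetric]) measurable
    then show "(\<integral>y. f (fst y) \<partial>?K) = (\<integral>q. f q \<partial>S)" by (simp add: measure_pmf.distr_pair_fst)
  qed
  show i: "integrable (round_law m S p) (\<lambda>z. h (fst z) (fst (snd z)))"
    unfolding round_law_def
  proof (rule P.Fubini_integrable)
    show "(\<lambda>z. h (fst z) (fst (snd z))) \<in> borel_measurable (?U \<Otimes>\<^sub>M ?K)"
      using meas by (simp add: round_law_def)
    show "integrable ?U (\<lambda>l. \<integral>y. norm (h (fst (l, y)) (fst (snd (l, y)))) \<partial>?K)"
      unfolding uniform_count_measure_def by (rule integrable_point_measure_finite) simp
    show "AE l in ?U. integrable ?K (\<lambda>y. h (fst (l, y)) (fst (snd (l, y))))"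
      using int by (intro AE_I2) (auto simp: space_uniform_count_measure intro!: K)
  qed
  have "(\<integral>z. h (fst z) (fst (snd z)) \<partial>round_law m S p) = (\<integral>l. \<integral>y. h l (fst y) \<partial>?K \<partial>?U)"
    using P.integral_fst'[OF i[unfolded round_law_def]] by (simp add: round_law_def)
  also have "\<dots> = (\<Sum>l\<in>{1..m}. (1 / real m) *\<^sub>R (\<integral>y. h l (fst y) \<partial>?K))"
    unfolding uniform_count_measure_def by (subst lebesgue_integral_point_measure_finite) auto
  also have "\<dots> = (1 / real m) *\<^sub>R (\<Sum>l\<in>{1..m}. \<integral>q. h l q \<partial>S)"
    unfolding scaleR_sum_right using K(2) int by (intro sum.cong refl) auto
  finally show "(\<integral>z. h (fst z) (fst (snd z)) \<partial>round_law m S p)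
      = (1 / real m) *\<^sub>R (\<Sum>l\<in>{1..m}. \<integral>q. h l q \<partial>S)" .
qed

lemma round_law_integral_coin:
  fixes A B :: real
  assumes "m \<ge> 1" "prob_space S" "0 \<le> p" "p \<le> 1"
  shows "(\<integral>z. (if snd (snd z) then A else B) \<partial>round_law m S p) = p * A + (1 - p) * B"
proof -
  let ?U = "uniform_count_measure {1..m}" and ?B = "measure_pmf (bernoulli_pmf p)"
  let ?K = "S \<Otimes>\<^sub>M ?B"
  interpret S: prob_space S by fact
  interpret U: prob_space ?U using assms by (intro prob_space_uniform_count_measure) auto
  interpret B: prob_space ?B by (rule measure_pmf.prob_space_axioms)
  interpret SB: pair_prob_space S ?B ..
  interpret P: pair_prob_space ?U ?K ..
  have "integrable ?K (\<lambda>y. if snd y then A else B)"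
    by (rule SB.P.integrable_const_bound[of _ "max \<bar>A\<bar> \<bar>B\<bar>"]) auto
  from SB.integral_fst'[OF this]
  have K: "(\<integral>y. (if snd y then A else B) \<partial>?K) = p * A + (1 - p) * B"
    using assms by (simp add: S.prob_space mult.commute)
  have "integrable (?U \<Otimes>\<^sub>M ?K) (\<lambda>z. if snd (snd z) then A else B)"
    by (rule P.P.integrable_const_bound[of _ "max \<bar>A\<bar> \<bar>B\<bar>"]) auto
  from P.integral_fst'[OF this] show ?thesis
    by (simp add: K U.prob_space round_law_def del: One_nat_def)
qed

lemma quantized_draw:
  fixes Q :: "'s \<Rightarrow> 'a::euclidean_space \<Rightarrow> 'a" and c :: "nat \<Rightarrow> 'a"
  assumes Q: "quantization \<omega> S Q" and m: "m \<ge> 1"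
  defines "V \<equiv> \<lambda>z :: nat \<times> 's \<times> bool. Q (fst (snd z)) (c (fst z))"
  shows "V \<in> borel_measurable (round_law m S p)"
    and "integrable (round_law m S p) (\<lambda>z. (norm (V z))\<^sup>2)"
    and "(\<integral>z. V z \<partial>round_law m S p) = (1 / real m) *\<^sub>R (\<Sum>l\<in>{1..m}. c l)"
    and "(\<integral>z. (norm (V z))\<^sup>2 \<partial>round_law m S p) \<le> (1 + \<omega>) * (1 / real m * (\<Sum>l\<in>{1..m}. (norm (c l))\<^sup>2))"
proof -
  have S: "prob_space S" using Q by (simp add: quantization_def)
  have [measurable]: "(\<lambda>z. fst (snd z)) \<in> round_law m S p \<rightarrow>\<^sub>M S"
    unfolding round_law_def by measurable
  have "c \<in> borel_measurable (uniform_count_measure {1..m})"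
    by (simp cong: measurable_cong_sets)
  then have [measurable]: "(\<lambda>z. c (fst z)) \<in> borel_measurable (round_law m S p)"
    unfolding round_law_def by measurable
  show [measurable]: "V \<in> borel_measurable (round_law m S p)"
    unfolding V_def by (rule quantization_measurable[OF Q]) measurable
  have sq: "(\<lambda>z. (norm (Q (fst (snd z)) (c (fst z))))\<^sup>2) \<in> borel_measurable (round_law m S p)"
    using \<open>V \<in> _\<close> unfolding V_def by measurable
  note r = round_law_integral[OF m S, where p = p]
  show "integrable (round_law m S p) (\<lambda>z. (norm (V z))\<^sup>2)"
    unfolding V_def by (rule r(1)[OF quantization_second_moment(1)[OF Q] sq])
  have int: "integrable S (\<lambda>q. Q q (c l))" for l
    using Q by (simp add: quantization_def)
  have "(\<integral>z. V z \<partial>round_law m S p) = (1 / real m) *\<^sub>R (\<Sum>l\<in>{1..m}. \<integral>q. Q q (c l) \<partial>S)"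
    unfolding V_def using \<open>V \<in> _\<close> unfolding V_def by (rule r(2)[OF int])
  also have "\<dots> = (1 / real m) *\<^sub>R (\<Sum>l\<in>{1..m}. c l)"
    using Q by (simp add: quantization_def)
  finally show "(\<integral>z. V z \<partial>round_law m S p) = (1 / real m) *\<^sub>R (\<Sum>l\<in>{1..m}. c l)" .
  have "(\<integral>z. (norm (V z))\<^sup>2 \<partial>round_law m S p)
      = (1 / real m) *\<^sub>R (\<Sum>l\<in>{1..m}. \<integral>q. (norm (Q q (c l)))\<^sup>2 \<partial>S)"
    unfolding V_def by (rule r(2)[OF quantization_second_moment(1)[OF Q] sq])
  also have "\<dots> \<le> (1 / real m) *\<^sub>R (\<Sum>l\<in>{1..m}. (1 + \<omega>) * (norm (c l))\<^sup>2)"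
    by (intro scaleR_left_mono sum_mono quantization_second_moment(2)[OF Q]) simp
  finally show "(\<integral>z. (norm (V z))\<^sup>2 \<partial>round_law m S p)
      \<le> (1 + \<omega>) * (1 / real m * (\<Sum>l\<in>{1..m}. (norm (c l))\<^sup>2))"
    by (simp add: sum_distrib_left mult_ac)
qed

locale fresh_draws = prob_space M for M :: "'o measure" +
  fixes S :: "'s measure" and Q :: "'s \<Rightarrow> 'a::euclidean_space \<Rightarrow> 'a" and \<omega> p :: real
    and n m :: nat
    and idx :: "nat \<Rightarrow> nat \<Rightarrow> 'o \<Rightarrow> nat"
    and seed :: "nat \<Rightarrow> nat \<Rightarrow> 'o \<Rightarrow> 's"
    and coin :: "nat \<Rightarrow> nat \<Rightarrow> 'o \<Rightarrow> bool"
  assumes n: "n \<ge> 1" and m: "m \<ge> 1" and \<omega>: "0 < \<omega>" and p: "0 < p" "p < 1"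
    and Q: "quantization \<omega> S Q"
    and fresh: "fresh_randomness M S n m p idx seed coin"
begin

abbreviation draw where "draw \<equiv> draws idx seed coin"
abbreviation law where "law \<equiv> round_law m S p"

definition past :: "nat \<Rightarrow> 'o measure" where
  "past k = sigma (space M)
     (\<Union>i\<in>{1..n}. \<Union>t\<in>{..<k}. {draw i t -` A \<inter> space M | A. A \<in> sets law})"

text \<open>All draws of one round are bundled into a single random variable, since integrating them out of
  the mean over the workers needs their joint independence from the past.\<close>

definition current :: "nat \<Rightarrow> 'o \<Rightarrow> nat \<times> nat \<Rightarrow> nat \<times> 's \<times> bool" where
  "current k s = (\<lambda>(i, t)\<in>{1..n} \<times> {k}. draw i t s)"

lemma S_prob: "prob_space S"
  using Q by (simp add: quantization_def)

lemma draw_measurable: "i \<in> {1..n} \<Longrightarrow> draw i k \<in> M \<rightarrow>\<^sub>M law"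
  using fresh by (auto simp: fresh_randomness_def indep_vars_def)

lemma distr_draw: "i \<in> {1..n} \<Longrightarrow> distr M law (draw i k) = law"
  using fresh by (simp add: fresh_randomness_def)

lemma space_past [simp]: "space (past k) = space M"
  by (simp add: past_def space_measure_of_conv)

lemma sets_past:
  "sets (past k) = sigma_sets (space M)
     (\<Union>i\<in>{1..n}. \<Union>t\<in>{..<k}. {draw i t -` A \<inter> space M | A. A \<in> sets law})"
  unfolding past_def by (rule sets_measure_of) auto

lemma subalgebra_past: "subalgebra M (past k)"
proof -
  have "sets (past k) \<subseteq> sets M"
    unfolding sets_past
    by (rule sets.sigma_sets_subset, clarify) (rule measurable_sets[OF draw_measurable]; assumption)
  then show ?thesis by (simp add: subalgebra_def)
qed

lemma past_mono: "j \<le> k \<Longrightarrow> subalgebra (past k) (past j)"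
  unfolding subalgebra_def sets_past
  by (simp, rule sigma_sets_mono', intro UN_mono) auto

lemma measurable_past_mono: "f \<in> past j \<rightarrow>\<^sub>M N \<Longrightarrow> j \<le> k \<Longrightarrow> f \<in> past k \<rightarrow>\<^sub>M N"
  by (rule measurable_from_subalg[OF past_mono])

lemma measurable_past_M: "f \<in> past j \<rightarrow>\<^sub>M N \<Longrightarrow> f \<in> M \<rightarrow>\<^sub>M N"
  by (rule measurable_from_subalg[OF subalgebra_past])

lemma draw_measurable_past:
  assumes "i \<in> {1..n}" "t < k"
  shows "draw i t \<in> past k \<rightarrow>\<^sub>M law"
proof (rule measurableI)
  fix s assume "s \<in> space (past k)"
  then show "draw i t s \<in> space law"
    using measurable_space[OF draw_measurable] assms by auto
next
  fix A assume "A \<in> sets law"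
  then show "draw i t -` A \<inter> space (past k) \<in> sets (past k)"
    using assms unfolding space_past sets_past by (intro sigma_sets.Basic) blast
qed

lemma current_measurable:
  "current k \<in> M \<rightarrow>\<^sub>M PiM ({1..n} \<times> {k}) (\<lambda>_. law)"
  unfolding current_def by (rule measurable_restrict) (auto intro: draw_measurable)

lemma current_apply: "i \<in> {1..n} \<Longrightarrow> current k s (i, k) = draw i k s"
  by (simp add: current_def)

text \<open>The past is generated by the restriction of the independent family of all draws to the rounds
  below \<open>k\<close>, the current round by its restriction to a disjoint set of indices.\<close>

lemma past_indep_current:
  "indep_set (sets (past k))
    (sigma_sets (space M) {current k -` A \<inter> space M | A. A \<in> sets (PiM ({1..n} \<times> {k}) (\<lambda>_. law))})"
    (is "indep_set ?P ?C")
proof -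
  let ?X = "\<lambda>(i, k). draw i k" and ?A = "{1..n} \<times> {..<k}" and ?B = "{1..n} \<times> {k}"
  let ?past = "\<lambda>s. \<lambda>j\<in>?A. ?X j s"
  let ?NA = "PiM ?A (\<lambda>_. law)"
  have "indep_vars (\<lambda>_. law) ?X ({1..n} \<times> UNIV)"
    using fresh by (simp add: fresh_randomness_def)
  from indep_var_restrict[OF this, of ?A ?B]
  have "indep_var ?NA ?past (PiM ?B (\<lambda>_. law)) (\<lambda>s. \<lambda>j\<in>?B. ?X j s)" by auto
  moreover have "(\<lambda>s. \<lambda>j\<in>?B. ?X j s) = current k"
    by (auto simp: current_def fun_eq_iff restrict_def)
  ultimately have ind: "indep_set (sigma_sets (space M) {?past -` A \<inter> space M | A. A \<in> sets ?NA}) ?C"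
    and meas: "?past \<in> M \<rightarrow>\<^sub>M ?NA"
    by (simp_all add: indep_var_eq)
  have "?P \<subseteq> sigma_sets (space M) {?past -` A \<inter> space M | A. A \<in> sets ?NA}"
    unfolding sets_past
  proof (rule sigma_sets_mono, clarify)
    fix i t A assume it: "i \<in> {1..n}" "t < k" and A: "A \<in> sets law"
    then have comp: "(\<lambda>f. f (i, t)) \<in> ?NA \<rightarrow>\<^sub>M law"
      by (intro measurable_component_singleton) auto
    have "draw i t -` A \<inter> space M = ?past -` ((\<lambda>f. f (i, t)) -` A \<inter> space ?NA) \<inter> space M"
      using it measurable_space[OF meas] by auto
    then show "draw i t -` A \<inter> space M \<in> sigma_sets (space M) {?past -` A \<inter> space M | A. A \<in> sets ?NA}"
      using measurable_sets[OF comp A] by (intro sigma_sets.Basic) blast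
  qed
  with ind show ?thesis unfolding indep_sets2_eq by blast
qed

lemma draws_of_round_indep: "indep_vars (\<lambda>_. law) (\<lambda>i. draw i k) {1..n}"
proof -
  let ?K = "\<lambda>i. {(i, k)}"
  have "indep_vars (\<lambda>_. law) (\<lambda>(i, k). draw i k) ({1..n} \<times> UNIV)"
    using fresh by (simp add: fresh_randomness_def)
  then have "indep_vars (\<lambda>i. PiM (?K i) (\<lambda>_. law)) (\<lambda>i s. \<lambda>j\<in>?K i. (\<lambda>(i, k). draw i k) j s) {1..n}"
    by (rule indep_vars_restrict) (auto simp: disjoint_family_on_def)
  from indep_vars_compose2[OF this, of "\<lambda>i f. f (i, k)" "\<lambda>_. law"]
  show ?thesis by simp
qed

lemma integral_draw:
  fixes f :: "nat \<times> 's \<times> bool \<Rightarrow> 'b::euclidean_space"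
  assumes "i \<in> {1..n}" "f \<in> borel_measurable law"
  shows "(\<integral>s. f (draw i k s) \<partial>M) = (\<integral>z. f z \<partial>law)"
  using integral_distr[OF draw_measurable[OF assms(1)] assms(2), of k]
  unfolding distr_draw[OF assms(1)] by (rule sym)

lemma integrable_draw:
  fixes f :: "nat \<times> 's \<times> bool \<Rightarrow> 'b::euclidean_space"
  assumes "i \<in> {1..n}" "integrable law f"
  shows "integrable M (\<lambda>s. f (draw i k s))"
  using assms integrable_distr[OF draw_measurable[OF assms(1)], of k f] distr_draw[OF assms(1)]
  by simp

text \<open>Workers draw independently, so only the diagonal variance terms survive in the mean and the
  quantization noise is damped by \<open>1 / n\<close>; the squared mean of the centres is absorbed by
  Jensen's inequality.\<close>

lemma mean_quantized_draws:
  fixes c :: "nat \<Rightarrow> nat \<Rightarrow> 'a" and k :: nat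
  defines "G \<equiv> \<lambda>s. (1 / real n) *\<^sub>R (\<Sum>i\<in>{1..n}. Q (seed i k s) (c i (idx i k s)))"
  shows "integrable M (\<lambda>s. (norm (G s))\<^sup>2)" and "G \<in> borel_measurable M"
    and "(\<integral>s. G s \<partial>M) = (1 / real n) *\<^sub>R (\<Sum>i\<in>{1..n}. (1 / real m) *\<^sub>R (\<Sum>l\<in>{1..m}. c i l))"
    and "(\<integral>s. (norm (G s))\<^sup>2 \<partial>M)
      \<le> (1 + \<omega> / real n) * (1 / real n * (\<Sum>i\<in>{1..n}. 1 / real m * (\<Sum>l\<in>{1..m}. (norm (c i l))\<^sup>2)))"
proof -
  let ?I = "{1..n}"
  define V where "V i z = Q (fst (snd z)) (c i (fst z))" for i and z :: "nat \<times> 's \<times> bool"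
  define W where "W i s = V i (draw i k s)" for i s
  define h where "h i = (1 / real m) *\<^sub>R (\<Sum>l\<in>{1..m}. c i l)" for i
  define u where "u i = 1 / real m * (\<Sum>l\<in>{1..m}. (norm (c i l))\<^sup>2)" for i
  note V = quantized_draw[OF Q m, where p = p and c = "c i" for i, folded V_def]
  have Vm: "V i \<in> borel_measurable law" for i
    using V(1)[of i] by (simp add: V_def[abs_def])
  have G: "G s = (1 / real n) *\<^sub>R (\<Sum>i\<in>?I. W i s)" for s
    by (simp add: G_def W_def V_def draws_def)
  have Wm: "W i \<in> borel_measurable M" if "i \<in> ?I" for i
    unfolding W_def[abs_def] using measurable_compose[OF draw_measurable[OF that] Vm] .
  have Wsq: "integrable M (\<lambda>s. (norm (W i s))\<^sup>2)" if "i \<in> ?I" for i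
    unfolding W_def using integrable_draw[OF that V(2)[of i]] .
  have Wint: "integrable M (W i)" if "i \<in> ?I" for i
    using integrable_of_square_integrable Wm Wsq that by blast
  have EW: "(\<integral>s. W i s \<partial>M) = h i" if "i \<in> ?I" for i
    unfolding W_def h_def integral_draw[OF that Vm] by (rule V(3))
  have EW2: "(\<integral>s. (norm (W i s))\<^sup>2 \<partial>M) \<le> (1 + \<omega>) * u i" if "i \<in> ?I" for i
    unfolding W_def u_def
    by (subst integral_draw[OF that, where f = "\<lambda>z. (norm (V i z))\<^sup>2"]) (use Vm V(4) in auto)
  show "integrable M (\<lambda>s. (norm (G s))\<^sup>2)"
    unfolding G by (intro integrable_norm2_scaleR integrable_norm2_sum Wm Wsq) auto
  show "G \<in> borel_measurable M"
    unfolding G[abs_def] by (intro borel_measurable_scaleR borel_measurable_sum Wm) auto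
  show "(\<integral>s. G s \<partial>M) = (1 / real n) *\<^sub>R (\<Sum>i\<in>?I. (1 / real m) *\<^sub>R (\<Sum>l\<in>{1..m}. c i l))"
    unfolding G using Wint EW by (simp add: h_def)
  have "indep_vars (\<lambda>_. borel) W ?I"
    unfolding W_def[abs_def] using draws_of_round_indep Vm by (rule indep_vars_compose2)
  then have sec: "(\<integral>s. (norm (\<Sum>i\<in>?I. W i s))\<^sup>2 \<partial>M)
      = (norm (\<Sum>i\<in>?I. h i))\<^sup>2 + (\<Sum>i\<in>?I. (\<integral>s. (norm (W i s))\<^sup>2 \<partial>M) - (norm (h i))\<^sup>2)"
    using second_moment_sum_indep[of ?I W] Wsq EW by simp
  have h_le: "(norm (h i))\<^sup>2 \<le> u i" for i
  proof -
    have "(norm (h i))\<^sup>2 = (norm (\<Sum>l\<in>{1..m}. c i l))\<^sup>2 / (real m)\<^sup>2"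
      by (simp add: h_def power_divide)
    also have "\<dots> \<le> (real m * (\<Sum>l\<in>{1..m}. (norm (c i l))\<^sup>2)) / (real m)\<^sup>2"
      using norm_sum_sq_le[of "c i" "{1..m}"] by (intro divide_right_mono) auto
    finally show ?thesis using m by (simp add: u_def power2_eq_square)
  qed
  have "(\<integral>s. (norm (\<Sum>i\<in>?I. W i s))\<^sup>2 \<partial>M)
      \<le> real n * (\<Sum>i\<in>?I. (norm (h i))\<^sup>2) + (\<Sum>i\<in>?I. (1 + \<omega>) * u i - (norm (h i))\<^sup>2)"
    unfolding sec using norm_sum_sq_le[of h ?I] EW2 by (intro add_mono sum_mono diff_right_mono) auto
  also have "\<dots> = (real n - 1) * (\<Sum>i\<in>?I. (norm (h i))\<^sup>2) + (1 + \<omega>) * (\<Sum>i\<in>?I. u i)"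
    by (simp add: sum_subtractf sum_distrib_left algebra_simps)
  also have "\<dots> \<le> (real n - 1) * (\<Sum>i\<in>?I. u i) + (1 + \<omega>) * (\<Sum>i\<in>?I. u i)"
    using n h_le by (intro add_right_mono mult_left_mono sum_mono) auto
  finally have "(\<integral>s. (norm (\<Sum>i\<in>?I. W i s))\<^sup>2 \<partial>M) \<le> (real n + \<omega>) * (\<Sum>i\<in>?I. u i)"
    by (simp add: algebra_simps)
  then have "(\<integral>s. (norm (\<Sum>i\<in>?I. W i s))\<^sup>2 \<partial>M) / (real n)\<^sup>2
      \<le> (real n + \<omega>) * (\<Sum>i\<in>?I. u i) / (real n)\<^sup>2"
    by (rule divide_right_mono) simp
  moreover have "(\<integral>s. (norm (G s))\<^sup>2 \<partial>M) = (\<integral>s. (norm (\<Sum>i\<in>?I. W i s))\<^sup>2 \<partial>M) / (real n)\<^sup>2"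
    unfolding G by (simp add: power_divide)
  moreover have "(real n + \<omega>) * (\<Sum>i\<in>?I. u i) / (real n)\<^sup>2
      = (1 + \<omega> / real n) * (1 / real n * (\<Sum>i\<in>?I. u i))"
    using n by (simp add: field_simps power2_eq_square)
  ultimately show "(\<integral>s. (norm (G s))\<^sup>2 \<partial>M)
      \<le> (1 + \<omega> / real n) * (1 / real n * (\<Sum>i\<in>?I. 1 / real m * (\<Sum>l\<in>{1..m}. (norm (c i l))\<^sup>2)))"
    by (simp add: u_def)
qed

end

context fresh_draws
begin

lemma current_component_measurable:
  "i \<in> {1..n} \<Longrightarrow> (\<lambda>z. snd z (i, k)) \<in> past k \<Otimes>\<^sub>M PiM ({1..n} \<times> {k}) (\<lambda>_. law) \<rightarrow>\<^sub>M law"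
  by measurable

lemma idx_law: "fst \<in> law \<rightarrow>\<^sub>M count_space {1..m}"
proof -
  have "fst \<in> law \<rightarrow>\<^sub>M uniform_count_measure {1..m}"
    unfolding round_law_def by (rule measurable_fst)
  then show ?thesis
    by (subst (asm) measurable_cong_sets[OF refl sets_uniform_count_measure_count_space])
qed

lemma seed_law: "(\<lambda>z. fst (snd z)) \<in> law \<rightarrow>\<^sub>M S"
  unfolding round_law_def by measurable

lemma coin_law: "(\<lambda>z. snd (snd z)) \<in> law \<rightarrow>\<^sub>M count_space UNIV"
  unfolding round_law_def by measurable

text \<open>The conditional version of \<open>mean_quantized_draws\<close>: the vectors to be quantized are determined by
  the past, so they may be frozen. The nonnegative form of the freezing principle is applied first, because
  square integrability of the mean is not known beforehand.\<close>

lemma mean_quantized_draws_cond: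
  fixes C :: "'o \<Rightarrow> nat \<Rightarrow> nat \<Rightarrow> 'a" and k :: nat
  assumes C: "\<And>i l. i \<in> {1..n} \<Longrightarrow> l \<in> {1..m} \<Longrightarrow> (\<lambda>s. C s i l) \<in> borel_measurable (past k)"
    and sq: "\<And>i l. i \<in> {1..n} \<Longrightarrow> l \<in> {1..m} \<Longrightarrow> integrable M (\<lambda>s. (norm (C s i l))\<^sup>2)"
  defines "G \<equiv> \<lambda>s. (1 / real n) *\<^sub>R (\<Sum>i\<in>{1..n}. Q (seed i k s) (C s i (idx i k s)))"
  shows "G \<in> borel_measurable M" and "integrable M (\<lambda>s. (norm (G s))\<^sup>2)"
    and "AE s in M. vec_cond_exp M (past k) G s
      = (1 / real n) *\<^sub>R (\<Sum>i\<in>{1..n}. (1 / real m) *\<^sub>R (\<Sum>l\<in>{1..m}. C s i l))"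
    and "AE s in M. real_cond_exp M (past k) (\<lambda>s. (norm (G s))\<^sup>2) s
      \<le> (1 + \<omega> / real n) * (1 / real n * (\<Sum>i\<in>{1..n}. 1 / real m * (\<Sum>l\<in>{1..m}. (norm (C s i l))\<^sup>2)))"
proof -
  let ?N = "PiM ({1..n} \<times> {k}) (\<lambda>_. law)"
  define \<phi> where "\<phi> = (\<lambda>(s, y :: nat \<times> nat \<Rightarrow> nat \<times> 's \<times> bool). (1 / real n) *\<^sub>R
    (\<Sum>i\<in>{1..n}. Q (fst (snd (y (i, k)))) (C s i (fst (y (i, k))))))"
  have \<phi>_current: "\<phi> (s, current k t)
      = (1 / real n) *\<^sub>R (\<Sum>i\<in>{1..n}. Q (seed i k t) (C s i (idx i k t)))" for s t
    unfolding \<phi>_def by (simp add: current_apply draws_def del: One_nat_def)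
  have G: "G s = \<phi> (s, current k s)" for s
    unfolding G_def \<phi>_current ..
  have \<phi>m[measurable]: "\<phi> \<in> borel_measurable (past k \<Otimes>\<^sub>M ?N)"
    unfolding \<phi>_def case_prod_beta
  proof (intro borel_measurable_scaleR borel_measurable_sum borel_measurable_const)
    fix i assume i: "i \<in> {1..n}"
    note y = current_component_measurable[OF i, of k]
    have l: "(\<lambda>z. fst (snd z (i, k))) \<in> past k \<Otimes>\<^sub>M ?N \<rightarrow>\<^sub>M count_space {1..m}"
      by (rule measurable_compose[OF y idx_law])
    have q: "(\<lambda>z. fst (snd (snd z (i, k)))) \<in> past k \<Otimes>\<^sub>M ?N \<rightarrow>\<^sub>M S"
      by (rule measurable_compose[OF y seed_law])
    have "(\<lambda>z. C (fst z) i (fst (snd z (i, k)))) \<in> borel_measurable (past k \<Otimes>\<^sub>M ?N)"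
      by (rule measurable_compose_countable'[OF _ l])
        (auto intro!: measurable_compose[OF measurable_fst] C i simp del: One_nat_def)
    with q show "(\<lambda>z. Q (fst (snd (snd z (i, k)))) (C (fst z) i (fst (snd z (i, k)))))
        \<in> borel_measurable (past k \<Otimes>\<^sub>M ?N)"
      by (rule quantization_measurable[OF Q])
  qed
  note [measurable] = current_measurable[of k]
  have id[measurable]: "(\<lambda>s. s) \<in> M \<rightarrow>\<^sub>M past k"
    by (rule measurable_past_M[of _ k]) simp
  show Gm[measurable]: "G \<in> borel_measurable M"
    unfolding G[abs_def] by measurable
  define U where "U s = (1 + \<omega> / real n) *
    (1 / real n * (\<Sum>i\<in>{1..n}. 1 / real m * (\<Sum>l\<in>{1..m}. (norm (C s i l))\<^sup>2)))" for s
  have Uint: "integrable M U"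
    unfolding U_def by (intro integrable_mult_right Bochner_Integration.integrable_sum sq)
  note mean = mean_quantized_draws[of k "C s" for s, folded \<phi>_current]
  have U: "(\<integral>t. (norm (\<phi> (s, current k t)))\<^sup>2 \<partial>M) \<le> U s" for s
    unfolding U_def by (rule mean(4))
  have \<phi>2: "(\<lambda>z. (norm (\<phi> z))\<^sup>2) \<in> borel_measurable (past k \<Otimes>\<^sub>M ?N)" by measurable
  have \<phi>2': "(\<lambda>z. ennreal ((norm (\<phi> z))\<^sup>2)) \<in> borel_measurable (past k \<Otimes>\<^sub>M ?N)" by measurable
  note freeze = subalgebra_past current_measurable past_indep_current
  show Gsq: "integrable M (\<lambda>s. (norm (G s))\<^sup>2)"
  proof (rule integrableI_bounded)
    have "(\<integral>\<^sup>+ s. ennreal (norm ((norm (G s))\<^sup>2)) \<partial>M)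
        = (\<integral>\<^sup>+ s. \<integral>\<^sup>+ t. ennreal ((norm (\<phi> (s, current k t)))\<^sup>2) \<partial>M \<partial>M)"
      using nn_integral_freezing[OF freeze \<phi>2'] by (simp add: G)
    also have "\<dots> = (\<integral>\<^sup>+ s. ennreal (\<integral>t. (norm (\<phi> (s, current k t)))\<^sup>2 \<partial>M) \<partial>M)"
      using mean(1) by (intro nn_integral_cong nn_integral_eq_integral) auto
    also have "\<dots> \<le> (\<integral>\<^sup>+ s. ennreal (norm (U s)) \<partial>M)"
      by (intro nn_integral_mono ennreal_leI order_trans[OF U]) simp
    also have "\<dots> < \<infinity>"
      using Uint by (simp add: integrable_iff_bounded)
    finally show "(\<integral>\<^sup>+ s. ennreal (norm ((norm (G s))\<^sup>2)) \<partial>M) < \<infinity>" .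
  qed measurable
  have Gint: "integrable M G"
    by (rule integrable_of_square_integrable[OF Gm Gsq])
  have "AE s in M. real_cond_exp M (past k) (\<lambda>s. (norm (G s))\<^sup>2) s
      = (\<integral>t. (norm (\<phi> (s, current k t)))\<^sup>2 \<partial>M)"
    using real_cond_exp_freezing[OF freeze \<phi>2] Gsq by (simp add: G)
  then show "AE s in M. real_cond_exp M (past k) (\<lambda>s. (norm (G s))\<^sup>2) s
      \<le> (1 + \<omega> / real n) * (1 / real n * (\<Sum>i\<in>{1..n}. 1 / real m * (\<Sum>l\<in>{1..m}. (norm (C s i l))\<^sup>2)))"
    by (rule AE_mp) (use U in \<open>auto simp: U_def\<close>)
  let ?m = "\<lambda>s. (1 / real n) *\<^sub>R (\<Sum>i\<in>{1..n}. (1 / real m) *\<^sub>R (\<Sum>l\<in>{1..m}. C s i l))"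
  have "AE s in M. real_cond_exp M (past k) (\<lambda>s. inner (G s) b) s = inner (?m s) b" for b
  proof -
    have mean_b: "(\<integral>t. inner (\<phi> (s, current k t)) b \<partial>M) = inner (?m s) b" for s
    proof -
      have "integrable M (\<lambda>t. \<phi> (s, current k t))"
        using mean(2) mean(1) by (rule integrable_of_square_integrable)
      then show ?thesis using mean(3) by (simp only: integral_inner_left)
    qed
    have meas_b: "(\<lambda>z. inner (\<phi> z) b) \<in> borel_measurable (past k \<Otimes>\<^sub>M ?N)" by measurable
    have int_b: "integrable M (\<lambda>s. inner (\<phi> (s, current k s)) b)"
      using Gint by (simp add: G[abs_def])
    show ?thesis
      using real_cond_exp_freezing[OF freeze meas_b int_b] unfolding mean_b G .
  qed
  then have "AE s in M. \<forall>b\<in>Basis. real_cond_exp M (past k) (\<lambda>s. inner (G s) b) s = inner (?m s) b"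
    by (intro AE_finite_allI) auto
  then show "AE s in M. vec_cond_exp M (past k) G s = ?m s"
  proof (rule AE_mp, intro AE_I2 impI)
    fix s assume "\<forall>b\<in>Basis. real_cond_exp M (past k) (\<lambda>s. inner (G s) b) s = inner (?m s) b"
    then have "vec_cond_exp M (past k) G s = (\<Sum>b\<in>Basis. inner (?m s) b *\<^sub>R b)"
      unfolding vec_cond_exp_def by (intro sum.cong) auto
    then show "vec_cond_exp M (past k) G s = ?m s" by (simp only: euclidean_representation)
  qed
qed

lemma coin_cond:
  fixes A B :: "nat \<Rightarrow> 'o \<Rightarrow> real"
  assumes A: "\<And>i. i \<in> {1..n} \<Longrightarrow> A i \<in> borel_measurable (past k)" "\<And>i. i \<in> {1..n} \<Longrightarrow> integrable M (A i)"
    and B: "\<And>i. i \<in> {1..n} \<Longrightarrow> B i \<in> borel_measurable (past k)" "\<And>i. i \<in> {1..n} \<Longrightarrow> integrable M (B i)"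
  shows "integrable M (\<lambda>s. \<Sum>i\<in>{1..n}. if coin i k s then A i s else B i s)"
    and "AE s in M. real_cond_exp M (past k) (\<lambda>s. \<Sum>i\<in>{1..n}. if coin i k s then A i s else B i s) s
      = (\<Sum>i\<in>{1..n}. p * A i s + (1 - p) * B i s)"
proof -
  let ?N = "PiM ({1..n} \<times> {k}) (\<lambda>_. law)"
  define \<phi> where "\<phi> = (\<lambda>(s, y :: nat \<times> nat \<Rightarrow> nat \<times> 's \<times> bool). \<Sum>i\<in>{1..n}. if snd (snd (y (i, k))) then A i s else B i s)"
  have \<phi>_current: "\<phi> (s, current k t) = (\<Sum>i\<in>{1..n}. if coin i k t then A i s else B i s)" for s t
    unfolding \<phi>_def by (simp add: current_apply draws_def del: One_nat_def cong: if_cong)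
  have coin_M: "Measurable.pred M (coin i k)" if "i \<in> {1..n}" for i
    using measurable_compose[OF draw_measurable[OF that, of k] coin_law] by (simp add: draws_def)
  show int: "integrable M (\<lambda>s. \<Sum>i\<in>{1..n}. if coin i k s then A i s else B i s)"
  proof (rule Bochner_Integration.integrable_sum)
    fix i assume i: "i \<in> {1..n}"
    have [measurable]: "A i \<in> borel_measurable M" "B i \<in> borel_measurable M" "Measurable.pred M (coin i k)"
      using A B i coin_M by auto
    show "integrable M (\<lambda>s. if coin i k s then A i s else B i s)"
      by (rule Bochner_Integration.integrable_bound[OF Bochner_Integration.integrable_add[OF
            integrable_norm[OF A(2)[OF i]] integrable_norm[OF B(2)[OF i]]]]) auto
  qed
  have \<phi>m: "\<phi> \<in> borel_measurable (past k \<Otimes>\<^sub>M ?N)"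
    unfolding \<phi>_def case_prod_beta
  proof (intro borel_measurable_sum)
    fix i assume i: "i \<in> {1..n}"
    have [measurable]: "Measurable.pred (past k \<Otimes>\<^sub>M ?N) (\<lambda>z. snd (snd (snd z (i, k))))"
      using measurable_compose[OF current_component_measurable[OF i, of k] coin_law] .
    have [measurable]: "A i \<in> borel_measurable (past k)" "B i \<in> borel_measurable (past k)"
      using A B i by auto
    show "(\<lambda>z. if snd (snd (snd z (i, k))) then A i (fst z) else B i (fst z))
        \<in> borel_measurable (past k \<Otimes>\<^sub>M ?N)"
      by measurable
  qed
  have law_coin: "(\<integral>t. (if coin i k t then \<alpha> else \<beta>) \<partial>M) = p * \<alpha> + (1 - p) * \<beta>"
    if i: "i \<in> {1..n}" for i and \<alpha> \<beta> :: real
  proof -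
    have "(\<lambda>z. if snd (snd z) then \<alpha> else \<beta>) \<in> borel_measurable law"
      using coin_law by measurable
    from integral_draw[OF i this, of k] show ?thesis
      using round_law_integral_coin[OF m S_prob, of p \<alpha> \<beta>] p by (simp add: draws_def)
  qed
  have "(\<integral>t. \<phi> (s, current k t) \<partial>M) = (\<Sum>i\<in>{1..n}. p * A i s + (1 - p) * B i s)" for s
  proof -
    have "integrable M (\<lambda>t. if coin i k t then A i s else B i s)" if "i \<in> {1..n}" for i
      using coin_M[OF that]
      by (intro integrable_const_bound[of _ "max \<bar>A i s\<bar> \<bar>B i s\<bar>"]) auto
    then show ?thesis
      unfolding \<phi>_current using law_coin by (simp del: One_nat_def)
  qed
  then show "AE s in M. real_cond_exp M (past k) (\<lambda>s. \<Sum>i\<in>{1..n}. if coin i k s then A i s else B i s) s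
      = (\<Sum>i\<in>{1..n}. p * A i s + (1 - p) * B i s)"
    using real_cond_exp_freezing[OF subalgebra_past current_measurable past_indep_current \<phi>m] int
    by (simp only: \<phi>_current)
qed

end

section \<open>The finite-sum objective\<close>

locale finite_sum_objective =
  fixes F :: "nat \<Rightarrow> nat \<Rightarrow> 'a::euclidean_space \<Rightarrow> real"
    and n m :: nat and L \<mu> :: real and xs :: 'a
  assumes n1: "n \<ge> 1" and m1: "m \<ge> 1" and L: "0 < L"
    and qsc: "quasi_strongly_convex \<mu> (f_global n m F) xs"
    and F_convex: "\<And>i j. i \<in> {1..n} \<Longrightarrow> j \<in> {1..m} \<Longrightarrow> convex_on UNIV (F i j)"
    and F_smooth: "\<And>i j. i \<in> {1..n} \<Longrightarrow> j \<in> {1..m} \<Longrightarrow> L_smooth L (F i j)"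
begin

abbreviation f where "f \<equiv> f_global n m F"

lemma f_local_eq: "f_local m F i = (\<lambda>x. 1 / real m * (\<Sum>j\<in>{1..m}. F i j x))"
  by (simp add: f_local_def fun_eq_iff)

lemma f_eq: "f = (\<lambda>x. 1 / real n * (\<Sum>i\<in>{1..n}. f_local m F i x))"
  by (simp add: f_global_def fun_eq_iff)

lemma local_smooth: "i \<in> {1..n} \<Longrightarrow> L_smooth L (f_local m F i)"
  using L_smooth_average[of "{1..m}" L "F i"] F_smooth m1 by (simp add: f_local_eq)

lemma f_smooth: "L_smooth L f"
  using L_smooth_average[of "{1..n}" L "f_local m F"] local_smooth n1 by (simp add: f_eq)

lemma f_convex: "convex_on UNIV f"
  unfolding f_eq f_local_eq
  by (intro convex_on_weighted_sum F_convex) auto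

lemma gradient_local:
  "i \<in> {1..n} \<Longrightarrow> gradient (f_local m F i) x = (1 / real m) *\<^sub>R (\<Sum>j\<in>{1..m}. gradient (F i j) x)"
  unfolding f_local_eq by (rule gradient_weighted_sum) (auto intro: F_smooth)

lemma gradient_f:
  "gradient f x = (1 / real n) *\<^sub>R (\<Sum>i\<in>{1..n}. gradient (f_local m F i) x)"
  unfolding f_eq by (rule gradient_weighted_sum) (auto intro: local_smooth)

lemma f_minimal: "f xs \<le> f x"
  using qsc by (auto simp: quasi_strongly_convex_def unique_minimizer_def)

lemma gradient_f_xs: "gradient f xs = 0"
  by (rule gradient_minimizer_eq_0[OF L_smooth_GDERIV[OF f_smooth] f_minimal])

lemma gradient_f_sq_le: "(norm (gradient f x))\<^sup>2 \<le> 2 * L * (f x - f xs)"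
  using convex_L_smooth_bregman[OF f_convex f_smooth L, of x xs] by (simp add: gradient_f_xs)

lemma \<mu>_le_L: "\<mu> \<le> L"
  by (rule quasi_strongly_convex_le_L[OF qsc f_convex f_smooth L])

lemma f_le_quadratic: "f x - f xs \<le> L / 2 * (norm (x - xs))\<^sup>2"
  using L_smooth_upper_bound[OF f_smooth, of x xs] by (simp add: gradient_f_xs)

lemma sigma_sq_nonneg: "0 \<le> sigma_sq n m F xs u"
  unfolding sigma_sq_def by (intro mult_nonneg_nonneg sum_nonneg) auto

text \<open>Summing the Bregman estimates of the components at the minimiser, the linear terms add up
  to the gradient of \<open>f\<close> there, which vanishes.\<close>

lemma sigma_sq_const_le: "sigma_sq n m F xs (\<lambda>_. x) \<le> 2 * L * (f x - f xs)"
proof -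
  let ?d = "\<lambda>i j. inner (gradient (F i j) xs) (x - xs)"
  have grad: "inner (gradient f xs) (x - xs)
      = 1 / (real n * real m) * (\<Sum>i\<in>{1..n}. \<Sum>j\<in>{1..m}. ?d i j)"
    unfolding gradient_f
    by (simp add: gradient_local inner_sum_left sum_distrib_left mult_ac del: One_nat_def)
  have "(\<Sum>i\<in>{1..n}. \<Sum>j\<in>{1..m}. (norm (gradient (F i j) x - gradient (F i j) xs))\<^sup>2)
      \<le> (\<Sum>i\<in>{1..n}. \<Sum>j\<in>{1..m}. 2 * L * (F i j x - F i j xs - ?d i j))"
    by (intro sum_mono convex_L_smooth_bregman F_convex F_smooth L)
  then have "sigma_sq n m F xs (\<lambda>_. x)
      \<le> 1 / (real n * real m) * (\<Sum>i\<in>{1..n}. \<Sum>j\<in>{1..m}. 2 * L * (F i j x - F i j xs - ?d i j))"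
    unfolding sigma_sq_def by (intro mult_left_mono) auto
  also have "\<dots> = 2 * L * (f x - f xs - inner (gradient f xs) (x - xs))"
    unfolding grad f_global_def f_local_def
    by (simp add: sum.distrib sum_subtractf sum_distrib_left algebra_simps)
  finally show ?thesis by (simp add: gradient_f_xs)
qed

text \<open>The vector that worker \<open>i\<close> quantizes when it picks component \<open>l\<close> at the point \<open>x\<close> with
  reference point \<open>w\<close>.\<close>

definition centred :: "'a \<Rightarrow> (nat \<Rightarrow> 'a) \<Rightarrow> nat \<Rightarrow> nat \<Rightarrow> 'a" where
  "centred x w i l = gradient (F i l) x - gradient (F i l) (w i)
     + gradient (f_local m F i) (w i) - gradient (f_local m F i) xs"

lemma mean_centred:
  "(1 / real n) *\<^sub>R (\<Sum>i\<in>{1..n}. (1 / real m) *\<^sub>R (\<Sum>l\<in>{1..m}. centred x w i l)) = gradient f x"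
proof -
  have "(1 / real m) *\<^sub>R (\<Sum>l\<in>{1..m}. centred x w i l)
      = gradient (f_local m F i) x - gradient (f_local m F i) xs" if i: "i \<in> {1..n}" for i
  proof -
    have "(\<Sum>l\<in>{1..m}. centred x w i l) = (\<Sum>l\<in>{1..m}. gradient (F i l) x)
        - (\<Sum>l\<in>{1..m}. gradient (F i l) (w i))
        + real m *\<^sub>R (gradient (f_local m F i) (w i) - gradient (f_local m F i) xs)"
      by (simp add: centred_def sum.distrib sum_subtractf scaleR_diff_right sum_constant_scaleR)
    then show ?thesis using m1 by (simp add: gradient_local[OF i] scaleR_add_right scaleR_diff_right)
  qed
  then have "(1 / real n) *\<^sub>R (\<Sum>i\<in>{1..n}. (1 / real m) *\<^sub>R (\<Sum>l\<in>{1..m}. centred x w i l))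
      = gradient f x - gradient f xs"
    by (simp add: gradient_f sum_subtractf scaleR_diff_right del: One_nat_def)
  then show ?thesis by (simp add: gradient_f_xs)
qed

lemma sum_norm_sq_centre_le:
  fixes B :: "nat \<Rightarrow> 'a"
  shows "(\<Sum>l\<in>{1..m}. (norm (B l - (1 / real m) *\<^sub>R (\<Sum>l\<in>{1..m}. B l)))\<^sup>2) \<le> (\<Sum>l\<in>{1..m}. (norm (B l))\<^sup>2)"
proof -
  define b where "b = (1 / real m) *\<^sub>R (\<Sum>l\<in>{1..m}. B l)"
  have sum: "(\<Sum>l\<in>{1..m}. B l) = real m *\<^sub>R b" using m1 by (simp add: b_def)
  have "(\<Sum>l\<in>{1..m}. (norm (B l - b))\<^sup>2)
      = (\<Sum>l\<in>{1..m}. (norm (B l))\<^sup>2 - 2 * inner (B l) b + (norm b)\<^sup>2)"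
    by (intro sum.cong refl) (simp add: power2_norm_eq_inner inner_commute algebra_simps)
  also have "\<dots> = (\<Sum>l\<in>{1..m}. (norm (B l))\<^sup>2) - 2 * inner (\<Sum>l\<in>{1..m}. B l) b + real m * (norm b)\<^sup>2"
    by (simp add: sum.distrib sum_subtractf sum_distrib_left inner_sum_left)
  also have "\<dots> = (\<Sum>l\<in>{1..m}. (norm (B l))\<^sup>2) - real m * (norm b)\<^sup>2"
    unfolding sum by (simp add: power2_norm_eq_inner)
  finally show ?thesis unfolding b_def[symmetric] by simp
qed

text \<open>The vector \<open>centred x w i l\<close> is the gradient difference between \<open>x\<close> and the minimiser, minus the
  one between \<open>w i\<close> and the minimiser recentred to have mean 0 over \<open>l\<close>. Recentring does not increase
  second moments, and this is what keeps the shift by \<open>gradient (f_local m F i) xs\<close> free of charge.\<close>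

lemma second_moment_centred:
  "1 / real n * (\<Sum>i\<in>{1..n}. 1 / real m * (\<Sum>l\<in>{1..m}. (norm (centred x w i l))\<^sup>2))
    \<le> 4 * L * (f x - f xs) + 2 * sigma_sq n m F xs w"
proof -
  define A where "A i l = gradient (F i l) x - gradient (F i l) xs" for i l
  define B where "B i l = gradient (F i l) (w i) - gradient (F i l) xs" for i l
  have "(\<Sum>l\<in>{1..m}. (norm (centred x w i l))\<^sup>2)
      \<le> 2 * (\<Sum>l\<in>{1..m}. (norm (A i l))\<^sup>2) + 2 * (\<Sum>l\<in>{1..m}. (norm (B i l))\<^sup>2)"
    if i: "i \<in> {1..n}" for i
  proof -
    let ?b = "(1 / real m) *\<^sub>R (\<Sum>l\<in>{1..m}. B i l)"
    have "centred x w i l = A i l + - (B i l - ?b)" for l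
      by (simp add: centred_def A_def B_def gradient_local[OF i] sum_subtractf scaleR_diff_right)
    then have "(\<Sum>l\<in>{1..m}. (norm (centred x w i l))\<^sup>2)
        \<le> (\<Sum>l\<in>{1..m}. 2 * (norm (A i l))\<^sup>2 + 2 * (norm (B i l - ?b))\<^sup>2)"
      using norm_add_sq_le[of "A i l" "- (B i l - ?b)" for l]
      by (intro sum_mono) (simp only: norm_minus_cancel)
    also have "\<dots> = 2 * (\<Sum>l\<in>{1..m}. (norm (A i l))\<^sup>2) + 2 * (\<Sum>l\<in>{1..m}. (norm (B i l - ?b))\<^sup>2)"
      by (simp add: sum.distrib sum_distrib_left)
    finally show ?thesis using sum_norm_sq_centre_le[of "B i"] by linarith
  qed
  then have "1 / real n * (\<Sum>i\<in>{1..n}. 1 / real m * (\<Sum>l\<in>{1..m}. (norm (centred x w i l))\<^sup>2))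
      \<le> 1 / real n * (\<Sum>i\<in>{1..n}. 1 / real m *
          (2 * (\<Sum>l\<in>{1..m}. (norm (A i l))\<^sup>2) + 2 * (\<Sum>l\<in>{1..m}. (norm (B i l))\<^sup>2)))"
    by (intro mult_left_mono sum_mono) auto
  also have "\<dots> = 2 * sigma_sq n m F xs (\<lambda>_. x) + 2 * sigma_sq n m F xs w"
    by (simp add: sigma_sq_def A_def B_def sum.distrib sum_distrib_left algebra_simps)
  finally show ?thesis using sigma_sq_const_le[of x] by linarith
qed

end

section \<open>The delayed process\<close>

lemma L_smooth_gradient_measurable:
  assumes "L_smooth L h" "X \<in> borel_measurable K"
  shows "(\<lambda>s. gradient h (X s)) \<in> borel_measurable K"
  using measurable_compose[OF assms(2) borel_measurable_continuous_onI[OF continuous_on_gradient[OF assms(1)]]] .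

lemma (in prob_space) L_smooth_gradient_square_integrable:
  assumes h: "L_smooth L h" and X[measurable]: "X \<in> borel_measurable M"
    and sq: "integrable M (\<lambda>s. (norm (X s))\<^sup>2)"
  shows "integrable M (\<lambda>s. (norm (gradient h (X s)))\<^sup>2)"
proof (rule Bochner_Integration.integrable_bound)
  show "integrable M (\<lambda>s. 2 * (L\<^sup>2 * (norm (X s))\<^sup>2) + 2 * (norm (gradient h 0))\<^sup>2)"
    using sq by simp
  have [measurable]: "(\<lambda>s. gradient h (X s)) \<in> borel_measurable M"
    using h X by (rule L_smooth_gradient_measurable)
  show "(\<lambda>s. (norm (gradient h (X s)))\<^sup>2) \<in> borel_measurable M" by measurable
  have "(norm (gradient h y))\<^sup>2 \<le> 2 * (L\<^sup>2 * (norm y)\<^sup>2) + 2 * (norm (gradient h 0))\<^sup>2" for y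
  proof -
    have "(norm (gradient h y - gradient h 0))\<^sup>2 \<le> (L * norm (y - 0))\<^sup>2"
      by (rule power_mono[OF L_smooth_gradient_lipschitz[OF h]]) simp
    then show ?thesis
      using norm_add_sq_le[of "gradient h y - gradient h 0" "gradient h 0"]
      by (simp add: power_mult_distrib)
  qed
  then show "AE s in M. norm ((norm (gradient h (X s)))\<^sup>2)
      \<le> norm (2 * (L\<^sup>2 * (norm (X s))\<^sup>2) + 2 * (norm (gradient h 0))\<^sup>2)"
    by (intro AE_I2) (simp add: abs_of_nonneg)
qed

locale delayed_qlsvrgstar =
  fresh_draws M S Q \<omega> p n m idx seed coin + finite_sum_objective F n m L \<mu> xs
  for M :: "'o measure" and S :: "'s measure" and Q :: "'s \<Rightarrow> 'a::euclidean_space \<Rightarrow> 'a"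
    and \<omega> p :: real and n m :: nat
    and idx :: "nat \<Rightarrow> nat \<Rightarrow> 'o \<Rightarrow> nat"
    and seed :: "nat \<Rightarrow> nat \<Rightarrow> 'o \<Rightarrow> 's"
    and coin :: "nat \<Rightarrow> nat \<Rightarrow> 'o \<Rightarrow> bool"
    and F :: "nat \<Rightarrow> nat \<Rightarrow> 'a \<Rightarrow> real" and L \<mu> :: real and xs :: 'a +
  fixes \<tau> :: nat and \<gamma> :: real and x0 :: 'a and w0 :: "nat \<Rightarrow> 'a"
    and x :: "nat \<Rightarrow> 'o \<Rightarrow> 'a"
    and g v e w :: "nat \<Rightarrow> nat \<Rightarrow> 'o \<Rightarrow> 'a"
  assumes \<tau>: "\<tau> \<ge> 1" and \<gamma>: "0 < \<gamma>"
    and framework: "delayed_framework M n \<tau> \<gamma> x0 x g v e"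
    and estimator: "qlsvrgstar_estimator M n m F xs Q w0 idx seed coin x g w"
begin

abbreviation g_mean where "g_mean \<equiv> worker_mean n g"
abbreviation e_mean where "e_mean \<equiv> worker_mean n e"
abbreviation gap where "gap k s \<equiv> f (x k s) - f xs"
abbreviation sig where "sig k s \<equiv> sigma_sq n m F xs (\<lambda>i. w i k s)"

lemma x_0: "s \<in> space M \<Longrightarrow> x 0 s = x0"
  using framework by (simp add: delayed_framework_def)

lemma v_mean:
  assumes "s \<in> space M"
  shows "worker_mean n v k s = (if \<tau> \<le> k then \<gamma> *\<^sub>R g_mean (k - \<tau>) s else 0)"
proof -
  have "(\<Sum>i\<in>{1..n}. v i k s) = (\<Sum>i\<in>{1..n}. if k \<ge> \<tau> then \<gamma> *\<^sub>R g i (k - \<tau>) s else 0)"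
    using framework assms by (intro sum.cong refl) (auto simp: delayed_framework_def)
  then show ?thesis by (simp add: worker_mean_def scaleR_sum_right mult.commute)
qed

lemma x_Suc:
  assumes "s \<in> space M"
  shows "x (Suc k) s = x k s - (if \<tau> \<le> k then \<gamma> *\<^sub>R g_mean (k - \<tau>) s else 0)"
  using framework assms unfolding v_mean[OF assms, symmetric] by (simp add: delayed_framework_def)

lemma e_0: "s \<in> space M \<Longrightarrow> e_mean 0 s = 0"
  using framework by (auto simp: delayed_framework_def worker_mean_def)

lemma e_Suc:
  assumes "s \<in> space M"
  shows "e_mean (Suc k) s = e_mean k s + \<gamma> *\<^sub>R g_mean k s
    - (if \<tau> \<le> k then \<gamma> *\<^sub>R g_mean (k - \<tau>) s else 0)"
proof -
  have "(\<Sum>i\<in>{1..n}. e i (Suc k) s) = (\<Sum>i\<in>{1..n}. e i k s + \<gamma> *\<^sub>R g i k s - v i k s)"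
    using framework assms by (intro sum.cong refl) (auto simp: delayed_framework_def)
  then show ?thesis
    unfolding v_mean[OF assms, symmetric] unfolding worker_mean_def
    by (simp add: sum.distrib sum_subtractf scaleR_add_right scaleR_diff_right
        scaleR_left_commute flip: scaleR_sum_right)
qed

text \<open>The accumulated error is what has been computed but not yet applied: the last \<open>\<tau>\<close> steps.\<close>

lemma e_window:
  assumes s: "s \<in> space M"
  shows "e_mean k s = \<gamma> *\<^sub>R (\<Sum>t\<in>{k - \<tau>..<k}. g_mean t s)"
proof (induction k)
  case 0
  show ?case using e_0[OF s] by simp
next
  case (Suc k)
  show ?case
  proof (cases "\<tau> \<le> k")
    case True
    let ?A = "\<Sum>t\<in>{k - \<tau>..<k}. g_mean t s" and ?W = "\<Sum>t\<in>{Suc k - \<tau>..<Suc k}. g_mean t s"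
    have "?A + g_mean k s = (\<Sum>t\<in>{k - \<tau>..<Suc k}. g_mean t s)"
      by (rule sum.atLeastLessThan_Suc[symmetric]) simp
    also have "\<dots> = g_mean (k - \<tau>) s + ?W"
      using True by (simp only: sum.atLeast_Suc_lessThan[of "k - \<tau>" "Suc k"] Suc_diff_le less_Suc_eq_le diff_le_self)
    finally have shift: "?A + g_mean k s = g_mean (k - \<tau>) s + ?W" .
    have "e_mean (Suc k) s = \<gamma> *\<^sub>R (?A + g_mean k s) - \<gamma> *\<^sub>R g_mean (k - \<tau>) s"
      using True by (simp add: e_Suc[OF s] Suc.IH scaleR_add_right)
    also have "\<dots> = \<gamma> *\<^sub>R ?W"
      unfolding shift by (simp only: scaleR_add_right add_diff_cancel_left')
    finally show ?thesis .
  next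
    case False
    then have "{Suc k - \<tau>..<Suc k} = insert k {k - \<tau>..<k}" by auto
    then show ?thesis
      using False by (simp add: e_Suc[OF s] Suc.IH scaleR_add_right)
  qed
qed

lemma w_0: "s \<in> space M \<Longrightarrow> i \<in> {1..n} \<Longrightarrow> w i 0 s = w0 i"
  using estimator by (simp add: qlsvrgstar_estimator_def)

lemma w_Suc:
  "s \<in> space M \<Longrightarrow> i \<in> {1..n} \<Longrightarrow> w i (Suc k) s = (if coin i k s then x k s else w i k s)"
  using estimator by (simp add: qlsvrgstar_estimator_def)

lemma g_mean_eq:
  assumes "s \<in> space M"
  shows "g_mean k s = (1 / real n) *\<^sub>R
    (\<Sum>i\<in>{1..n}. Q (seed i k s) (centred (x k s) (\<lambda>i. w i k s) i (idx i k s)))"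
  unfolding worker_mean_def
  using estimator assms
  by (intro arg_cong[where f = "scaleR (1 / real n)"] sum.cong refl)
    (auto simp: qlsvrgstar_estimator_def Let_def centred_def)

lemma centred_measurable:
  assumes "i \<in> {1..n}" "l \<in> {1..m}" "X \<in> borel_measurable K" "W i \<in> borel_measurable K"
  shows "(\<lambda>s. centred (X s) (\<lambda>i. W i s) i l) \<in> borel_measurable K"
  unfolding centred_def using assms
  by (intro borel_measurable_add borel_measurable_diff borel_measurable_const
      L_smooth_gradient_measurable[OF F_smooth] L_smooth_gradient_measurable[OF local_smooth])

lemma centred_square_integrable:
  assumes "i \<in> {1..n}" "l \<in> {1..m}" "X \<in> borel_measurable M" "W i \<in> borel_measurable M"
    "integrable M (\<lambda>s. (norm (X s))\<^sup>2)" "integrable M (\<lambda>s. (norm (W i s))\<^sup>2)"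
  shows "integrable M (\<lambda>s. (norm (centred (X s) (\<lambda>i. W i s) i l))\<^sup>2)"
  unfolding centred_def using assms
  by (intro integrable_norm2_add integrable_norm2_diff borel_measurable_add borel_measurable_diff
      borel_measurable_const L_smooth_gradient_measurable[OF F_smooth]
      L_smooth_gradient_measurable[OF local_smooth]
      L_smooth_gradient_square_integrable[OF F_smooth]
      L_smooth_gradient_square_integrable[OF local_smooth]) auto

lemma g_mean_measurable_step:
  assumes "x t \<in> borel_measurable (past t)" "\<And>i. i \<in> {1..n} \<Longrightarrow> w i t \<in> borel_measurable (past t)"
  shows "g_mean t \<in> borel_measurable (past (Suc t))"
proof -
  let ?P = "past (Suc t)"
  have "(\<lambda>s. Q (seed i t s) (centred (x t s) (\<lambda>i. w i t s) i (idx i t s))) \<in> borel_measurable ?P"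
    if i: "i \<in> {1..n}" for i
  proof (rule quantization_measurable[OF Q])
    note d = draw_measurable_past[OF i lessI[of t]]
    show "seed i t \<in> ?P \<rightarrow>\<^sub>M S"
      using measurable_compose[OF d seed_law] by (simp add: draws_def)
    have idx: "idx i t \<in> ?P \<rightarrow>\<^sub>M count_space {1..m}"
      using measurable_compose[OF d idx_law] by (simp add: draws_def)
    show "(\<lambda>s. centred (x t s) (\<lambda>i. w i t s) i (idx i t s)) \<in> borel_measurable ?P"
    proof (rule measurable_compose_countable'[OF _ idx])
      fix l assume l: "l \<in> {1..m}"
      show "(\<lambda>s. centred (x t s) (\<lambda>i. w i t s) i l) \<in> borel_measurable ?P"
        by (rule measurable_past_mono[OF centred_measurable[where W = "\<lambda>i. w i t",
              OF i l assms(1) assms(2)[OF i]]]) simp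
    qed simp
  qed
  then have "(\<lambda>s. (1 / real n) *\<^sub>R
      (\<Sum>i\<in>{1..n}. Q (seed i t s) (centred (x t s) (\<lambda>i. w i t s) i (idx i t s)))) \<in> borel_measurable ?P"
    by (intro borel_measurable_scaleR borel_measurable_sum borel_measurable_const)
  then show ?thesis
    by (subst measurable_cong[where g = "\<lambda>s. (1 / real n) *\<^sub>R
      (\<Sum>i\<in>{1..n}. Q (seed i t s) (centred (x t s) (\<lambda>i. w i t s) i (idx i t s)))"])
      (auto simp: g_mean_eq simp del: One_nat_def)
qed

text \<open>Strong induction is needed because \<open>x (Suc j)\<close> depends on the estimator of round \<open>j - \<tau>\<close>.\<close>

lemma adapted: "x k \<in> borel_measurable (past k) \<and> (\<forall>i\<in>{1..n}. w i k \<in> borel_measurable (past k))"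
proof (induction k rule: less_induct)
  case (less k)
  show ?case
  proof (cases k)
    case 0
    have "x 0 \<in> borel_measurable (past 0)"
      by (subst measurable_cong[where g = "\<lambda>_. x0"]) (auto simp: x_0)
    moreover have "w i 0 \<in> borel_measurable (past 0)" if "i \<in> {1..n}" for i
      using that by (subst measurable_cong[where g = "\<lambda>_. w0 i"]) (auto simp: w_0)
    ultimately show ?thesis using 0 by blast
  next
    case (Suc j)
    have jk: "j < k" "j \<le> k" "j - \<tau> < k" "Suc (j - \<tau>) \<le> k" using Suc by auto
    have xj: "x j \<in> borel_measurable (past k)"
      by (rule measurable_past_mono[OF _ jk(2)]) (use less[OF jk(1)] in blast)
    have wj: "w i j \<in> borel_measurable (past k)" if "i \<in> {1..n}" for i
      by (rule measurable_past_mono[OF _ jk(2)]) (use less[OF jk(1)] that in blast)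
    have gj: "g_mean (j - \<tau>) \<in> borel_measurable (past k)"
      by (rule measurable_past_mono[OF g_mean_measurable_step jk(4)]) (use less[OF jk(3)] in blast)+
    have "(\<lambda>s. x j s - (if \<tau> \<le> j then \<gamma> *\<^sub>R g_mean (j - \<tau>) s else 0)) \<in> borel_measurable (past k)"
      using xj gj by (cases "\<tau> \<le> j") auto
    then have "x k \<in> borel_measurable (past k)"
      unfolding Suc by (subst measurable_cong[OF x_Suc]) auto
    moreover have "w i k \<in> borel_measurable (past k)" if i: "i \<in> {1..n}" for i
    proof -
      have [measurable]: "Measurable.pred (past k) (coin i j)"
        using measurable_compose[OF draw_measurable_past[OF i] coin_law, of j k] Suc
        by (simp add: draws_def)
      have [measurable]: "x j \<in> borel_measurable (past k)" "w i j \<in> borel_measurable (past k)"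
        using xj wj i by auto
      have "(\<lambda>s. if coin i j s then x j s else w i j s) \<in> borel_measurable (past k)" by measurable
      then show ?thesis
        unfolding Suc by (subst measurable_cong[OF w_Suc[OF _ i]]) auto
    qed
    ultimately show ?thesis by blast
  qed
qed

lemma x_past: "x k \<in> borel_measurable (past k)"
  and w_past: "i \<in> {1..n} \<Longrightarrow> w i k \<in> borel_measurable (past k)"
  using adapted by auto

lemma x_meas: "x k \<in> borel_measurable M"
  and w_meas: "i \<in> {1..n} \<Longrightarrow> w i k \<in> borel_measurable M"
  using x_past w_past measurable_past_M by blast+

lemma g_past: "t < k \<Longrightarrow> g_mean t \<in> borel_measurable (past k)"
  using g_mean_measurable_step[OF x_past w_past] by (rule measurable_past_mono) auto

lemma g_meas: "g_mean k \<in> borel_measurable M"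
  using g_past[OF lessI] by (rule measurable_past_M)

lemma e_past: "e_mean k \<in> borel_measurable (past k)"
proof -
  have "(\<lambda>s. \<gamma> *\<^sub>R (\<Sum>t\<in>{k - \<tau>..<k}. g_mean t s)) \<in> borel_measurable (past k)"
    by (intro borel_measurable_scaleR borel_measurable_sum borel_measurable_const) (auto intro: g_past)
  then show ?thesis by (subst measurable_cong[OF e_window]) auto
qed

lemma e_meas: "e_mean k \<in> borel_measurable M"
  using e_past by (rule measurable_past_M)

text \<open>The past already determines \<open>x k\<close>, so adjoining it to the history changes nothing.\<close>

lemma history_eq_past: "history M law n draw x k = past k"
proof -
  let ?D = "\<Union>i\<in>{1..n}. \<Union>t\<in>{..<k}. {draw i t -` A \<inter> space M | A. A \<in> sets law}"
  let ?X = "{x k -` B \<inter> space M | B. B \<in> sets borel}"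
  have "?X \<subseteq> sets (past k)"
    using measurable_sets[OF x_past[of k]] by auto
  then have "sigma_sets (space M) (?X \<union> ?D) = sigma_sets (space M) ?D"
    unfolding sets_past by (intro sigma_sets_eqI) (auto intro: sigma_sets.Basic)
  then have "sets (history M law n draw x k) = sets (past k)"
    unfolding sets_past history_def by (subst sets_measure_of) auto
  moreover have "emeasure (history M law n draw x k) A = emeasure (past k) A" for A
    unfolding history_def past_def by (simp add: emeasure_sigma)
  ultimately show ?thesis by (intro measure_eqI)
qed

lemma g_mean_square_integrable_step:
  assumes "integrable M (\<lambda>s. (norm (x k s))\<^sup>2)" "\<And>i. i \<in> {1..n} \<Longrightarrow> integrable M (\<lambda>s. (norm (w i k s))\<^sup>2)"
  shows "integrable M (\<lambda>s. (norm (g_mean k s))\<^sup>2)"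
proof -
  have "integrable M (\<lambda>s. (norm ((1 / real n) *\<^sub>R
      (\<Sum>i\<in>{1..n}. Q (seed i k s) (centred (x k s) (\<lambda>i. w i k s) i (idx i k s)))))\<^sup>2)"
    using assms
    by (intro mean_quantized_draws_cond(2) centred_measurable centred_square_integrable
        x_past w_past x_meas w_meas)
  then show ?thesis
    by (subst Bochner_Integration.integrable_cong[OF refl]) (auto simp: g_mean_eq simp del: One_nat_def)
qed

lemma sq_state:
  "integrable M (\<lambda>s. (norm (x k s))\<^sup>2) \<and> (\<forall>i\<in>{1..n}. integrable M (\<lambda>s. (norm (w i k s))\<^sup>2))"
proof (induction k rule: less_induct)
  case (less k)
  show ?case
  proof (cases k)
    case 0
    have "integrable M (\<lambda>s. (norm (x 0 s))\<^sup>2)"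
      by (subst Bochner_Integration.integrable_cong[OF refl, where g = "\<lambda>_. (norm x0)\<^sup>2"]) (auto simp: x_0)
    moreover have "integrable M (\<lambda>s. (norm (w i 0 s))\<^sup>2)" if "i \<in> {1..n}" for i
      using that
      by (subst Bochner_Integration.integrable_cong[OF refl, where g = "\<lambda>_. (norm (w0 i))\<^sup>2"]) (auto simp: w_0)
    ultimately show ?thesis using 0 by blast
  next
    case (Suc j)
    have xj: "integrable M (\<lambda>s. (norm (x j s))\<^sup>2)"
      and wj: "\<And>i. i \<in> {1..n} \<Longrightarrow> integrable M (\<lambda>s. (norm (w i j s))\<^sup>2)"
      using less[of j] Suc by auto
    have gj: "integrable M (\<lambda>s. (norm (g_mean (j - \<tau>) s))\<^sup>2)"
      using less[of "j - \<tau>"] Suc by (intro g_mean_square_integrable_step) auto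
    have "integrable M (\<lambda>s. (norm (x j s - \<gamma> *\<^sub>R g_mean (j - \<tau>) s))\<^sup>2)"
      by (intro integrable_norm2_diff integrable_norm2_scaleR borel_measurable_scaleR
          borel_measurable_const x_meas g_meas xj gj)
    then have "integrable M (\<lambda>s. (norm (x j s - (if \<tau> \<le> j then \<gamma> *\<^sub>R g_mean (j - \<tau>) s else 0)))\<^sup>2)"
      using xj by (cases "\<tau> \<le> j") simp_all
    then have "integrable M (\<lambda>s. (norm (x k s))\<^sup>2)"
      unfolding Suc by (subst Bochner_Integration.integrable_cong[OF refl]) (auto simp: x_Suc)
    moreover have "integrable M (\<lambda>s. (norm (w i k s))\<^sup>2)" if i: "i \<in> {1..n}" for i
    proof (rule Bochner_Integration.integrable_bound[OF Bochner_Integration.integrable_add[OF xj wj[OF i]]])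
      show "(\<lambda>s. (norm (w i k s))\<^sup>2) \<in> borel_measurable M"
        using w_meas[OF i, of k] by measurable
      show "AE s in M. norm ((norm (w i k s))\<^sup>2) \<le> norm ((norm (x j s))\<^sup>2 + (norm (w i j s))\<^sup>2)"
        unfolding Suc using i by (intro AE_I2) (auto simp: w_Suc)
    qed
    ultimately show ?thesis by blast
  qed
qed

lemma x_sq: "integrable M (\<lambda>s. (norm (x k s))\<^sup>2)"
  and w_sq: "i \<in> {1..n} \<Longrightarrow> integrable M (\<lambda>s. (norm (w i k s))\<^sup>2)"
  using sq_state by auto

lemma g_sq: "integrable M (\<lambda>s. (norm (g_mean k s))\<^sup>2)"
  by (rule g_mean_square_integrable_step[OF x_sq w_sq])

lemma g_int: "integrable M (g_mean k)"
  by (rule integrable_of_square_integrable[OF g_meas g_sq])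

lemma e_sq: "integrable M (\<lambda>s. (norm (e_mean k s))\<^sup>2)"
proof -
  have "integrable M (\<lambda>s. (norm (\<gamma> *\<^sub>R (\<Sum>t\<in>{k - \<tau>..<k}. g_mean t s)))\<^sup>2)"
    by (intro integrable_norm2_scaleR integrable_norm2_sum g_meas g_sq) auto
  then show ?thesis
    by (subst Bochner_Integration.integrable_cong[OF refl]) (auto simp: e_window)
qed

lemma grad_past: "(\<lambda>s. gradient f (x k s)) \<in> borel_measurable (past k)"
  by (rule L_smooth_gradient_measurable[OF f_smooth x_past])

lemma grad_meas: "(\<lambda>s. gradient f (x k s)) \<in> borel_measurable M"
  using grad_past by (rule measurable_past_M)

lemma grad_sq: "integrable M (\<lambda>s. (norm (gradient f (x k s)))\<^sup>2)"
  by (rule L_smooth_gradient_square_integrable[OF f_smooth x_meas x_sq])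

lemma f_gap_integrable:
  assumes [measurable]: "X \<in> borel_measurable M" and sq: "integrable M (\<lambda>s. (norm (X s))\<^sup>2)"
  shows "integrable M (\<lambda>s. f (X s) - f xs)"
proof (rule Bochner_Integration.integrable_bound)
  have "integrable M (\<lambda>s. (norm (X s - xs))\<^sup>2)"
    using sq by (intro integrable_norm2_diff) auto
  then show "integrable M (\<lambda>s. L / 2 * (norm (X s - xs))\<^sup>2)" by simp
  have "f \<in> borel_measurable borel"
    by (rule borel_measurable_continuous_onI[OF continuous_on_L_smooth[OF f_smooth]])
  then show "(\<lambda>s. f (X s) - f xs) \<in> borel_measurable M" by measurable
  show "AE s in M. norm (f (X s) - f xs) \<le> norm (L / 2 * (norm (X s - xs))\<^sup>2)"
    using f_minimal f_le_quadratic L by (intro AE_I2) (simp add: abs_of_nonneg)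
qed

lemma gap_int: "integrable M (gap k)"
  by (rule f_gap_integrable[OF x_meas x_sq])

lemma gradient_dist_past:
  assumes "i \<in> {1..n}" "j \<in> {1..m}"
  shows "(\<lambda>s. (norm (gradient (F i j) (x k s) - gradient (F i j) xs))\<^sup>2) \<in> borel_measurable (past k)"
    and "(\<lambda>s. (norm (gradient (F i j) (w i k s) - gradient (F i j) xs))\<^sup>2) \<in> borel_measurable (past k)"
    and "integrable M (\<lambda>s. (norm (gradient (F i j) (x k s) - gradient (F i j) xs))\<^sup>2)"
    and "integrable M (\<lambda>s. (norm (gradient (F i j) (w i k s) - gradient (F i j) xs))\<^sup>2)"
proof -
  note F = F_smooth[OF assms]
  note [measurable] = L_smooth_gradient_measurable[OF F x_past[of k]]
    L_smooth_gradient_measurable[OF F w_past[OF assms(1), of k]]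
  show "(\<lambda>s. (norm (gradient (F i j) (x k s) - gradient (F i j) xs))\<^sup>2) \<in> borel_measurable (past k)"
    "(\<lambda>s. (norm (gradient (F i j) (w i k s) - gradient (F i j) xs))\<^sup>2) \<in> borel_measurable (past k)"
    by measurable
  show "integrable M (\<lambda>s. (norm (gradient (F i j) (x k s) - gradient (F i j) xs))\<^sup>2)"
    by (intro integrable_norm2_diff L_smooth_gradient_measurable[OF F]
        L_smooth_gradient_square_integrable[OF F] x_meas x_sq) auto
  show "integrable M (\<lambda>s. (norm (gradient (F i j) (w i k s) - gradient (F i j) xs))\<^sup>2)"
    using assms(1)
    by (intro integrable_norm2_diff L_smooth_gradient_measurable[OF F]
        L_smooth_gradient_square_integrable[OF F] w_meas w_sq) auto
qed

lemma sig_past: "sig k \<in> borel_measurable (past k)"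
  unfolding sigma_sq_def
  by (intro borel_measurable_times borel_measurable_sum borel_measurable_const gradient_dist_past)

lemma sig_meas: "sig k \<in> borel_measurable M"
  using sig_past by (rule measurable_past_M)

lemma sig_int: "integrable M (sig k)"
  unfolding sigma_sq_def
  by (intro integrable_mult_right Bochner_Integration.integrable_sum gradient_dist_past)

lemma sig_0: "s \<in> space M \<Longrightarrow> sig 0 s = sigma_sq n m F xs w0"
  unfolding sigma_sq_def by (intro arg_cong2[where f = "(*)"] refl sum.cong) (auto simp: w_0)

subsection \<open>Conditional moments\<close>

interpretation past: finite_measure_subalgebra M "past k" for k
  by unfold_locales (rule subalgebra_past)

lemma g_mean_cond:
  "AE s in M. vec_cond_exp M (past k) (g_mean k) s = gradient f (x k s)"
  "AE s in M. real_cond_exp M (past k) (\<lambda>s. (norm (g_mean k s))\<^sup>2) s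
    \<le> (1 + \<omega> / real n) * (4 * L * gap k s + 2 * sig k s)"
proof -
  define G where "G = (\<lambda>s. (1 / real n) *\<^sub>R
      (\<Sum>i\<in>{1..n}. Q (seed i k s) (centred (x k s) (\<lambda>i. w i k s) i (idx i k s))))"
  have gG: "g_mean k s = G s" if "s \<in> space M" for s
    unfolding G_def by (rule g_mean_eq[OF that])
  have C1: "\<And>i l. i \<in> {1..n} \<Longrightarrow> l \<in> {1..m} \<Longrightarrow>
      (\<lambda>s. centred (x k s) (\<lambda>i. w i k s) i l) \<in> borel_measurable (past k)"
    by (intro centred_measurable x_past w_past)
  have C2: "\<And>i l. i \<in> {1..n} \<Longrightarrow> l \<in> {1..m} \<Longrightarrow>
      integrable M (\<lambda>s. (norm (centred (x k s) (\<lambda>i. w i k s) i l))\<^sup>2)"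
    by (intro centred_square_integrable x_meas w_meas x_sq w_sq)
  note G = mean_quantized_draws_cond[of "\<lambda>s. centred (x k s) (\<lambda>i. w i k s)" k, OF C1 C2]
  have G1[measurable]: "G \<in> borel_measurable M" unfolding G_def by (rule G(1))
  have "AE s in M. vec_cond_exp M (past k) G s = (1 / real n) *\<^sub>R (\<Sum>i\<in>{1..n}.
      (1 / real m) *\<^sub>R (\<Sum>l\<in>{1..m}. centred (x k s) (\<lambda>i. w i k s) i l))"
    unfolding G_def by (rule G(3))
  then have G3: "AE s in M. vec_cond_exp M (past k) G s = gradient f (x k s)"
    unfolding mean_centred .
  have G4: "AE s in M. real_cond_exp M (past k) (\<lambda>s. (norm (G s))\<^sup>2) s
    \<le> (1 + \<omega> / real n) * (1 / real n * (\<Sum>i\<in>{1..n}. 1 / real m *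
        (\<Sum>l\<in>{1..m}. (norm (centred (x k s) (\<lambda>i. w i k s) i l))\<^sup>2)))"
    unfolding G_def by (rule G(4))
  note [measurable] = g_meas[of k]
  have "AE s in M. real_cond_exp M (past k) (\<lambda>s. inner (g_mean k s) b) s
      = real_cond_exp M (past k) (\<lambda>s. inner (G s) b) s" for b
    by (rule past.real_cond_exp_cong) (auto simp: gG)
  then have "AE s in M. \<forall>b\<in>Basis. real_cond_exp M (past k) (\<lambda>s. inner (g_mean k s) b) s
      = real_cond_exp M (past k) (\<lambda>s. inner (G s) b) s"
    by (intro AE_finite_allI) auto
  with G3 show "AE s in M. vec_cond_exp M (past k) (g_mean k) s = gradient f (x k s)"
  proof eventually_elim
    case (elim s)
    then have "vec_cond_exp M (past k) (g_mean k) s = vec_cond_exp M (past k) G s"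
      unfolding vec_cond_exp_def by (intro sum.cong) auto
    then show ?case using elim(1) by simp
  qed
  have "AE s in M. real_cond_exp M (past k) (\<lambda>s. (norm (g_mean k s))\<^sup>2) s
      = real_cond_exp M (past k) (\<lambda>s. (norm (G s))\<^sup>2) s"
    by (rule past.real_cond_exp_cong) (auto simp: gG)
  with G4 show "AE s in M. real_cond_exp M (past k) (\<lambda>s. (norm (g_mean k s))\<^sup>2) s
    \<le> (1 + \<omega> / real n) * (4 * L * gap k s + 2 * sig k s)"
  proof eventually_elim
    case (elim s)
    show ?case
      unfolding elim(2)
      by (rule order_trans[OF elim(1)], rule mult_left_mono[OF second_moment_centred])
        (use \<omega> in simp)
  qed
qed

text \<open>A coin flip replaces each reference point by the current iterate, whose gradient differences
  are controlled by the function gap.\<close>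

lemma sig_cond:
  "AE s in M. real_cond_exp M (past k) (sig (Suc k)) s \<le> (1 - p) * sig k s + 2 * (L * p) * gap k s"
proof -
  define A where "A i s = (\<Sum>j\<in>{1..m}. 1 / (real n * real m) *
      (norm (gradient (F i j) (x k s) - gradient (F i j) xs))\<^sup>2)" for i s
  define B where "B i s = (\<Sum>j\<in>{1..m}. 1 / (real n * real m) *
      (norm (gradient (F i j) (w i k s) - gradient (F i j) xs))\<^sup>2)" for i s
  have A: "(\<Sum>i\<in>{1..n}. A i s) = sigma_sq n m F xs (\<lambda>_. x k s)"
    and B: "(\<Sum>i\<in>{1..n}. B i s) = sig k s" for s
    by (simp_all add: A_def B_def sigma_sq_def sum_distrib_left)
  have mA: "A i \<in> borel_measurable (past k)" if "i \<in> {1..n}" for i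
    unfolding A_def[abs_def]
    by (intro borel_measurable_times borel_measurable_sum borel_measurable_const gradient_dist_past that)
  have iA: "integrable M (A i)" if "i \<in> {1..n}" for i
    unfolding A_def[abs_def]
    by (intro integrable_mult_right Bochner_Integration.integrable_sum gradient_dist_past that)
  have mB: "B i \<in> borel_measurable (past k)" if "i \<in> {1..n}" for i
    unfolding B_def[abs_def]
    by (intro borel_measurable_times borel_measurable_sum borel_measurable_const gradient_dist_past that)
  have iB: "integrable M (B i)" if "i \<in> {1..n}" for i
    unfolding B_def[abs_def]
    by (intro integrable_mult_right Bochner_Integration.integrable_sum gradient_dist_past that)
  let ?m = "\<lambda>s. \<Sum>i\<in>{1..n}. if coin i k s then A i s else B i s"
  note c = coin_cond[of A k B, OF mA iA mB iB]
  have c1: "integrable M ?m" by (rule c(1))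
  have c2: "AE s in M. real_cond_exp M (past k) ?m s = (\<Sum>i\<in>{1..n}. p * A i s + (1 - p) * B i s)"
    by (rule c(2))
  have "sig (Suc k) s = ?m s" if "s \<in> space M" for s
  proof -
    have "sig (Suc k) s = (\<Sum>i\<in>{1..n}. \<Sum>j\<in>{1..m}. 1 / (real n * real m) *
        (norm (gradient (F i j) (w i (Suc k) s) - gradient (F i j) xs))\<^sup>2)"
      by (simp add: sigma_sq_def sum_distrib_left)
    also have "\<dots> = ?m s"
      using that by (intro sum.cong refl) (auto simp: w_Suc A_def B_def)
    finally show ?thesis .
  qed
  then have "AE s in M. real_cond_exp M (past k) (sig (Suc k)) s = real_cond_exp M (past k) ?m s"
    by (intro past.real_cond_exp_cong AE_I2 sig_meas borel_measurable_integrable[OF c1])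
  with c2 show ?thesis
  proof eventually_elim
    case (elim s)
    have "(\<Sum>i\<in>{1..n}. p * A i s + (1 - p) * B i s)
        = p * sigma_sq n m F xs (\<lambda>_. x k s) + (1 - p) * sig k s"
      unfolding A[symmetric] B[symmetric] by (simp add: sum.distrib sum_distrib_left)
    also have "\<dots> \<le> p * (2 * L * gap k s) + (1 - p) * sig k s"
      using p by (intro add_right_mono mult_left_mono sigma_sq_const_le) auto
    finally show ?case using elim by (simp add: mult_ac)
  qed
qed

end

section \<open>Weighted sums\<close>

lemma weight_nonneg: "\<eta> < 1 \<Longrightarrow> 0 \<le> weight \<eta> k"
  by (simp add: weight_def)

lemma weight_0: "\<eta> < 1 \<Longrightarrow> (1 - \<eta>) * weight \<eta> 0 = 1"
  by (simp add: weight_def)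

lemma weight_Suc: "\<eta> < 1 \<Longrightarrow> (1 - \<eta>) * weight \<eta> (Suc k) = weight \<eta> k"
  by (simp add: weight_def)

text \<open>Within one window the weights grow by at most the factor \<open>1 / (1 - \<tau> * \<eta>)\<close>, by
  Bernoulli's inequality, and every index lies in at most \<open>\<tau>\<close> windows.\<close>

lemma weighted_window_sum_le:
  fixes c :: "nat \<Rightarrow> real"
  assumes c: "\<And>t. 0 \<le> c t" and \<eta>: "0 \<le> \<eta>" "\<eta> < 1" and small: "\<eta> * real \<tau> \<le> 1 / 16"
  shows "(\<Sum>k=0..K. weight \<eta> k * (\<Sum>t\<in>{k - \<tau>..<k}. c t))
    \<le> 16 / 15 * real \<tau> * (\<Sum>t=0..K. weight \<eta> t * c t)"
proof -
  have grow: "weight \<eta> k \<le> 16 / 15 * weight \<eta> t" if "t < k" "k \<le> t + \<tau>" for k t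
  proof -
    have "15 / 16 \<le> 1 + real (k - t) * (- \<eta>)"
    proof -
      have "real (k - t) * \<eta> \<le> real \<tau> * \<eta>"
        using that \<eta> by (intro mult_right_mono) auto
      then show ?thesis using small by (simp add: mult.commute)
    qed
    also have "\<dots> \<le> (1 + (- \<eta>)) ^ (k - t)"
      using \<eta> by (intro Bernoulli_inequality) simp
    finally have B: "15 / 16 \<le> (1 - \<eta>) ^ (k - t)" by simp
    have eq: "(1 - \<eta>) ^ (k + 1) = (1 - \<eta>) ^ (k - t) * (1 - \<eta>) ^ (t + 1)"
      using that by (simp flip: power_add)
    have "15 / 16 * (1 - \<eta>) ^ (t + 1) \<le> (1 - \<eta>) ^ (k + 1)"
      unfolding eq using B \<eta> by (intro mult_right_mono) auto
    then have "1 / (1 - \<eta>) ^ (k + 1) \<le> 1 / (15 / 16 * (1 - \<eta>) ^ (t + 1))"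
      by (rule divide_left_mono) (use \<eta> in auto)
    then show ?thesis by (simp add: weight_def)
  qed
  have "(\<Sum>k=0..K. weight \<eta> k * (\<Sum>t\<in>{k - \<tau>..<k}. c t))
      \<le> (\<Sum>k=0..K. \<Sum>t\<in>{t\<in>{0..K}. t < k \<and> k \<le> t + \<tau>}. 16 / 15 * (weight \<eta> t * c t))"
  proof (rule sum_mono)
    fix k assume "k \<in> {0..K}"
    then have "{k - \<tau>..<k} = {t\<in>{0..K}. t < k \<and> k \<le> t + \<tau>}" by auto
    then have "weight \<eta> k * (\<Sum>t\<in>{k - \<tau>..<k}. c t)
        = (\<Sum>t\<in>{t\<in>{0..K}. t < k \<and> k \<le> t + \<tau>}. weight \<eta> k * c t)"
      by (simp add: sum_distrib_left)
    also have "\<dots> \<le> (\<Sum>t\<in>{t\<in>{0..K}. t < k \<and> k \<le> t + \<tau>}. 16 / 15 * weight \<eta> t * c t)"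
      by (intro sum_mono mult_right_mono grow c) auto
    finally show "weight \<eta> k * (\<Sum>t\<in>{k - \<tau>..<k}. c t)
        \<le> (\<Sum>t\<in>{t\<in>{0..K}. t < k \<and> k \<le> t + \<tau>}. 16 / 15 * (weight \<eta> t * c t))"
      by (simp add: mult.assoc)
  qed
  also have "\<dots> = (\<Sum>t=0..K. \<Sum>k\<in>{k\<in>{0..K}. t < k \<and> k \<le> t + \<tau>}. 16 / 15 * (weight \<eta> t * c t))"
    by (rule sum.swap_restrict) auto
  also have "\<dots> \<le> (\<Sum>t=0..K. real \<tau> * (16 / 15 * (weight \<eta> t * c t)))"
  proof (rule sum_mono)
    fix t
    have "card {k\<in>{0..K}. t < k \<and> k \<le> t + \<tau>} \<le> card {t<..t + \<tau>}"
      by (intro card_mono) auto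
    then have "real (card {k\<in>{0..K}. t < k \<and> k \<le> t + \<tau>}) \<le> real \<tau>" by simp
    then show "(\<Sum>k\<in>{k\<in>{0..K}. t < k \<and> k \<le> t + \<tau>}. 16 / 15 * (weight \<eta> t * c t))
        \<le> real \<tau> * (16 / 15 * (weight \<eta> t * c t))"
      unfolding sum_constant using c weight_nonneg[OF \<eta>(2)] by (intro mult_right_mono) auto
  qed
  also have "\<dots> = 16 / 15 * real \<tau> * (\<Sum>t=0..K. weight \<eta> t * c t)"
    by (simp add: sum_distrib_left mult_ac)
  finally show ?thesis .
qed

text \<open>The weights grow more slowly than the sequence contracts, since \<open>\<eta> \<le> p / 4\<close>; a net contraction
  of at least \<open>3 * p / 4\<close> remains after weighting.\<close>

lemma weighted_sum_contraction:
  fixes s r :: "nat \<Rightarrow> real"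
  assumes rec: "\<And>k. s (Suc k) \<le> (1 - p) * s k + q * r k" and s: "\<And>k. 0 \<le> s k"
    and p: "0 < p" "p < 1" and \<eta>: "0 \<le> \<eta>" "\<eta> \<le> p / 4"
  shows "(\<Sum>k=0..K. weight \<eta> k * s k) \<le> 4 / (3 * p) * (s 0 + q * (\<Sum>k=0..K. weight \<eta> k * r k))"
proof -
  have \<eta>1: "\<eta> < 1" using p \<eta> by simp
  note w = weight_nonneg[OF \<eta>1]
  have step: "weight \<eta> k * s (Suc k)
      \<le> (1 - \<eta>) * (weight \<eta> k * s k) - (p - \<eta>) * (weight \<eta> k * s k) + q * (weight \<eta> k * r k)" for k
    using mult_left_mono[OF rec[of k] w[of k]] by (simp add: algebra_simps)
  have "(p - \<eta>) * (\<Sum>k=0..K. weight \<eta> k * s k) + weight \<eta> K * s (Suc K)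
      \<le> s 0 + q * (\<Sum>k=0..K. weight \<eta> k * r k)"
  proof (induction K)
    case 0
    have "(1 - \<eta>) * (weight \<eta> 0 * s 0) = s 0"
      using weight_0[OF \<eta>1] by (metis mult.assoc mult_1)
    with step[of 0] have "(p - \<eta>) * (weight \<eta> 0 * s 0) + weight \<eta> 0 * s (Suc 0)
        \<le> s 0 + q * (weight \<eta> 0 * r 0)" by linarith
    then show ?case by simp
  next
    case (Suc K)
    have "(1 - \<eta>) * (weight \<eta> (Suc K) * s (Suc K)) = weight \<eta> K * s (Suc K)"
      using weight_Suc[OF \<eta>1] by (metis mult.assoc)
    then show ?case
      using step[of "Suc K"] Suc.IH unfolding sum.atLeast0_atMost_Suc distrib_left by linarith
  qed
  moreover have "0 \<le> weight \<eta> K * s (Suc K)" using w s by simp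
  moreover have "3 * p / 4 * (\<Sum>k=0..K. weight \<eta> k * s k) \<le> (p - \<eta>) * (\<Sum>k=0..K. weight \<eta> k * s k)"
    using \<eta> w s by (intro mult_right_mono sum_nonneg mult_nonneg_nonneg) auto
  ultimately have "3 * p / 4 * (\<Sum>k=0..K. weight \<eta> k * s k) \<le> s 0 + q * (\<Sum>k=0..K. weight \<eta> k * r k)"
    by linarith
  then show ?thesis using p by (simp add: field_simps)
qed

text \<open>The weights are the inverse powers of the contraction factor, so the weighted inequalities
  telescope.\<close>

lemma weighted_sum_descent:
  fixes T r d :: "nat \<Rightarrow> real"
  assumes rec: "\<And>k. T (Suc k) \<le> (1 - \<eta>) * T k - c * r k + b * d k" and T: "\<And>k. 0 \<le> T k"
    and \<eta>: "\<eta> < 1"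
  shows "c * (\<Sum>k=0..K. weight \<eta> k * r k) \<le> T 0 + b * (\<Sum>k=0..K. weight \<eta> k * d k)"
proof -
  note w = weight_nonneg[OF \<eta>]
  have step: "weight \<eta> k * T (Suc k)
      \<le> (1 - \<eta>) * weight \<eta> k * T k - c * (weight \<eta> k * r k) + b * (weight \<eta> k * d k)" for k
    using mult_left_mono[OF rec[of k] w[of k]] by (simp add: algebra_simps)
  have "weight \<eta> K * T (Suc K) + c * (\<Sum>k=0..K. weight \<eta> k * r k)
      \<le> T 0 + b * (\<Sum>k=0..K. weight \<eta> k * d k)"
  proof (induction K)
    case 0
    show ?case using step[of 0] unfolding weight_0[OF \<eta>] by simp
  next
    case (Suc K)
    show ?case
      using step[of "Suc K"] Suc.IH unfolding weight_Suc[OF \<eta>] by (simp add: algebra_simps)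
  qed
  moreover have "0 \<le> weight \<eta> K * T (Suc K)" using w T by simp
  ultimately show ?thesis by linarith
qed

section \<open>Unconditional recursions\<close>

context delayed_qlsvrgstar
begin

interpretation past: finite_measure_subalgebra M "past k" for k
  by unfold_locales (rule subalgebra_past)

definition a where "a = 1 + 2 * \<omega> / real n"
definition mean_gap where "mean_gap k = (\<integral>s. gap k s \<partial>M)"
definition mean_sig where "mean_sig k = (\<integral>s. sig k s \<partial>M)"
definition mean_err where "mean_err k = (\<integral>s. (norm (e_mean k s))\<^sup>2 \<partial>M)"

lemma a_ge_1: "1 \<le> a"
  using \<omega> by (simp add: a_def)

lemma mean_gap_nonneg: "0 \<le> mean_gap k"
  unfolding mean_gap_def using f_minimal by (intro integral_nonneg_AE AE_I2) simp

lemma mean_sig_nonneg: "0 \<le> mean_sig k"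
  unfolding mean_sig_def using sigma_sq_nonneg by (intro integral_nonneg_AE AE_I2)

lemma mean_sig_0: "mean_sig 0 = sigma_sq n m F xs w0"
proof -
  have "mean_sig 0 = (\<integral>s. sigma_sq n m F xs w0 \<partial>M)"
    unfolding mean_sig_def by (intro Bochner_Integration.integral_cong refl sig_0)
  then show ?thesis by (simp add: prob_space)
qed

lemma g_mean_unbiased_inner:
  assumes u: "u \<in> borel_measurable (past k)" and sq: "integrable M (\<lambda>s. (norm (u s))\<^sup>2)"
  shows "(\<integral>s. inner (u s) (g_mean k s) \<partial>M) = (\<integral>s. inner (u s) (gradient f (x k s)) \<partial>M)"
proof -
  have uM: "u \<in> borel_measurable M" using u by (rule measurable_past_M)
  note [measurable] = uM g_meas[of k] grad_meas[of k]
  have comp: "integrable M (\<lambda>s. inner (u s) b * inner (X s) b)"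
    if [measurable]: "X \<in> borel_measurable M" and X: "integrable M (\<lambda>s. (norm (X s))\<^sup>2)" and b: "b \<in> Basis"
    for X :: "'o \<Rightarrow> 'a" and b
  proof (rule Bochner_Integration.integrable_bound[OF Bochner_Integration.integrable_add[OF sq X]])
    have "\<bar>inner y b * inner z b\<bar> \<le> (norm y)\<^sup>2 + (norm z)\<^sup>2" for y z :: 'a
    proof -
      have "\<bar>inner y b\<bar> * \<bar>inner z b\<bar> \<le> norm y * norm z"
        using Basis_le_norm[OF b] by (intro mult_mono) auto
      also have "\<dots> \<le> (norm y)\<^sup>2 + (norm z)\<^sup>2"
        using sum_squares_bound[of "norm y" "norm z"] mult_nonneg_nonneg[OF norm_ge_zero norm_ge_zero, of y z]
        by linarith
      finally show ?thesis by (simp add: abs_mult)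
    qed
    then show "AE s in M. norm (inner (u s) b * inner (X s) b) \<le> norm ((norm (u s))\<^sup>2 + (norm (X s))\<^sup>2)"
      by simp
  qed measurable
  have "(\<integral>s. inner (u s) b * inner (g_mean k s) b \<partial>M)
      = (\<integral>s. inner (u s) b * inner (gradient f (x k s)) b \<partial>M)" if b: "b \<in> Basis" for b
  proof -
    have ub: "(\<lambda>s. inner (u s) b) \<in> borel_measurable (past k)" using u by measurable
    have gb: "(\<lambda>s. inner (g_mean k s) b) \<in> borel_measurable M" by measurable
    have "(\<integral>s. inner (u s) b * inner (g_mean k s) b \<partial>M)
        = (\<integral>s. inner (u s) b * real_cond_exp M (past k) (\<lambda>s. inner (g_mean k s) b) s \<partial>M)"
      by (rule past.real_cond_exp_intg(2)[OF comp[OF g_meas g_sq b] ub gb, symmetric])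
    also have "\<dots> = (\<integral>s. inner (u s) b * inner (gradient f (x k s)) b \<partial>M)"
    proof (rule integral_cong_AE)
      show "AE s in M. inner (u s) b * real_cond_exp M (past k) (\<lambda>s. inner (g_mean k s) b) s
          = inner (u s) b * inner (gradient f (x k s)) b"
        using g_mean_cond(1)[of k]
      proof eventually_elim
        case (elim s)
        show ?case
          unfolding elim[symmetric] vec_cond_exp_def using b by (simp add: inner_sum_left_Basis)
      qed
    qed measurable
    finally show ?thesis .
  qed
  then have "(\<Sum>b\<in>Basis. \<integral>s. inner (u s) b * inner (g_mean k s) b \<partial>M)
      = (\<Sum>b\<in>Basis. \<integral>s. inner (u s) b * inner (gradient f (x k s)) b \<partial>M)"
    by (rule sum.cong[OF refl])
  moreover have "(\<integral>s. inner (u s) (X s) \<partial>M) = (\<Sum>b\<in>Basis. \<integral>s. inner (u s) b * inner (X s) b \<partial>M)"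
    if "X \<in> borel_measurable M" "integrable M (\<lambda>s. (norm (X s))\<^sup>2)" for X :: "'o \<Rightarrow> 'a"
  proof -
    have "(\<integral>s. inner (u s) (X s) \<partial>M) = (\<integral>s. (\<Sum>b\<in>Basis. inner (u s) b * inner (X s) b) \<partial>M)"
      by (intro Bochner_Integration.integral_cong refl euclidean_inner)
    also have "\<dots> = (\<Sum>b\<in>Basis. \<integral>s. inner (u s) b * inner (X s) b \<partial>M)"
      by (intro Bochner_Integration.integral_sum comp that)
    finally show ?thesis .
  qed
  ultimately show ?thesis by (simp only: g_meas g_sq grad_meas grad_sq)
qed

lemma g_mean_second_moment: "(\<integral>s. (norm (g_mean k s))\<^sup>2 \<partial>M) \<le> a * (4 * L * mean_gap k + 2 * mean_sig k)"
proof -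
  have "(\<integral>s. (norm (g_mean k s))\<^sup>2 \<partial>M)
      = (\<integral>s. real_cond_exp M (past k) (\<lambda>s. (norm (g_mean k s))\<^sup>2) s \<partial>M)"
    by (rule past.real_cond_exp_int(2)[OF g_sq, symmetric])
  also have "\<dots> \<le> (\<integral>s. (1 + \<omega> / real n) * (4 * L * gap k s + 2 * sig k s) \<partial>M)"
    using gap_int sig_int
    by (intro integral_mono_AE past.real_cond_exp_int(1) g_sq g_mean_cond) auto
  also have "\<dots> = (1 + \<omega> / real n) * (4 * L * mean_gap k + 2 * mean_sig k)"
  proof -
    have "(\<integral>s. 4 * L * gap k s + 2 * sig k s \<partial>M) = 4 * L * mean_gap k + 2 * mean_sig k"
      unfolding mean_gap_def mean_sig_def
      by (subst Bochner_Integration.integral_add) (use gap_int sig_int in auto)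
    then show ?thesis by (simp only: integral_mult_right_zero)
  qed
  also have "\<dots> \<le> a * (4 * L * mean_gap k + 2 * mean_sig k)"
    using \<omega> L mean_gap_nonneg[of k] mean_sig_nonneg[of k] unfolding a_def
    by (intro mult_right_mono add_left_mono divide_right_mono) auto
  finally show ?thesis .
qed

lemma mean_sig_Suc: "mean_sig (Suc k) \<le> (1 - p) * mean_sig k + 2 * (L * p) * mean_gap k"
proof -
  have "mean_sig (Suc k) = (\<integral>s. real_cond_exp M (past k) (sig (Suc k)) s \<partial>M)"
    unfolding mean_sig_def by (rule past.real_cond_exp_int(2)[OF sig_int, symmetric])
  also have "\<dots> \<le> (\<integral>s. (1 - p) * sig k s + 2 * (L * p) * gap k s \<partial>M)"
    using gap_int sig_int
    by (intro integral_mono_AE past.real_cond_exp_int(1) sig_int sig_cond) auto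
  also have "\<dots> = (1 - p) * mean_sig k + 2 * (L * p) * mean_gap k"
    unfolding mean_gap_def mean_sig_def
    by (subst Bochner_Integration.integral_add) (use gap_int sig_int in auto)
  finally show ?thesis .
qed

text \<open>Splitting each \<open>g_mean t\<close> into gradient and noise, the gradients of one window are bounded
  by Cauchy-Schwarz at the price of a factor \<open>\<tau>\<close>, while the noises are martingale differences
  and hence orthogonal, so that they cost no such factor.\<close>

lemma mean_err_le:
  "mean_err k \<le> \<gamma>\<^sup>2 * (\<Sum>t\<in>{k - \<tau>..<k}. (4 * L * real \<tau> + 8 * L * a) * mean_gap t + 4 * a * mean_sig t)"
proof -
  let ?W = "{k - \<tau>..<k}"
  define G where "G t s = gradient f (x t s)" for t s
  define z where "z t s = g_mean t s - G t s" for t s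
  have Gm: "G t \<in> borel_measurable M" and Gsq: "integrable M (\<lambda>s. (norm (G t s))\<^sup>2)"
    and Gp: "G t \<in> borel_measurable (past t)" for t
    unfolding G_def[abs_def] by (rule grad_meas grad_sq grad_past)+
  have zm: "z t \<in> borel_measurable M" for t
    unfolding z_def[abs_def] by (intro borel_measurable_diff g_meas Gm)
  have zsq: "integrable M (\<lambda>s. (norm (z t s))\<^sup>2)" for t
    unfolding z_def by (intro integrable_norm2_diff g_meas g_sq Gm Gsq)
  have zp: "z t \<in> borel_measurable (past j)" if "t < j" for t j
    unfolding z_def[abs_def] using that
    by (intro borel_measurable_diff g_past measurable_past_mono[OF Gp]) auto
  have orth: "(\<integral>s. inner (u s) (z t s) \<partial>M) = 0"
    if u: "u \<in> borel_measurable (past t)" and usq: "integrable M (\<lambda>s. (norm (u s))\<^sup>2)" for u t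
  proof -
    have um: "u \<in> borel_measurable M" using u by (rule measurable_past_M)
    have "(\<integral>s. inner (u s) (z t s) \<partial>M) = (\<integral>s. inner (u s) (g_mean t s) - inner (u s) (G t s) \<partial>M)"
      by (simp add: z_def inner_diff_right)
    also have "\<dots> = (\<integral>s. inner (u s) (g_mean t s) \<partial>M) - (\<integral>s. inner (u s) (G t s) \<partial>M)"
      by (intro Bochner_Integration.integral_diff integrable_inner_of_norm2 um usq g_meas g_sq Gm Gsq)
    also have "\<dots> = 0"
      using g_mean_unbiased_inner[OF u usq] by (simp add: G_def)
    finally show ?thesis .
  qed
  have cross: "(\<integral>s. inner (z i s) (z j s) \<partial>M) = (if i = j then \<integral>s. (norm (z i s))\<^sup>2 \<partial>M else 0)" for i j
  proof (cases i j rule: linorder_cases)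
    case less
    then show ?thesis using orth[OF zp[OF less] zsq] by simp
  next
    case equal
    then show ?thesis by (simp add: power2_norm_eq_inner)
  next
    case greater
    then show ?thesis using orth[OF zp[OF greater] zsq] by (simp add: inner_commute)
  qed
  have noise: "(\<integral>s. (norm (\<Sum>t\<in>?W. z t s))\<^sup>2 \<partial>M) = (\<Sum>t\<in>?W. \<integral>s. (norm (z t s))\<^sup>2 \<partial>M)"
    unfolding integral_norm_sum_sq[OF zm zsq] cross by (simp add: sum.delta)
  have z_le: "(\<integral>s. (norm (z t s))\<^sup>2 \<partial>M) \<le> a * (4 * L * mean_gap t + 2 * mean_sig t)" for t
  proof -
    have "(\<integral>s. (norm (g_mean t s))\<^sup>2 \<partial>M)
        = (\<integral>s. (norm (z t s))\<^sup>2 + (2 * inner (G t s) (z t s) + (norm (G t s))\<^sup>2) \<partial>M)"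
      by (intro Bochner_Integration.integral_cong refl)
        (simp add: z_def power2_norm_eq_inner inner_commute algebra_simps)
    also have "\<dots> = (\<integral>s. (norm (z t s))\<^sup>2 \<partial>M)
        + (2 * (\<integral>s. inner (G t s) (z t s) \<partial>M) + (\<integral>s. (norm (G t s))\<^sup>2 \<partial>M))"
      using zsq Gsq integrable_inner_of_norm2[OF Gm zm Gsq zsq] by simp
    also have "(\<integral>s. inner (G t s) (z t s) \<partial>M) = 0" by (rule orth[OF Gp Gsq])
    finally have "(\<integral>s. (norm (g_mean t s))\<^sup>2 \<partial>M)
        = (\<integral>s. (norm (z t s))\<^sup>2 \<partial>M) + (\<integral>s. (norm (G t s))\<^sup>2 \<partial>M)" by simp
    moreover have "0 \<le> (\<integral>s. (norm (G t s))\<^sup>2 \<partial>M)"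
      by (intro integral_nonneg_AE AE_I2) simp
    ultimately show ?thesis using g_mean_second_moment[of t] by linarith
  qed
  have G_le: "(\<integral>s. (norm (\<Sum>t\<in>?W. G t s))\<^sup>2 \<partial>M) \<le> real \<tau> * (\<Sum>t\<in>?W. 2 * L * mean_gap t)"
  proof -
    have "(\<integral>s. (norm (\<Sum>t\<in>?W. G t s))\<^sup>2 \<partial>M) \<le> (\<integral>s. real \<tau> * (\<Sum>t\<in>?W. 2 * L * gap t s) \<partial>M)"
    proof (rule integral_mono)
      show "integrable M (\<lambda>s. (norm (\<Sum>t\<in>?W. G t s))\<^sup>2)"
        by (intro integrable_norm2_sum Gm Gsq) auto
      show "integrable M (\<lambda>s. real \<tau> * (\<Sum>t\<in>?W. 2 * L * gap t s))"
        by (intro integrable_mult_right Bochner_Integration.integrable_sum gap_int)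
      fix s
      have "(norm (\<Sum>t\<in>?W. G t s))\<^sup>2 \<le> real (card ?W) * (\<Sum>t\<in>?W. (norm (G t s))\<^sup>2)"
        by (rule norm_sum_sq_le)
      also have "\<dots> \<le> real \<tau> * (\<Sum>t\<in>?W. 2 * L * gap t s)"
        unfolding G_def by (intro mult_mono sum_mono gradient_f_sq_le sum_nonneg) auto
      finally show "(norm (\<Sum>t\<in>?W. G t s))\<^sup>2 \<le> real \<tau> * (\<Sum>t\<in>?W. 2 * L * gap t s)" .
    qed
    also have "\<dots> = real \<tau> * (\<Sum>t\<in>?W. 2 * L * mean_gap t)"
    proof -
      have "(\<integral>s. (\<Sum>t\<in>?W. 2 * L * gap t s) \<partial>M) = (\<Sum>t\<in>?W. \<integral>s. 2 * L * gap t s \<partial>M)"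
        by (intro Bochner_Integration.integral_sum integrable_mult_right gap_int)
      then show ?thesis by (simp only: integral_mult_right_zero mean_gap_def)
    qed
    finally show ?thesis .
  qed
  have "mean_err k = (\<integral>s. (norm (\<gamma> *\<^sub>R (\<Sum>t\<in>?W. g_mean t s)))\<^sup>2 \<partial>M)"
    unfolding mean_err_def by (intro Bochner_Integration.integral_cong refl) (simp add: e_window)
  also have "\<dots> = \<gamma>\<^sup>2 * (\<integral>s. (norm (\<Sum>t\<in>?W. g_mean t s))\<^sup>2 \<partial>M)"
    by (simp add: power_mult_distrib)
  also have "\<dots> \<le> \<gamma>\<^sup>2 * (2 * (\<integral>s. (norm (\<Sum>t\<in>?W. G t s))\<^sup>2 \<partial>M) + 2 * (\<integral>s. (norm (\<Sum>t\<in>?W. z t s))\<^sup>2 \<partial>M))"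
  proof (rule mult_left_mono)
    have iG: "integrable M (\<lambda>s. (norm (\<Sum>t\<in>?W. G t s))\<^sup>2)"
      and iz: "integrable M (\<lambda>s. (norm (\<Sum>t\<in>?W. z t s))\<^sup>2)"
      and ig: "integrable M (\<lambda>s. (norm (\<Sum>t\<in>?W. g_mean t s))\<^sup>2)"
      by (intro integrable_norm2_sum Gm Gsq zm zsq g_meas g_sq finite_atLeastLessThan)+
    have "(\<integral>s. (norm (\<Sum>t\<in>?W. g_mean t s))\<^sup>2 \<partial>M)
        \<le> (\<integral>s. 2 * (norm (\<Sum>t\<in>?W. G t s))\<^sup>2 + 2 * (norm (\<Sum>t\<in>?W. z t s))\<^sup>2 \<partial>M)"
    proof (rule integral_mono[OF ig])
      show "integrable M (\<lambda>s. 2 * (norm (\<Sum>t\<in>?W. G t s))\<^sup>2 + 2 * (norm (\<Sum>t\<in>?W. z t s))\<^sup>2)"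
        using iG iz by simp
      fix s
      have "(\<Sum>t\<in>?W. g_mean t s) = (\<Sum>t\<in>?W. G t s) + (\<Sum>t\<in>?W. z t s)"
        by (simp add: z_def sum_subtractf)
      then show "(norm (\<Sum>t\<in>?W. g_mean t s))\<^sup>2
          \<le> 2 * (norm (\<Sum>t\<in>?W. G t s))\<^sup>2 + 2 * (norm (\<Sum>t\<in>?W. z t s))\<^sup>2"
        using norm_add_sq_le by metis
    qed
    then show "(\<integral>s. (norm (\<Sum>t\<in>?W. g_mean t s))\<^sup>2 \<partial>M)
        \<le> 2 * (\<integral>s. (norm (\<Sum>t\<in>?W. G t s))\<^sup>2 \<partial>M) + 2 * (\<integral>s. (norm (\<Sum>t\<in>?W. z t s))\<^sup>2 \<partial>M)"
      using iG iz by simp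
  qed simp
  also have "\<dots> \<le> \<gamma>\<^sup>2 * (2 * (real \<tau> * (\<Sum>t\<in>?W. 2 * L * mean_gap t)) + 2 * (\<Sum>t\<in>?W. a * (4 * L * mean_gap t + 2 * mean_sig t)))"
    unfolding noise by (intro mult_left_mono add_mono G_le sum_mono z_le) auto
  also have "\<dots> = \<gamma>\<^sup>2 * (\<Sum>t\<in>?W. (4 * L * real \<tau> + 8 * L * a) * mean_gap t + 4 * a * mean_sig t)"
    by (simp add: sum.distrib sum_distrib_left algebra_simps)
  finally show ?thesis .
qed

text \<open>Applying all pending steps at once gives a sequence that performs undelayed steps, to
  which the classical one-step analysis applies; the error enters only because the gradient is
  taken at \<open>x k\<close>.\<close>

definition corrected where "corrected k s = x k s - e_mean k s"
definition dist_sq where "dist_sq k = (\<integral>s. (norm (corrected k s - xs))\<^sup>2 \<partial>M)"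

lemma corrected_Suc:
  "s \<in> space M \<Longrightarrow> corrected (Suc k) s = corrected k s - \<gamma> *\<^sub>R g_mean k s"
  by (simp add: corrected_def x_Suc e_Suc)

lemma dist_sq_0: "dist_sq 0 = (norm (x0 - xs))\<^sup>2"
proof -
  have "dist_sq 0 = (\<integral>s. (norm (x0 - xs))\<^sup>2 \<partial>M)"
    unfolding dist_sq_def
    by (intro Bochner_Integration.integral_cong refl) (simp add: corrected_def x_0 e_0)
  then show ?thesis by (simp add: prob_space)
qed

lemma dist_sq_nonneg: "0 \<le> dist_sq k"
  unfolding dist_sq_def by (intro integral_nonneg_AE AE_I2) simp

text \<open>Three estimates are combined: quasi strong convexity at \<open>y\<close>; the passage from \<open>y\<close> to
  \<open>y - d\<close> in the term with \<open>\<mu>\<close>, which costs \<open>\<mu> \<le> L\<close> times \<open>(norm d)\<^sup>2\<close>; and Young's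
  inequality for \<open>inner d (gradient f y)\<close>, whose gradient part uses up one of the two function gaps and
  whose other part costs \<open>2 * L\<close> times \<open>(norm d)\<^sup>2\<close>.\<close>

lemma corrected_inner_ge:
  assumes "0 \<le> \<mu>"
  shows "- 2 * inner (y - d - xs) (gradient f y)
    \<le> - (f y - f xs) - \<mu> / 2 * (norm (y - d - xs))\<^sup>2 + 3 * L * (norm d)\<^sup>2"
proof -
  let ?g = "gradient f y"
  have "f xs \<ge> f y + inner ?g (xs - y) + \<mu> / 2 * (norm (y - xs))\<^sup>2"
    using qsc unfolding quasi_strongly_convex_def by blast
  then have 1: "- 2 * inner (y - xs) ?g \<le> - 2 * (f y - f xs) - \<mu> * (norm (y - xs))\<^sup>2"
    by (simp add: inner_commute inner_diff_right algebra_simps)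
  have "(norm (y - d - xs))\<^sup>2 \<le> 2 * (norm (y - xs))\<^sup>2 + 2 * (norm d)\<^sup>2"
    using norm_add_sq_le[of "y - xs" "- d"] by (simp add: algebra_simps)
  then have "\<mu> * (norm (y - d - xs))\<^sup>2 \<le> \<mu> * (2 * (norm (y - xs))\<^sup>2 + 2 * (norm d)\<^sup>2)"
    using assms by (rule mult_left_mono)
  moreover have "\<mu> * (norm d)\<^sup>2 \<le> L * (norm d)\<^sup>2"
    using \<mu>_le_L by (rule mult_right_mono) simp
  ultimately have 2: "- \<mu> * (norm (y - xs))\<^sup>2 \<le> - \<mu> / 2 * (norm (y - d - xs))\<^sup>2 + L * (norm d)\<^sup>2"
    by (simp add: algebra_simps)
  have "0 \<le> (norm (?g - (2 * L) *\<^sub>R d))\<^sup>2" by simp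
  also have "\<dots> = (norm ?g)\<^sup>2 - 4 * L * inner d ?g + 4 * L\<^sup>2 * (norm d)\<^sup>2"
    unfolding power2_norm_eq_inner by (simp add: inner_commute algebra_simps power2_eq_square)
  also have "\<dots> \<le> 2 * L * (f y - f xs) - 4 * L * inner d ?g + 4 * L\<^sup>2 * (norm d)\<^sup>2"
    using gradient_f_sq_le[of y] by simp
  finally have "(2 * L) * (2 * inner d ?g) \<le> (2 * L) * ((f y - f xs) + 2 * L * (norm d)\<^sup>2)"
    by (simp add: algebra_simps power2_eq_square)
  then have 3: "2 * inner d ?g \<le> (f y - f xs) + 2 * L * (norm d)\<^sup>2"
    using L mult_le_cancel_left_pos[of "2 * L"] by simp
  have "- 2 * inner (y - d - xs) ?g = - 2 * inner (y - xs) ?g + 2 * inner d ?g"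
    by (simp add: inner_diff_left)
  then show ?thesis using 1 2 3 by (simp add: algebra_simps)
qed

lemma norm_diff_scaleR_sq:
  "(norm (u - c *\<^sub>R h))\<^sup>2 = (norm u)\<^sup>2 + (- 2 * c * inner u h + c\<^sup>2 * (norm h)\<^sup>2)"
  for u h :: "'b::real_inner"
  unfolding power2_norm_eq_inner
  by (simp add: inner_diff_left inner_diff_right inner_commute[of h u] power2_eq_square
      right_diff_distrib)

lemma dist_sq_Suc:
  assumes \<mu>: "0 \<le> \<mu>"
  shows "dist_sq (Suc k) \<le> (1 - \<gamma> * \<mu> / 2) * dist_sq k - \<gamma> * mean_gap k + 3 * L * \<gamma> * mean_err k
    + \<gamma>\<^sup>2 * (a * (4 * L * mean_gap k + 2 * mean_sig k))"
proof -
  define u where "u s = corrected k s - xs" for s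
  have up: "u \<in> borel_measurable (past k)"
    unfolding u_def[abs_def] corrected_def
    by (intro borel_measurable_diff x_past e_past borel_measurable_const)
  have um: "u \<in> borel_measurable M" using up by (rule measurable_past_M)
  have usq: "integrable M (\<lambda>s. (norm (u s))\<^sup>2)"
    unfolding u_def corrected_def
    by (intro integrable_norm2_diff borel_measurable_diff x_meas e_meas x_sq e_sq
        borel_measurable_const integrable_const)
  have iug: "integrable M (\<lambda>s. inner (u s) (g_mean k s))"
    by (intro integrable_inner_of_norm2 um usq g_meas g_sq)
  have iuG: "integrable M (\<lambda>s. inner (u s) (gradient f (x k s)))"
    by (intro integrable_inner_of_norm2 um usq grad_meas grad_sq)
  have "dist_sq (Suc k)
      = (\<integral>s. (norm (u s))\<^sup>2 + (- 2 * \<gamma> * inner (u s) (g_mean k s) + \<gamma>\<^sup>2 * (norm (g_mean k s))\<^sup>2) \<partial>M)"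
    unfolding dist_sq_def
  proof (intro Bochner_Integration.integral_cong refl)
    fix s assume "s \<in> space M"
    then have "corrected (Suc k) s - xs = u s - \<gamma> *\<^sub>R g_mean k s"
      by (simp add: corrected_Suc u_def)
    then show "(norm (corrected (Suc k) s - xs))\<^sup>2
        = (norm (u s))\<^sup>2 + (- 2 * \<gamma> * inner (u s) (g_mean k s) + \<gamma>\<^sup>2 * (norm (g_mean k s))\<^sup>2)"
      by (simp only: norm_diff_scaleR_sq)
  qed
  also have "\<dots> = dist_sq k + (- 2 * \<gamma> * (\<integral>s. inner (u s) (g_mean k s) \<partial>M)
      + \<gamma>\<^sup>2 * (\<integral>s. (norm (g_mean k s))\<^sup>2 \<partial>M))"
    using usq iug g_sq by (simp add: dist_sq_def u_def)
  also have "(\<integral>s. inner (u s) (g_mean k s) \<partial>M) = (\<integral>s. inner (u s) (gradient f (x k s)) \<partial>M)"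
    by (rule g_mean_unbiased_inner[OF up usq])
  finally have eq: "dist_sq (Suc k) = dist_sq k + \<gamma> * (- 2 * (\<integral>s. inner (u s) (gradient f (x k s)) \<partial>M))
      + \<gamma>\<^sup>2 * (\<integral>s. (norm (g_mean k s))\<^sup>2 \<partial>M)" by simp
  have "- 2 * (\<integral>s. inner (u s) (gradient f (x k s)) \<partial>M)
      = (\<integral>s. - 2 * inner (u s) (gradient f (x k s)) \<partial>M)" by simp
  also have "\<dots> \<le> (\<integral>s. - gap k s - \<mu> / 2 * (norm (u s))\<^sup>2 + 3 * L * (norm (e_mean k s))\<^sup>2 \<partial>M)"
  proof (rule integral_mono)
    show "integrable M (\<lambda>s. - 2 * inner (u s) (gradient f (x k s)))" using iuG by simp
    show "integrable M (\<lambda>s. - gap k s - \<mu> / 2 * (norm (u s))\<^sup>2 + 3 * L * (norm (e_mean k s))\<^sup>2)"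
      by (intro Bochner_Integration.integrable_add Bochner_Integration.integrable_diff
          Bochner_Integration.integrable_minus integrable_mult_right gap_int usq e_sq)
    show "- 2 * inner (u s) (gradient f (x k s))
        \<le> - gap k s - \<mu> / 2 * (norm (u s))\<^sup>2 + 3 * L * (norm (e_mean k s))\<^sup>2" for s
      unfolding u_def corrected_def by (rule corrected_inner_ge[OF \<mu>])
  qed
  also have "\<dots> = - mean_gap k - \<mu> / 2 * dist_sq k + 3 * L * mean_err k"
  proof -
    have "(\<integral>s. - A s - \<mu> / 2 * B s + 3 * L * C s \<partial>M)
        = - (\<integral>s. A s \<partial>M) - \<mu> / 2 * (\<integral>s. B s \<partial>M) + 3 * L * (\<integral>s. C s \<partial>M)"
      if "integrable M A" "integrable M B" "integrable M C" for A B C :: "'o \<Rightarrow> real"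
      using that by simp
    from this[OF gap_int usq e_sq] show ?thesis
      by (simp only: mean_gap_def dist_sq_def mean_err_def u_def)
  qed
  finally have "\<gamma> * (- 2 * (\<integral>s. inner (u s) (gradient f (x k s)) \<partial>M))
      \<le> \<gamma> * (- mean_gap k - \<mu> / 2 * dist_sq k + 3 * L * mean_err k)"
    using \<gamma> by (intro mult_left_mono) auto
  moreover have "\<gamma>\<^sup>2 * (\<integral>s. (norm (g_mean k s))\<^sup>2 \<partial>M) \<le> \<gamma>\<^sup>2 * (a * (4 * L * mean_gap k + 2 * mean_sig k))"
    by (intro mult_left_mono g_mean_second_moment) simp
  ultimately show ?thesis unfolding eq by (simp add: algebra_simps)
qed

end

section \<open>Small steps\<close>

text \<open>The two step-size conditions in the form in which they are used. The first makes the drift of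
  the Lyapunov function leave half of the function gap; the second makes the accumulated errors absorb
  at most a quarter of it. The second follows from the bound with \<open>1 + 2 / (1 - p)\<close> because that
  number is at least 3.\<close>

locale small_step_qlsvrgstar = delayed_qlsvrgstar +
  assumes \<mu>: "0 \<le> \<mu>"
    and step_descent: "\<gamma> * (56 * L * a) \<le> 3"
    and step_delay: "64 * (\<gamma>\<^sup>2 * L\<^sup>2 * real \<tau> * (real \<tau> + 6 * a)) \<le> 1"
begin

interpretation past: finite_measure_subalgebra M "past k" for k
  by unfold_locales (rule subalgebra_past)

abbreviation rate where "rate \<equiv> eta \<gamma> \<mu> 1 p"

definition F2 where "F2 = 12 * \<gamma>\<^sup>2 * L * real \<tau> * a * (2 + p) / p"
definition M2 where "M2 = 8 * a / (3 * p)"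
definition T0 where "T0 = (norm (x0 - xs))\<^sup>2 + M2 * \<gamma>\<^sup>2 * mean_sig 0"

lemma rate_eq: "rate = min (\<gamma> * \<mu> / 2) (p / 4)"
  using p by (simp add: eta_def)

lemma rate_nonneg: "0 \<le> rate" and rate_le_p: "rate \<le> p / 4" and rate_less_1: "rate < 1"
  using p \<gamma> \<mu> by (simp_all add: rate_eq min_le_iff_disj min_less_iff_disj)

lemma rate_le_\<mu>: "rate \<le> \<gamma> * \<mu> / 2"
  by (simp add: rate_eq)

lemma rate_window: "rate * real \<tau> \<le> 1 / 16"
proof -
  have "64 * (\<gamma>\<^sup>2 * L\<^sup>2 * real \<tau> * real \<tau>) \<le> 64 * (\<gamma>\<^sup>2 * L\<^sup>2 * real \<tau> * (real \<tau> + 6 * a))"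
    using a_ge_1 by (intro mult_left_mono) auto
  with step_delay have "(8 * \<gamma> * L * real \<tau>)\<^sup>2 \<le> 1\<^sup>2"
    by (simp add: power2_eq_square mult_ac)
  then have *: "8 * \<gamma> * L * real \<tau> \<le> 1" by (rule power2_le_imp_le) simp
  have "rate * real \<tau> \<le> \<gamma> * L / 2 * real \<tau>"
    using rate_le_\<mu> \<mu>_le_L \<gamma> by (intro mult_right_mono order_trans[OF rate_le_\<mu>]) auto
  then show ?thesis using * by simp
qed

text \<open>The windows are summed by \<open>weighted_window_sum_le\<close>, and the weighted sum of the
  \<open>mean_sig k\<close> that appears is traded for function gaps by \<open>weighted_sum_contraction\<close>. The
  second step-size condition then caps the coefficient of the gaps at 1 / 5.\<close>

lemma error_sum:
  "3 * L * (\<Sum>k=0..K. weight rate k * mean_err k)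
    \<le> 1 / 4 * (\<Sum>k=0..K. weight rate k * mean_gap k) + F2 * mean_sig 0"
proof -
  note w = weight_nonneg[OF rate_less_1]
  define R where "R = (\<Sum>k=0..K. weight rate k * mean_gap k)"
  define Z where "Z = (\<Sum>k=0..K. weight rate k * mean_sig k)"
  define c where "c t = (4 * L * real \<tau> + 8 * L * a) * mean_gap t + 4 * a * mean_sig t" for t
  define B where "B = \<gamma>\<^sup>2 * L * real \<tau>"
  have R: "0 \<le> R" unfolding R_def using w mean_gap_nonneg by (intro sum_nonneg mult_nonneg_nonneg) auto
  have B: "0 \<le> B" using L by (simp add: B_def)
  have c: "0 \<le> c t" for t
    unfolding c_def using L a_ge_1 mean_gap_nonneg mean_sig_nonneg by (intro add_nonneg_nonneg mult_nonneg_nonneg) auto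
  have Z: "Z \<le> 4 / (3 * p) * (mean_sig 0 + 2 * (L * p) * R)"
    unfolding Z_def R_def
    by (rule weighted_sum_contraction[where s = mean_sig and r = mean_gap, OF mean_sig_Suc mean_sig_nonneg p rate_nonneg rate_le_p])
  have "(\<Sum>k=0..K. weight rate k * mean_err k)
      \<le> (\<Sum>k=0..K. \<gamma>\<^sup>2 * (weight rate k * (\<Sum>t\<in>{k - \<tau>..<k}. c t)))"
    using mult_left_mono[OF mean_err_le w]
    by (intro sum_mono) (simp add: c_def mult_ac)
  also have "\<dots> = \<gamma>\<^sup>2 * (\<Sum>k=0..K. weight rate k * (\<Sum>t\<in>{k - \<tau>..<k}. c t))"
    by (simp add: sum_distrib_left)
  also have "\<dots> \<le> \<gamma>\<^sup>2 * (16 / 15 * real \<tau> * (\<Sum>t=0..K. weight rate t * c t))"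
    by (intro mult_left_mono weighted_window_sum_le c rate_nonneg rate_less_1 rate_window) simp
  also have "(\<Sum>t=0..K. weight rate t * c t) = (4 * L * real \<tau> + 8 * L * a) * R + 4 * a * Z"
    by (simp add: c_def R_def Z_def sum.distrib sum_distrib_left algebra_simps)
  finally have "3 * L * (\<Sum>k=0..K. weight rate k * mean_err k)
      \<le> 3 * L * (\<gamma>\<^sup>2 * (16 / 15 * real \<tau> * ((4 * L * real \<tau> + 8 * L * a) * R + 4 * a * Z)))"
    using L by (intro mult_left_mono) auto
  also have "\<dots> = 16 / 5 * B * ((4 * L * real \<tau> + 8 * L * a) * R + 4 * a * Z)"
    by (simp add: B_def)
  also have "\<dots> \<le> 16 / 5 * B * ((4 * L * real \<tau> + 8 * L * a) * R
      + 4 * a * (4 / (3 * p) * (mean_sig 0 + 2 * (L * p) * R)))"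
    using B a_ge_1 by (intro mult_left_mono add_left_mono Z) auto
  also have "\<dots> = 16 / 5 * B * (4 * L * real \<tau> + 56 / 3 * L * a) * R + 256 / 15 * (B * a / p * mean_sig 0)"
    using p by (simp add: field_simps)
  also have "\<dots> \<le> 1 / 4 * R + F2 * mean_sig 0"
  proof (rule add_mono)
    have "16 / 5 * B * (4 * L * real \<tau> + 56 / 3 * L * a) \<le> 16 / 5 * B * (4 * L * (real \<tau> + 6 * a))"
      using B L a_ge_1 by (intro mult_left_mono) (auto simp: algebra_simps)
    also have "\<dots> = 1 / 5 * (64 * (\<gamma>\<^sup>2 * L\<^sup>2 * real \<tau> * (real \<tau> + 6 * a)))"
      by (simp add: B_def power2_eq_square)
    also have "\<dots> \<le> 1 / 4" using step_delay by simp
    finally show "16 / 5 * B * (4 * L * real \<tau> + 56 / 3 * L * a) * R \<le> 1 / 4 * R"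
      using R by (rule mult_right_mono)
    have "256 / 15 * (B * a / p * mean_sig 0) \<le> 12 * (2 + p) * (B * a / p * mean_sig 0)"
      using B p a_ge_1 mean_sig_nonneg[of 0] by (intro mult_right_mono mult_nonneg_nonneg divide_nonneg_pos) auto
    also have "\<dots> = F2 * mean_sig 0" by (simp add: F2_def B_def)
    finally show "256 / 15 * (B * a / p * mean_sig 0) \<le> F2 * mean_sig 0" .
  qed
  finally show ?thesis by (simp only: R_def)
qed

text \<open>The factor \<open>M2\<close> is chosen so that the contraction of \<open>sig\<close> by \<open>1 - p\<close> pays for the term
  \<open>2 * a\<close> from the second moment of the estimator: \<open>M2 * (1 - p) + 2 * a = M2 * (1 - p / 4)\<close>.\<close>

lemma lyapunov_Suc:
  "dist_sq (Suc k) + M2 * \<gamma>\<^sup>2 * mean_sig (Suc k)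
    \<le> (1 - rate) * (dist_sq k + M2 * \<gamma>\<^sup>2 * mean_sig k) - \<gamma> / 2 * mean_gap k + 3 * L * \<gamma> * mean_err k"
proof -
  have M2: "0 \<le> M2" using a_ge_1 p by (simp add: M2_def)
  have "M2 * \<gamma>\<^sup>2 * mean_sig (Suc k) \<le> M2 * \<gamma>\<^sup>2 * ((1 - p) * mean_sig k + 2 * (L * p) * mean_gap k)"
    using M2 by (intro mult_left_mono mean_sig_Suc) simp
  moreover note dist_sq_Suc[OF \<mu>, of k]
  ultimately have "dist_sq (Suc k) + M2 * \<gamma>\<^sup>2 * mean_sig (Suc k)
      \<le> (1 - \<gamma> * \<mu> / 2) * dist_sq k + \<gamma>\<^sup>2 * (M2 * (1 - p) + 2 * a) * mean_sig k
        - \<gamma> * mean_gap k + \<gamma> * (\<gamma> * (2 * L * p * M2 + 4 * L * a)) * mean_gap k + 3 * L * \<gamma> * mean_err k"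
    by (simp add: algebra_simps power2_eq_square)
  moreover have "(1 - \<gamma> * \<mu> / 2) * dist_sq k \<le> (1 - rate) * dist_sq k"
    using rate_le_\<mu> dist_sq_nonneg by (intro mult_right_mono) auto
  moreover have "\<gamma>\<^sup>2 * (M2 * (1 - p) + 2 * a) * mean_sig k \<le> \<gamma>\<^sup>2 * (M2 * (1 - rate)) * mean_sig k"
  proof -
    have "M2 * (1 - p) + 2 * a = M2 * (1 - p / 4)"
      using p by (simp add: M2_def field_simps)
    also have "\<dots> \<le> M2 * (1 - rate)"
      using M2 rate_le_p by (intro mult_left_mono) auto
    finally show ?thesis
      using mean_sig_nonneg by (intro mult_right_mono mult_left_mono) auto
  qed
  moreover have "\<gamma> * (\<gamma> * (2 * L * p * M2 + 4 * L * a)) * mean_gap k \<le> \<gamma> * (1 / 2) * mean_gap k"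
  proof -
    have "\<gamma> * (2 * L * p * M2 + 4 * L * a) = 1 / 6 * (\<gamma> * (56 * L * a))"
      using p by (simp add: M2_def field_simps)
    also have "\<dots> \<le> 1 / 2" using step_descent by linarith
    finally show ?thesis
      using \<gamma> mean_gap_nonneg by (intro mult_right_mono mult_left_mono) auto
  qed
  ultimately show ?thesis by (simp add: algebra_simps)
qed

lemma gap_sum: "(\<Sum>k=0..K. weight rate k * mean_gap k) \<le> 4 * (T0 + \<gamma> * F2 * mean_sig 0) / \<gamma>"
proof -
  let ?R = "\<Sum>k=0..K. weight rate k * mean_gap k" and ?E = "\<Sum>k=0..K. weight rate k * mean_err k"
  have M2: "0 \<le> M2" using a_ge_1 p by (simp add: M2_def)
  have "\<gamma> / 2 * ?R \<le> (dist_sq 0 + M2 * \<gamma>\<^sup>2 * mean_sig 0) + 3 * L * \<gamma> * ?E"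
    using M2 dist_sq_nonneg mean_sig_nonneg
    by (intro weighted_sum_descent[where T = "\<lambda>k. dist_sq k + M2 * \<gamma>\<^sup>2 * mean_sig k" and r = mean_gap and d = mean_err,
          OF lyapunov_Suc _ rate_less_1]) simp
  also have "3 * L * \<gamma> * ?E = \<gamma> * (3 * L * ?E)" by simp
  also have "\<dots> \<le> \<gamma> * (1 / 4 * ?R + F2 * mean_sig 0)"
    using \<gamma> error_sum by (intro mult_left_mono) auto
  finally have "?R * \<gamma> \<le> 4 * (T0 + \<gamma> * F2 * mean_sig 0)"
    by (simp add: T0_def dist_sq_0 algebra_simps)
  then show ?thesis using \<gamma> by (simp add: pos_le_divide_eq)
qed

lemma parametric_assumption_holds:
  "parametric_assumption M (history M law n draw x) f xs L \<mu> \<gamma> x g_mean e_mean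
    (\<lambda>k s. 0) sig (2 * L * a) 0 (2 * a) 0 1 p 0 (L * p) 0 0 0 F2 0"
  unfolding parametric_assumption_def history_eq_past Let_def
proof (intro conjI allI ballI)
  fix k
  show "integrable M (g_mean k)" by (rule g_int)
  show "integrable M (\<lambda>s. (norm (g_mean k s))\<^sup>2)" by (rule g_sq)
  show "integrable M (\<lambda>s. 0 :: real)" by simp
  show "integrable M (sig k)" by (rule sig_int)
  show "integrable M (gap k)" by (rule gap_int)
  show "integrable M (\<lambda>s. (norm (e_mean k s))\<^sup>2)" by (rule e_sq)
  show "0 \<le> (0 :: real)" by simp
  show "0 \<le> sig k s" for s by (rule sigma_sq_nonneg)
  show "AE s in M. vec_cond_exp M (past k) (g_mean k) s = gradient f (x k s)"
    by (rule g_mean_cond)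
  show "AE s in M. real_cond_exp M (past k) (\<lambda>s. (norm (g_mean k s))\<^sup>2) s
      \<le> 2 * (2 * L * a) * gap k s + 0 * 0 + 2 * a * sig k s + 0"
    using g_mean_cond(2)[of k]
  proof eventually_elim
    case (elim s)
    also have "(1 + \<omega> / real n) * (4 * L * gap k s + 2 * sig k s) \<le> a * (4 * L * gap k s + 2 * sig k s)"
      using \<omega> L f_minimal[of "x k s"] sigma_sq_nonneg[of "\<lambda>i. w i k s"] unfolding a_def
      by (intro mult_right_mono add_left_mono divide_right_mono add_nonneg_nonneg mult_nonneg_nonneg) auto
    finally show ?case by (simp add: algebra_simps)
  qed
  have "AE s in M. real_cond_exp M (past k) (\<lambda>s. 0) s = 0"
    by (rule past.real_cond_exp_F_meas) auto
  then show "AE s in M. real_cond_exp M (past k) (\<lambda>s. 0) s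
      \<le> (1 - 1) * 0 + 2 * 0 * gap k s + 0 * 1 * sig k s + 0"
    by eventually_elim simp
  show "AE s in M. real_cond_exp M (past k) (sig (Suc k)) s
      \<le> (1 - p) * sig k s + 2 * (L * p) * gap k s"
    by (rule sig_cond)
  show "AE s in M. 3 * L * (\<Sum>j=0..k. weight rate j * (\<integral>s. (norm (e_mean j s))\<^sup>2 \<partial>M))
      \<le> 1 / 4 * (\<Sum>j=0..k. weight rate j * (\<integral>s. gap j s \<partial>M))
        + 0 * 0 + F2 * sig 0 s + \<gamma> * 0 * weight_sum rate k"
    using error_sum[of k] by (intro AE_I2) (simp add: sig_0 mean_sig_0 mean_gap_def mean_err_def)
qed

lemma weight_sum_ge: "1 \<le> (1 - rate) ^ K * weight_sum rate K"
proof -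
  have pos: "0 < 1 - rate" using rate_less_1 by simp
  \<comment> \<open>The last weight alone suffices.\<close>
  have "1 \<le> 1 / (1 - rate)" using rate_nonneg pos by simp
  also have "\<dots> = (1 - rate) ^ K * weight rate K" using pos by (simp add: weight_def)
  also have "\<dots> \<le> (1 - rate) ^ K * weight_sum rate K"
    unfolding weight_sum_def using pos weight_nonneg[OF rate_less_1]
    by (intro mult_left_mono member_le_sum) auto
  finally show ?thesis .
qed

lemma weight_sum_pos: "0 < weight_sum rate K"
  using weight_sum_ge[of K] rate_less_1
  by (metis diff_gt_0_iff_gt less_le_trans zero_less_mult_pos zero_less_one zero_less_power)

lemma averaged_gap:
  defines "xbar \<equiv> weighted_average rate x"
  shows "integrable M (\<lambda>s. f (xbar K s) - f xs)"
    and "(\<integral>s. f (xbar K s) - f xs \<partial>M) \<le> 4 * (T0 + \<gamma> * F2 * mean_sig 0) / \<gamma> / weight_sum rate K"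
proof -
  let ?W = "weight_sum rate K"
  note w = weight_nonneg[OF rate_less_1]
  have meas: "xbar K \<in> borel_measurable M"
    unfolding xbar_def weighted_average_def[abs_def]
    by (intro borel_measurable_scaleR borel_measurable_sum borel_measurable_const x_meas)
  have sq: "integrable M (\<lambda>s. (norm (xbar K s))\<^sup>2)"
    unfolding xbar_def weighted_average_def
    by (intro integrable_norm2_scaleR integrable_norm2_sum borel_measurable_scaleR
        borel_measurable_const x_meas x_sq) auto
  show int: "integrable M (\<lambda>s. f (xbar K s) - f xs)"
    by (rule f_gap_integrable[OF meas sq])
  have jensen: "f (xbar K s) - f xs \<le> (\<Sum>k=0..K. weight rate k / ?W * gap k s)" for s
  proof -
    have one: "(\<Sum>k=0..K. weight rate k / ?W) = 1"
      using weight_sum_pos[of K] by (simp add: weight_sum_def flip: sum_divide_distrib)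
    have "xbar K s = (\<Sum>k=0..K. (weight rate k / ?W) *\<^sub>R x k s)"
      by (simp add: xbar_def weighted_average_def scaleR_sum_right)
    also have "f \<dots> \<le> (\<Sum>k=0..K. weight rate k / ?W * f (x k s))"
      using w weight_sum_pos[of K]
      by (intro convex_on_sum[OF _ _ f_convex one]) (auto intro: divide_nonneg_pos)
    also have "\<dots> = (\<Sum>k=0..K. weight rate k / ?W * gap k s) + (\<Sum>k=0..K. weight rate k / ?W) * f xs"
      by (simp add: right_diff_distrib sum_subtractf sum_distrib_right)
    finally show ?thesis unfolding one by simp
  qed
  have "(\<integral>s. f (xbar K s) - f xs \<partial>M) \<le> (\<integral>s. (\<Sum>k=0..K. weight rate k / ?W * gap k s) \<partial>M)"
    using int by (intro integral_mono jensen Bochner_Integration.integrable_sum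
        integrable_mult_right gap_int)
  also have "\<dots> = (\<Sum>k=0..K. weight rate k / ?W * mean_gap k)"
  proof -
    have "(\<integral>s. (\<Sum>k=0..K. weight rate k / ?W * gap k s) \<partial>M)
        = (\<Sum>k=0..K. \<integral>s. weight rate k / ?W * gap k s \<partial>M)"
      by (intro Bochner_Integration.integral_sum integrable_mult_right gap_int)
    then show ?thesis by (simp only: integral_mult_right_zero mean_gap_def)
  qed
  also have "\<dots> = (\<Sum>k=0..K. weight rate k * mean_gap k) / ?W"
    by (simp add: sum_divide_distrib)
  also have "\<dots> \<le> 4 * (T0 + \<gamma> * F2 * mean_sig 0) / \<gamma> / ?W"
    using gap_sum weight_sum_pos[of K] by (intro divide_right_mono) auto
  finally show "(\<integral>s. f (xbar K s) - f xs \<partial>M) \<le> 4 * (T0 + \<gamma> * F2 * mean_sig 0) / \<gamma> / ?W" .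
qed

lemma constant_nonneg: "0 \<le> 4 * (T0 + \<gamma> * F2 * mean_sig 0) / \<gamma>"
  unfolding T0_def M2_def F2_def using \<gamma> L a_ge_1 p mean_sig_nonneg[of 0]
  by (intro divide_nonneg_pos mult_nonneg_nonneg add_nonneg_nonneg) auto

lemma averaged_gap_linear:
  "(\<integral>s. f (weighted_average rate x K s) - f xs \<partial>M)
    \<le> (1 - rate) ^ K * (4 * (T0 + \<gamma> * F2 * mean_sig 0) / \<gamma>)"
proof -
  define C where "C = 4 * (T0 + \<gamma> * F2 * mean_sig 0) / \<gamma>"
  have "C * 1 \<le> C * ((1 - rate) ^ K * weight_sum rate K)"
    unfolding C_def by (intro mult_left_mono weight_sum_ge constant_nonneg)
  then have "C / weight_sum rate K \<le> (1 - rate) ^ K * C"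
    using weight_sum_pos[of K] by (simp add: pos_divide_le_eq mult_ac)
  then show ?thesis
    using averaged_gap(2)[of K] unfolding C_def[symmetric] by linarith
qed

lemma averaged_gap_sublinear:
  assumes "\<mu> = 0" "1 \<le> K"
  shows "(\<integral>s. f (weighted_average rate x K s) - f xs \<partial>M)
    \<le> 4 * (T0 + \<gamma> * F2 * mean_sig 0) / (\<gamma> * real K)"
proof -
  have "rate = 0" unfolding rate_eq using assms p by simp
  then have "weight_sum rate K = real K + 1"
    by (simp add: weight_sum_def weight_def)
  then have "4 * (T0 + \<gamma> * F2 * mean_sig 0) / \<gamma> / weight_sum rate K
      \<le> 4 * (T0 + \<gamma> * F2 * mean_sig 0) / \<gamma> / real K"
    using constant_nonneg assms by (intro divide_left_mono) auto
  then show ?thesis using averaged_gap(2)[of K] by simp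
qed

end

section \<open>Convergence of the delayed method\<close>

theorem theoremK8:
  fixes F :: "nat \<Rightarrow> nat \<Rightarrow> 'a::euclidean_space \<Rightarrow> real"
    and n m \<tau> :: nat
    and L \<mu> \<omega> \<gamma> p a F2 M2 \<sigma>0sq T0 :: real
    and xs x0 :: 'a and w0 :: "nat \<Rightarrow> 'a"
    and S :: "'s measure" and Q :: "'s \<Rightarrow> 'a \<Rightarrow> 'a"
    and M :: "'o measure"
    and idx :: "nat \<Rightarrow> nat \<Rightarrow> 'o \<Rightarrow> nat"
    and seed :: "nat \<Rightarrow> nat \<Rightarrow> 'o \<Rightarrow> 's"
    and coin :: "nat \<Rightarrow> nat \<Rightarrow> 'o \<Rightarrow> bool"
    and x :: "nat \<Rightarrow> 'o \<Rightarrow> 'a"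
    and g v e w :: "nat \<Rightarrow> nat \<Rightarrow> 'o \<Rightarrow> 'a"
  assumes "n \<ge> 1" and "m \<ge> 1"
    and "\<mu> \<ge> 0"
    and "quasi_strongly_convex \<mu> (f_global n m F) xs"
    and "\<And>i j. i \<in> {1..n} \<Longrightarrow> j \<in> {1..m} \<Longrightarrow> convex_on UNIV (F i j)"
    and "\<And>i j. i \<in> {1..n} \<Longrightarrow> j \<in> {1..m} \<Longrightarrow> L_smooth L (F i j)"
    and "\<omega> > 0" and "quantization \<omega> S Q"
    and "\<tau> \<ge> 1" and "0 < p" and "p < 1"
    and "fresh_randomness M S n m p idx seed coin"
    and "delayed_framework M n \<tau> \<gamma> x0 x g v e"
    and "qlsvrgstar_estimator M n m F xs Q w0 idx seed coin x g w"
    and "a = 1 + 2 * \<omega> / real n"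
    and "0 < \<gamma>"
    and "\<gamma> \<le> min (3 / (56 * L * a))
                 (1 / (8 * L * sqrt (real \<tau> * (real \<tau> + 2 * a * (1 + 2 / (1 - p))))))"
    and "F2 = 12 * \<gamma>\<^sup>2 * L * real \<tau> * a * (2 + p) / p"
    and "M2 = 8 * a / (3 * p)"
    and "\<sigma>0sq = sigma_sq n m F xs w0"
    and "T0 = (norm (x0 - xs))\<^sup>2 + M2 * \<gamma>\<^sup>2 * \<sigma>0sq"
  shows
    "parametric_assumption M
       (history M (round_law m S p) n (draws idx seed coin) x)
       (f_global n m F) xs L \<mu> \<gamma> x (worker_mean n g) (worker_mean n e)
       (\<lambda>k s. 0) (\<lambda>k s. sigma_sq n m F xs (\<lambda>i. w i k s))
       \<comment> \<open>A', B1', B2', D1'\<close> (2 * L * a) 0 (2 * a) 0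
       \<comment> \<open>rho1, rho2\<close> 1 p
       \<comment> \<open>C1, C2, G, D2\<close> 0 (L * p) 0 0
       \<comment> \<open>F1, F2, D3\<close> 0 F2 0
     \<and> (\<forall>K. let xbar = weighted_average (eta \<gamma> \<mu> 1 p) x K in
          integrable M (\<lambda>s. f_global n m F (xbar s) - f_global n m F xs) \<and>
          (\<mu> > 0 \<longrightarrow>
            (\<integral>s. f_global n m F (xbar s) - f_global n m F xs \<partial>M)
              \<le> (1 - min (\<gamma> * \<mu> / 2) (p / 4)) ^ K * (4 * (T0 + \<gamma> * F2 * \<sigma>0sq) / \<gamma>)) \<and>
          (\<mu> = 0 \<and> K \<ge> 1 \<longrightarrow>
            (\<integral>s. f_global n m F (xbar s) - f_global n m F xs \<partial>M)
              \<le> 4 * (T0 + \<gamma> * F2 * \<sigma>0sq) / (\<gamma> * real K)))"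
proof -
  note A = assms
  have L0: "0 \<le> L"
    using L_smooth_nonneg[OF A(6)[of 1 1]] A(1,2) by simp
  \<comment> \<open>Division by 0 yields 0, so for \<open>L = 0\<close> the step-size condition would force \<open>\<gamma> \<le> 0\<close>.\<close>
  have L: "0 < L"
  proof (rule ccontr)
    assume "\<not> 0 < L"
    then show False using L0 A(16,17) by simp
  qed
  have a1: "1 \<le> a" using A(1,7,15) by simp
  have "prob_space M" using A(12) by (simp add: fresh_randomness_def)
  then interpret prob_space M .
  interpret D: delayed_qlsvrgstar M S Q \<omega> p n m idx seed coin F L \<mu> xs \<tau> \<gamma> x0 w0 x g v e w
    using A L by unfold_locales auto
  have a: "D.a = a" by (simp add: D.a_def A(15))
  let ?Z = "real \<tau> * (real \<tau> + 2 * a * (1 + 2 / (1 - p)))"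
  have "\<gamma> \<le> 3 / (56 * L * a)" using A(17) by simp
  then have step1: "\<gamma> * (56 * L * a) \<le> 3"
    using L a1 by (subst (asm) pos_le_divide_eq) auto
  have "2 \<le> 2 / (1 - p)" using A(10,11) by (simp add: pos_le_divide_eq)
  then have "2 * a * 3 \<le> 2 * a * (1 + 2 / (1 - p))"
    using a1 by (intro mult_left_mono) auto
  then have Z: "real \<tau> * (real \<tau> + 6 * a) \<le> ?Z"
    by (intro mult_left_mono) auto
  have "0 < real \<tau> * (real \<tau> + 6 * a)"
    using A(9) a1 by (intro mult_pos_pos add_pos_pos) auto
  with Z have Zpos: "0 < ?Z" by linarith
  have "\<gamma> \<le> 1 / (8 * L * sqrt ?Z)" using A(17) by simp
  then have "\<gamma> * (8 * L * sqrt ?Z) \<le> 1"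
    using L Zpos by (subst (asm) pos_le_divide_eq) auto
  then have "(\<gamma> * (8 * L * sqrt ?Z))\<^sup>2 \<le> 1\<^sup>2"
    using L Zpos A(16) by (intro power_mono) auto
  then have "64 * (\<gamma>\<^sup>2 * L\<^sup>2) * ?Z \<le> 1"
    using Zpos by (simp add: power_mult_distrib mult_ac)
  moreover have "64 * (\<gamma>\<^sup>2 * L\<^sup>2) * (real \<tau> * (real \<tau> + 6 * a)) \<le> 64 * (\<gamma>\<^sup>2 * L\<^sup>2) * ?Z"
    by (rule mult_left_mono[OF Z]) simp
  ultimately have step2: "64 * (\<gamma>\<^sup>2 * L\<^sup>2 * real \<tau> * (real \<tau> + 6 * a)) \<le> 1"
    by (simp add: mult.assoc)
  interpret D: small_step_qlsvrgstar M S Q \<omega> p n m idx seed coin F L \<mu> xs \<tau> \<gamma> x0 w0 x g v e w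
    by unfold_locales (use A(3) step1 step2 in \<open>simp_all add: a\<close>)
  have F2: "D.F2 = F2" by (simp add: D.F2_def a A(18))
  have M2: "D.M2 = M2" by (simp add: D.M2_def a A(19))
  have \<sigma>0: "D.mean_sig 0 = \<sigma>0sq" by (simp add: D.mean_sig_0 A(20))
  have T0: "D.T0 = T0" by (simp add: D.T0_def M2 \<sigma>0 A(21))
  note [simp] = a F2 \<sigma>0 T0
  show ?thesis
    using D.parametric_assumption_holds D.averaged_gap(1) D.averaged_gap_linear D.averaged_gap_sublinear
    by (simp add: Let_def D.rate_eq[symmetric])
qed

end
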